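(* Fix $\epsilon,\delta>0$. There exist positive constants $M,D,C$ depending only on $\epsilon$ and $\delta$ (not on $n$) such that for all sufficiently large $n$ and for every realization of $X$ with $k_X(n)\ge\delta n^2$, $$\mathbb{P}\big[X_n\hookrightarrow_{(M,D,C)}Y_n\,\big|\,X_n\big]\ge e^{-\epsilon n^2}.$$
   Context: $X$ and $Y$ are independent homogeneous Poisson point processes of intensity 1 on $\mathbb{R}^2$. $X_n$ (resp. $Y_n$) is the metric space (with the Euclidean metric) consisting of the points of $X$ (resp. $Y$) in $[0,n]^2$ together with the boundary $\partial[0,n]^2$. Two metric spaces $(X,d_X)$, $(Y,d_Y)$ are roughly isometric with parameters $(M,D,C)$ via $T:X\to Y$ if $\frac1M d_X(x_1,x_2)-D\le d_Y(T(x_1),T(x_2))\le M d_X(x_1,x_2)+D$ for all $x_1,x_2\in X$, and for every $y\in Y$ there is $x\in X$ with $d_Y(T(x),y)\le C$. $X_n\hookrightarrow_{(M,D,C)}Y_n$ denotes the event that there exists a rough isometry with parameters $(M,D,C)$ from $X_n$ to $Y_n$ which is the identity on $\partial[0,n]^2$. $k_X(n)$ is the number of unit squares $[j,j+1]\times[\ell,\ell+1]$ ($j,\ell\in\mathbb{Z}$) contained in $[0,n]^2$ that contain at least one point of $X$. The probability is conditional on $X$ (only $Y$ is random). *)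

theory Defs
  imports "HOL-Probability.Probability"
begin

type_synonym point = "real \<times> real"

definition square :: "nat \<Rightarrow> point set" where
  "square n = cbox (0, 0) (real n, real n)"

definition Xn :: "point set \<Rightarrow> nat \<Rightarrow> point set" where
  "Xn X n = (X \<inter> square n) \<union> frontier (square n)"

definition rough_isometry ::
  "real \<Rightarrow> real \<Rightarrow> real \<Rightarrow> point set \<Rightarrow> point set \<Rightarrow> (point \<Rightarrow> point) \<Rightarrow> bool" where
  "rough_isometry M D C A B T \<longleftrightarrow>
     T ` A \<subseteq> B \<and>
     (\<forall>x1\<in>A. \<forall>x2\<in>A. dist x1 x2 / M - D \<le> dist (T x1) (T x2)
                     \<and> dist (T x1) (T x2) \<le> M * dist x1 x2 + D) \<and>
     (\<forall>y\<in>B. \<exists>x\<in>A. dist (T x) y \<le> C)"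

definition rough_embeds :: "real \<Rightarrow> real \<Rightarrow> real \<Rightarrow> nat \<Rightarrow> point set \<Rightarrow> point set \<Rightarrow> bool" where
  "rough_embeds M D C n X Y \<longleftrightarrow>
     (\<exists>T. rough_isometry M D C (Xn X n) (Xn Y n) T \<and> (\<forall>p\<in>frontier (square n). T p = p))"

definition kX :: "point set \<Rightarrow> nat \<Rightarrow> nat" where
  "kX X n = card {(j :: int, l :: int). 0 \<le> j \<and> j + 1 \<le> int n \<and> 0 \<le> l \<and> l + 1 \<le> int n \<and>
                    (\<exists>p\<in>X. p \<in> cbox (real_of_int j, real_of_int l) (real_of_int j + 1, real_of_int l + 1))}"

text \<open>Realizations of a Poisson process are locally finite point sets.\<close>
definition locally_finite_set :: "point set \<Rightarrow> bool" where
  "locally_finite_set X \<longleftrightarrow> (\<forall>K. bounded K \<longrightarrow> finite (X \<inter> K))"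

text \<open>Law of a Poisson process of intensity 1 restricted to [0,n]^2: the number N of
  points is Poisson(n^2), and given N the points are i.i.d. uniform on [0,n]^2.
  The configuration is the set f ` {..<N}.\<close>
definition unif_points :: "nat \<Rightarrow> nat \<Rightarrow> (nat \<Rightarrow> point) measure" where
  "unif_points n N = PiM {..<N} (\<lambda>_. uniform_measure lborel (square n))"

definition poisson_weight :: "nat \<Rightarrow> nat \<Rightarrow> real" where
  "poisson_weight n N = exp (- (real n ^ 2)) * (real n ^ 2) ^ N / fact N"

text \<open>"P[Y \<cap> [0,n]^2 \<in> E] \<ge> p" for the Poisson process Y, in inner-probability form:
  there is a measurable event (for each number of points N) contained in E whose
  probability is at least p.  (For measurable E this is exactly P[E] \<ge> p.)\<close>
definition poisson_prob_ge :: "nat \<Rightarrow> (point set \<Rightarrow> bool) \<Rightarrow> real \<Rightarrow> bool" where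
  "poisson_prob_ge n E p \<longleftrightarrow>
     (\<exists>A :: nat \<Rightarrow> (nat \<Rightarrow> point) set.
        (\<forall>N. A N \<in> sets (unif_points n N) \<and> (\<forall>f\<in>A N. E (f ` {..<N}))) \<and>
        (\<Sum>N. poisson_weight n N * measure (unif_points n N) (A N)) \<ge> p)"

end

theory Submission
  imports Defs
begin

text \<open>
  Rescale the square to the unit square and let \<open>Q\<close> be the closed set of occupied cells, of area at
  least \<open>\<delta>\<close>. The heart of the proof is a bi-Lipschitz map \<open>\<phi>\<close> of the unit square, fixing the boundary,
  whose constant depends only on \<open>\<delta>\<close> and \<open>\<epsilon>\<close>, such that \<open>\<phi>(Q)\<close> has area at least \<open>1 - \<epsilon>/2\<close>. Given
  \<open>\<phi>\<close>, cut the square into blocks of large constant size and ask that every block meeting \<open>\<phi>(Q)\<close>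
  contains a fixed positive number of points of \<open>Y\<close> and that every other block contains none. This
  event has probability at least \<open>exp (- \<epsilon> n\<^sup>2)\<close>, and moving each \<open>\<phi>(x)\<close> to a point of \<open>Y\<close> in
  its block is a rough isometry.

  The map \<open>\<phi>\<close> is a composition of boundedly many shears \<open>(x, y) \<mapsto> (x, y + v(x, y))\<close> or
  \<open>(x, y) \<mapsto> (x + v(x, y), y)\<close>, each of which increases the area \<open>m\<close> of the set by a fixed multiple
  of \<open>m (1 - m)\<close>. A shear changes the area by the integral of \<open>\<partial>\<^sub>y v\<close> over the set, so \<open>v\<close> should
  have bounded gradient and \<open>\<partial>\<^sub>y v\<close> should correlate with the indicator of the set. Take for \<open>v\<close> a sum
  over dyadic cells of tents whose \<open>y\<close>-derivatives are Haar functions, cut off near the vertical sides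
  of the cell, with the Haar coefficients of the indicator as coefficients. The terms of \<open>\<partial>\<^sub>y v\<close> are
  orthogonal, those of \<open>\<partial>\<^sub>x v\<close> nearly so, hence the gain in area controls the \<open>L\<^sup>2\<close> norm of the
  gradient. Stopping the sum on every cell where the gradient has become large makes \<open>v\<close> Lipschitz, and
  by Chebyshev it loses only a fixed fraction of the gain. By Parseval the vertical and horizontal
  coefficients together carry the whole variance \<open>m (1 - m)\<close>.
\<close>

section \<open>Dyadic cells of the unit square\<close>

text \<open>The occupied cells may be arranged adversarially, so the variance is spread in an
  unknown way over dyadic levels whose number has no a priori bound. Adding the tents of all levels
  costs nothing in L^2, but the gradient is then only square integrable; the stopping makes the
  Lipschitz constant independent of the number of levels. A tent has to vanish on the whole boundary
  of its cell, so its y-derivative is only a damped Haar function. The coefficients are taken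
  against these damped functions, which makes the gain in area equal to a sum of squares; what this
  loses against the true Haar coefficients is a fixed fraction of the variance. The target area 1 -
  \<epsilon>/2 comes from the budget of the Poisson event: an empty block of area s costs exp (- s),
  so the blocks that miss the image use up at most half of the exponent \<epsilon> n^2, and the
  other half pays for the exact counts in the remaining blocks, each of which is only polynomially
  unlikely in s.\<close>

definition unit_meas :: "real measure" where
  "unit_meas = density lborel (\<lambda>x. ennreal (indicator {0..<1} x))"

definition sq_meas :: "point measure" where
  "sq_meas = unit_meas \<Otimes>\<^sub>M unit_meas"

abbreviation sq_expectation :: "(point \<Rightarrow> real) \<Rightarrow> real" (binder "\<E>" 10) where
  "sq_expectation F \<equiv> integral\<^sup>L sq_meas F"

abbreviation unit_sq :: "point set" where
  "unit_sq \<equiv> cbox (0, 0) (1, 1)"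

definition cell :: "nat \<Rightarrow> real \<Rightarrow> int" where
  "cell k x = \<lfloor>2 ^ k * x\<rfloor>"

lemma sets_unit_meas [simp, measurable_cong]: "sets unit_meas = sets borel"
  by (simp add: unit_meas_def)

lemma space_unit_meas [simp]: "space unit_meas = UNIV"
  by (simp add: unit_meas_def)

lemma sets_sq_meas [simp, measurable_cong]: "sets sq_meas = sets borel"
  unfolding sq_meas_def borel_prod[symmetric] by (rule sets_pair_measure_cong) simp_all

lemma space_sq_meas [simp]: "space sq_meas = UNIV"
  by (simp add: sq_meas_def space_pair_measure)

lemma prob_space_unit_meas: "prob_space unit_meas"
  by (rule prob_spaceI)
     (simp add: unit_meas_def emeasure_density ennreal_indicator)

interpretation unit: prob_space unit_meas by (rule prob_space_unit_meas)

interpretation sq: pair_prob_space unit_meas unit_meas by unfold_locales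

lemma sq_meas_density:
  "sq_meas = density lborel (\<lambda>p. ennreal (indicator ({0..<1} \<times> {0..<1}) p))"
proof -
  have "sq_meas = density (lborel \<Otimes>\<^sub>M lborel)
     (\<lambda>(x,y). ennreal (indicator {0..<1} x) * ennreal (indicator {0..<1} y))"
    unfolding sq_meas_def unit_meas_def
    by (rule pair_measure_density)
       (auto intro!: sigma_finite_lborel finite_measure.sigma_finite_measure
         simp: unit_meas_def[symmetric] unit.sigma_finite_measure_axioms)
  also have "\<dots> = density lborel (\<lambda>p. ennreal (indicator ({0..<1} \<times> {0..<1}) p))"
    unfolding lborel_prod
    by (rule arg_cong[where f="density lborel"]) (auto simp: fun_eq_iff indicator_def)
  finally show ?thesis .
qed

lemma prob_space_sq_meas: "prob_space sq_meas"
  unfolding sq_meas_def by (rule sq.prob_space_axioms)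

interpretation sqm: prob_space sq_meas by (rule prob_space_sq_meas)

lemma integral_sq_meas_eq:
  fixes F :: "point \<Rightarrow> real"
  assumes F[measurable]: "F \<in> borel_measurable borel" and 0: "\<And>p. p \<notin> unit_sq \<Longrightarrow> F p = 0"
  shows "(\<E> p. F p) = (\<integral>p. F p \<partial>lborel)"
proof -
  have b: "{0..<1::real} \<times> {0..<1::real} \<in> sets borel" by (intro borel_Times) auto
  have "(\<E> p. F p) = (\<integral>p. indicator ({0..<1} \<times> {0..<1}) p *\<^sub>R F p \<partial>lborel)"
    unfolding sq_meas_density by (rule integral_density) (use b in auto)
  also have "\<dots> = (\<integral>p. F p \<partial>lborel)"
  proof (rule integral_cong_AE)
    \<comment> \<open>Half-open intervals make the dyadic cells tile the square exactly. The closed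
      square has in addition only the sides x = 1 and y = 1, which lie on null lines.\<close>
    have 1: "{1::real} \<times> (UNIV::real set) \<in> null_sets lborel"
      unfolding lborel_prod[symmetric]
      by (rule null_setsI) (auto simp: lborel.emeasure_pair_measure_Times)
    have 2: "(UNIV::real set) \<times> {1::real} \<in> null_sets lborel"
      unfolding lborel_prod[symmetric]
      by (rule null_setsI) (auto simp: lborel.emeasure_pair_measure_Times)
    show "AE p in lborel. indicator ({0..<1} \<times> {0..<1}) p *\<^sub>R F p = F p"
      using AE_not_in[OF 1] AE_not_in[OF 2]
    proof eventually_elim
      case (elim p)
      show ?case
      proof (cases "p \<in> unit_sq")
        case True
        then have "p \<in> {0..<1} \<times> {0..<1}" using elim by (cases p) (auto simp: cbox_Pair_eq less_le)
        then show ?thesis by simp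
      qed (simp add: 0)
    qed
  qed (use b in auto)
  finally show ?thesis .
qed

lemma measure_sq_meas:
  assumes "A \<in> sets borel" "A \<subseteq> unit_sq"
  shows "measure sq_meas A = measure lborel A"
proof -
  have "(\<E> p. indicator A p) = (\<integral>p. indicator A p \<partial>lborel :: real)"
    by (rule integral_sq_meas_eq) (use assms in \<open>auto simp: indicator_def\<close>)
  then show ?thesis by simp
qed

lemma integrable_unit:
  assumes "F \<in> borel_measurable borel" "\<And>x. \<bar>F x\<bar> \<le> (B::real)"
  shows "integrable unit_meas F"
  by (rule unit.integrable_const_bound[where B=B]) (use assms in \<open>auto simp: unit_meas_def\<close>)

lemma integrable_sq:
  assumes "F \<in> borel_measurable borel" "\<And>x. \<bar>F x\<bar> \<le> (B::real)"
  shows "integrable sq_meas F"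
proof (rule sqm.integrable_const_bound[where B=B])
  show "F \<in> borel_measurable sq_meas"
    using assms(1) by (simp cong: measurable_cong_sets)
qed (use assms in auto)

text \<open>Cut the interval into N equal pieces and rescale each to unit length. For N a power of 2
  the pieces are dyadic cells; N = 2 and N = 16 serve to compute the integrals of
  \<open>haar\<close>, \<open>slope\<close> and the plateau defect.\<close>

lemma unit_split:
  fixes F :: "real \<Rightarrow> real"
  assumes F: "F \<in> borel_measurable borel" "\<And>x. \<bar>F x\<bar> \<le> B" and N: "N > 0"
  shows "(\<integral>y. F y \<partial>unit_meas) =
    (\<Sum>j<N. \<integral>t. F ((real j + t) / real N) \<partial>unit_meas) / real N"
proof -
  have F'[measurable]: "F \<in> borel_measurable lborel" using F by simp
  have dens: "(\<integral>y. G y \<partial>unit_meas) = (\<integral>y. indicator {0..<1} y * G y \<partial>lborel)"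
    if "G \<in> borel_measurable borel" for G :: "real \<Rightarrow> real"
    unfolding unit_meas_def using that by (subst integral_density) auto
  have ind: "indicator {0..<1} y = (\<Sum>j<N. indicator {real j / N..<(real j + 1) / N} y :: real)" for y
  proof (cases "y \<in> {0..<1::real}")
    case True
    define j where "j = nat \<lfloor>N * y\<rfloor>"
    have y: "0 \<le> y" "y < 1" using True by auto
    have f0: "0 \<le> \<lfloor>N * y\<rfloor>" using y by simp
    have "N * y < N" using y N by simp
    then have jN: "j < N" using f0 unfolding j_def by linarith
    have *: "y \<in> {real i / N..<(real i + 1) / N} \<longleftrightarrow> i = j" for i
    proof -
      have "y \<in> {real i / N..<(real i + 1) / N} \<longleftrightarrow> real i \<le> N * y \<and> N * y < real i + 1"
        using N by (simp add: field_simps)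
      also have "\<dots> \<longleftrightarrow> \<lfloor>N * y\<rfloor> = int i" by (simp add: floor_eq_iff)
      also have "\<dots> \<longleftrightarrow> i = j" using f0 unfolding j_def by linarith
      finally show ?thesis .
    qed
    have "(\<Sum>i<N. indicator {real i / N..<(real i + 1) / N} y :: real) = (\<Sum>i<N. if i = j then 1 else 0)"
      by (rule sum.cong) (simp_all only: indicator_def of_bool_def *)
    then show ?thesis using True jN by simp
  next
    case False
    have "y \<notin> {real i / N..<(real i + 1) / N}" if "i < N" for i
    proof
      assume a: "y \<in> {real i / N..<(real i + 1) / N}"
      have "0 \<le> real i / N" by simp
      moreover have "(real i + 1) / N \<le> 1" using that N by (simp add: field_simps)
      ultimately have "y \<in> {0..<1}" using a unfolding atLeastLessThan_iff by linarith
      then show False using False by simp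
    qed
    then have "(\<Sum>i<N. indicator {real i / N..<(real i + 1) / N} y :: real) = 0"
      by (intro sum.neutral) auto
    then show ?thesis using False by simp
  qed
  have int: "integrable lborel (\<lambda>y. indicator {real j / N..<(real j + 1) / N} y * F y)" for j
    by (rule integrableI_bounded_set[where A="{real j / N..<(real j + 1) / N}" and B=B])
       (use F N in \<open>auto simp: indicator_def divide_right_mono\<close>)
  have "(\<integral>y. F y \<partial>unit_meas) = (\<integral>y. (\<Sum>j<N. indicator {real j / N..<(real j + 1) / N} y * F y) \<partial>lborel)"
    by (subst dens) (use F ind in \<open>auto simp: sum_distrib_right\<close>)
  also have "\<dots> = (\<Sum>j<N. \<integral>y. indicator {real j / N..<(real j + 1) / N} y * F y \<partial>lborel)"
    using int by (rule Bochner_Integration.integral_sum)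
  also have "\<dots> = (\<Sum>j<N. (\<integral>t. F ((real j + t) / real N) \<partial>unit_meas) / real N)"
  proof (rule sum.cong)
    fix j
    have "(\<integral>y. indicator {real j / N..<(real j + 1) / N} y * F y \<partial>lborel)
      = \<bar>1 / real N\<bar> *\<^sub>R (\<integral>t. indicator {real j / N..<(real j + 1) / N} (real j / N + 1 / real N * t)
           * F (real j / N + 1 / real N * t) \<partial>lborel)"
      by (rule lborel_integral_real_affine) (use N in simp)
    also have "(\<integral>t. indicator {real j / N..<(real j + 1) / N} (real j / N + 1 / real N * t)
           * F (real j / N + 1 / real N * t) \<partial>lborel) =
        (\<integral>t. indicator {0..<1} t * F ((real j + t) / real N) \<partial>lborel)"
      by (rule Bochner_Integration.integral_cong)
         (use N in \<open>auto simp: indicator_def field_simps\<close>)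
    also have "\<dots> = (\<integral>t. F ((real j + t) / real N) \<partial>unit_meas)"
      by (rule dens[symmetric]) (use F in measurable)
    finally show "(\<integral>y. indicator {real j / N..<(real j + 1) / N} y * F y \<partial>lborel)
       = (\<integral>t. F ((real j + t) / real N) \<partial>unit_meas) / real N" by simp
  qed simp
  finally show ?thesis by (simp add: sum_divide_distrib)
qed

lemma AE_unit: "AE t in unit_meas. 0 \<le> t \<and> t < 1"
  unfolding unit_meas_def by (subst AE_density) (auto simp: indicator_def)

lemma measurable_cell [measurable]: "cell k \<in> measurable borel (count_space UNIV)"
  unfolding cell_def by measurable

text \<open>On each dyadic interval \<open>c\<close> is constant while \<open>h\<close> runs through
  one full period, so the integral factors. This is the source of every cancellation below: an
  \<open>h\<close> of mean 0 annihilates the integral whatever \<open>c\<close> is.\<close>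

lemma unit_cell_integral:
  fixes c :: "int \<Rightarrow> real" and h :: "real \<Rightarrow> real"
  assumes h [measurable]: "h \<in> borel_measurable borel" and hB: "\<And>x. \<bar>h x\<bar> \<le> B" and cB: "\<And>j. \<bar>c j\<bar> \<le> B'"
  shows "(\<integral>y. c (cell k y) * h (frac (2 ^ k * y)) \<partial>unit_meas) =
     (\<Sum>j<2 ^ k. c (int j)) / 2 ^ k * (\<integral>t. h t \<partial>unit_meas)"
proof -
  have [measurable]: "c \<in> measurable (count_space UNIV) borel" by simp
  have frac_m [measurable]: "(frac :: real \<Rightarrow> real) \<in> borel_measurable borel"
    unfolding frac_def by measurable
  have B0: "0 \<le> B" "0 \<le> B'" using hB[of 0] cB[of 0] by auto
  have "(\<integral>y. c (cell k y) * h (frac (2 ^ k * y)) \<partial>unit_meas) =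
    (\<Sum>j<2^k. \<integral>t. c (cell k ((real j + t) / real (2^k))) * h (frac (2 ^ k * ((real j + t) / real (2^k)))) \<partial>unit_meas) / real (2^k)"
    by (rule unit_split[where B="B' * B"])
       (use hB cB B0 in \<open>auto simp: abs_mult intro!: mult_mono\<close>)
  also have "(\<Sum>j<2^k. \<integral>t. c (cell k ((real j + t) / real (2^k))) * h (frac (2 ^ k * ((real j + t) / real (2^k)))) \<partial>unit_meas)
    = (\<Sum>j<2^k. c (int j) * \<integral>t. h t \<partial>unit_meas)"
  proof (rule sum.cong)
    fix j :: nat
    have "(\<integral>t. c (cell k ((real j + t) / real (2^k))) * h (frac (2 ^ k * ((real j + t) / real (2^k)))) \<partial>unit_meas)
      = (\<integral>t. c (int j) * h t \<partial>unit_meas)"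
    proof (rule integral_cong_AE)
      show "AE t in unit_meas. c (cell k ((real j + t) / real (2^k))) * h (frac (2 ^ k * ((real j + t) / real (2^k))))
         = c (int j) * h t"
        using AE_unit
      proof eventually_elim
        fix t :: real assume t: "0 \<le> t \<and> t < 1"
        then have fl: "\<lfloor>real j + t\<rfloor> = int j" by (simp add: floor_eq_iff)
        then have "frac (real j + t) = t" by (simp add: frac_def)
        then show "c (cell k ((real j + t) / real (2^k))) * h (frac (2 ^ k * ((real j + t) / real (2^k))))
         = c (int j) * h t" using fl by (simp add: cell_def)
      qed
    qed auto
    then show "(\<integral>t. c (cell k ((real j + t) / real (2^k))) * h (frac (2 ^ k * ((real j + t) / real (2^k)))) \<partial>unit_meas)
      = c (int j) * (\<integral>t. h t \<partial>unit_meas)" by simp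
  qed simp
  finally show ?thesis by (simp add: sum_distrib_right)
qed

lemma prob_unit_UNIV [simp]: "measure unit_meas UNIV = 1"
  using unit.prob_space by simp

lemma prob_sq_UNIV [simp]: "measure sq_meas UNIV = 1"
  using sqm.prob_space by simp

section \<open>Cell means as conditional expectations\<close>

abbreviation at_cell :: "(int \<Rightarrow> int \<Rightarrow> 'a) \<Rightarrow> nat \<Rightarrow> nat \<Rightarrow> point \<Rightarrow> 'a" where
  "at_cell b k l p \<equiv> b (cell k (fst p)) (cell l (snd p))"

text \<open>The factor is the reciprocal area of a cell, so on the cells of the unit square this is
  the mean of \<open>g\<close>; on all other cells it is 0.\<close>

definition coef :: "(point \<Rightarrow> real) \<Rightarrow> nat \<Rightarrow> nat \<Rightarrow> int \<Rightarrow> int \<Rightarrow> real" where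
  "coef g k l i j = 2 ^ (k + l) *
     (\<E> p. g p * of_bool (cell k (fst p) = i \<and> cell l (snd p) = j))"

abbreviation lev :: "nat \<Rightarrow> (nat \<Rightarrow> int \<Rightarrow> int \<Rightarrow> 'a) \<Rightarrow> nat \<Rightarrow> point \<Rightarrow> 'a" where
  "lev e c k \<equiv> at_cell (c k) (k + e) k"

lemma measurable_fst_borel [measurable]:
  "(fst :: point \<Rightarrow> real) \<in> borel_measurable borel"
  by (intro borel_measurable_continuous_onI continuous_on_fst continuous_on_id)

lemma measurable_snd_borel [measurable]:
  "(snd :: point \<Rightarrow> real) \<in> borel_measurable borel"
  by (intro borel_measurable_continuous_onI continuous_on_snd continuous_on_id)

lemma measurable_frac [measurable]: "(frac :: real \<Rightarrow> real) \<in> borel_measurable borel"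
  unfolding frac_def by measurable

lemma measurable_at_cell [measurable]:
  fixes b :: "int \<Rightarrow> int \<Rightarrow> real"
  shows "(\<lambda>p. at_cell b k l p) \<in> borel_measurable borel"
proof (rule measurable_compose_countable[where f="\<lambda>i p. b i (cell l (snd p))" and g="\<lambda>p. cell k (fst p)"])
  show "(\<lambda>p :: point. cell k (fst p)) \<in> borel \<rightarrow>\<^sub>M count_space UNIV"
    by (rule measurable_compose[OF measurable_fst_borel measurable_cell])
  fix i
  have "(\<lambda>p :: point. cell l (snd p)) \<in> borel \<rightarrow>\<^sub>M count_space UNIV"
    by (rule measurable_compose[OF measurable_snd_borel measurable_cell])
  then show "(\<lambda>p :: point. b i (cell l (snd p))) \<in> borel_measurable borel"
    by (rule measurable_compose) simp
qed

lemma measurable_of_bool_cell [measurable]: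
  "(\<lambda>p. of_bool (cell k (fst p) = i \<and> cell l (snd p) = j) :: real) \<in> borel_measurable borel"
  using measurable_at_cell[of "\<lambda>i' j'. of_bool (i' = i \<and> j' = j)"] by simp

lemma integral_sq_iterated:
  fixes F :: "point \<Rightarrow> real"
  assumes "F \<in> borel_measurable borel" "\<And>x. \<bar>F x\<bar> \<le> B"
  shows "(\<E> p. F p) = (\<integral>x. (\<integral>y. F (x, y) \<partial>unit_meas) \<partial>unit_meas)"
    and "(\<E> p. F p) = (\<integral>y. (\<integral>x. F (x, y) \<partial>unit_meas) \<partial>unit_meas)"
proof -
  have i: "integrable (unit_meas \<Otimes>\<^sub>M unit_meas) F"
    using integrable_sq[OF assms] by (simp add: sq_meas_def)
  show "(\<E> p. F p) = (\<integral>x. (\<integral>y. F (x, y) \<partial>unit_meas) \<partial>unit_meas)"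
    using sq.integral_fst'[OF i] by (simp add: sq_meas_def)
  show "(\<E> p. F p) = (\<integral>y. (\<integral>x. F (x, y) \<partial>unit_meas) \<partial>unit_meas)"
    using sq.integral_snd[of "\<lambda>x y. F (x, y)"] i by (simp add: sq_meas_def)
qed

lemma integral_at_cell:
  assumes "\<And>i j. \<bar>b i j\<bar> \<le> (B :: real)"
  shows "(\<E> p. at_cell b k l p) = (\<Sum>i<2^k. \<Sum>j<2^l. b (int i) (int j)) / 2 ^ (k + l)"
proof -
  have "(\<E> p. at_cell b k l p) = (\<integral>x. (\<integral>y. b (cell k x) (cell l y) \<partial>unit_meas) \<partial>unit_meas)"
    by (subst integral_sq_iterated(1)[where B=B]) (use assms in auto)
  also have "\<dots> = (\<integral>x. (\<Sum>j<2^l. b (cell k x) (int j)) / 2 ^ l \<partial>unit_meas)"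
    using unit_cell_integral[where h="\<lambda>_. 1" and B=1 and k=l and B'=B] assms by simp
  also have "\<dots> = (\<Sum>i<2^k. (\<Sum>j<2^l. b (int i) (int j)) / 2 ^ l) / 2 ^ k"
  proof -
    have "\<bar>(\<Sum>j<2^l. b i (int j)) / 2 ^ l\<bar> \<le> B" for i
    proof -
      have "\<bar>\<Sum>j<2^l. b i (int j)\<bar> \<le> (\<Sum>j<2^l::nat. B)" for i
        by (rule order.trans[OF sum_abs sum_mono]) (use assms in auto)
      then show ?thesis by (simp add: field_simps abs_divide)
    qed
    then show ?thesis
      using unit_cell_integral[where h="\<lambda>_. 1" and B=1 and k=k and B'=B and
          c="\<lambda>i. (\<Sum>j<2^l. b i (int j)) / 2 ^ l"] by simp
  qed
  finally show ?thesis by (simp add: sum_divide_distrib power_add field_simps)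
qed

lemma AE_sq_in: "AE p in sq_meas. fst p \<in> {0..<1} \<and> snd p \<in> {0..<1}"
proof -
  have m: "(\<lambda>p. ennreal (indicator ({0..<1::real} \<times> {0..<1::real}) p)) \<in> borel_measurable lborel"
    by (intro measurable_compose[OF _ measurable_ennreal] borel_measurable_indicator)
       (auto intro: borel_Times)
  show ?thesis
    unfolding sq_meas_density by (subst AE_density[OF m]) (auto simp: indicator_def)
qed

lemma cell_range:
  assumes "0 \<le> x" "x < 1"
  shows "0 \<le> cell k x" "cell k x < 2 ^ k"
proof -
  show "0 \<le> cell k x" using assms by (simp add: cell_def)
  have "2 ^ k * x < 2 ^ k" using assms by simp
  then show "cell k x < 2 ^ k" by (simp add: cell_def floor_less_iff)
qed

lemma at_cell_eq_sum:
  fixes b :: "int \<Rightarrow> int \<Rightarrow> real"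
  assumes "fst p \<in> {0..<1}" "snd p \<in> {0..<1}"
  shows "at_cell b k l p = (\<Sum>i<2^k. \<Sum>j<2^l. b (int i) (int j) *
     of_bool (cell k (fst p) = int i \<and> cell l (snd p) = int j))"
proof -
  define i0 where "i0 = nat (cell k (fst p))"
  define j0 where "j0 = nat (cell l (snd p))"
  have c: "cell k (fst p) = int i0" "cell l (snd p) = int j0"
    using cell_range[of "fst p" k] cell_range[of "snd p" l] assms unfolding i0_def j0_def by auto
  have i0: "i0 < 2^k" and j0: "j0 < 2^l"
    using cell_range[of "fst p" k] cell_range[of "snd p" l] assms unfolding c by auto
  have "(\<Sum>i<2^k. \<Sum>j<2^l. b (int i) (int j) *
     of_bool (cell k (fst p) = int i \<and> cell l (snd p) = int j))
    = (\<Sum>i<2^k. if i0 = i then (\<Sum>j<2^l. if j0 = j then b (int i) (int j) else 0) else 0)"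
    unfolding c by (intro sum.cong refl) (auto intro!: sum.cong)
  also have "\<dots> = b (int i0) (int j0)" using i0 j0 by simp
  finally show ?thesis unfolding c by simp
qed

lemma abs_coef_le:
  assumes "g \<in> borel_measurable borel" "\<And>x. \<bar>g x\<bar> \<le> 1"
  shows "\<bar>coef g k l i j\<bar> \<le> 1"
proof -
  have "\<bar>\<integral>p. g p * of_bool (cell k (fst p) = i \<and> cell l (snd p) = j) \<partial>sq_meas\<bar>
     \<le> (\<E> p. of_bool (cell k (fst p) = i \<and> cell l (snd p) = j))"
    by (rule order.trans[OF integral_abs_bound integral_mono])
       (use assms in \<open>auto intro!: integrable_sq[where B=1] simp: abs_mult\<close>)
  also have "\<dots> = (\<Sum>i'<2^k. \<Sum>j'<2^l. of_bool (int i' = i \<and> int j' = j)) / 2 ^ (k + l)"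
    using integral_at_cell[of "\<lambda>i' j'. of_bool (i' = i \<and> j' = j)" 1 k l] by simp
  also have "\<dots> \<le> 1 / 2 ^ (k + l)"
  proof (rule divide_right_mono)
    have "(\<Sum>j'<2^l. of_bool (int i' = i \<and> int j' = j) :: real) \<le> of_bool (i' = nat i)" for i'
    proof -
      have "(\<Sum>j'<2^l. of_bool (int i' = i \<and> int j' = j) :: real) \<le>
        (\<Sum>j'<2^l. if j' = nat j then of_bool (i' = nat i) else 0)"
        by (intro sum_mono) auto
      also have "\<dots> \<le> of_bool (i' = nat i)" by simp
      finally show ?thesis .
    qed
    from order.trans[OF this] have "(\<Sum>i'<2^k. \<Sum>j'<2^l. of_bool (int i' = i \<and> int j' = j) :: real) \<le>
       (\<Sum>i'<2^k. if i' = nat i then 1 else 0)"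
      by (intro sum_mono) (simp only: of_bool_def order.refl)
    also have "\<dots> \<le> 1" by simp
    finally show "(\<Sum>i'<2^k. \<Sum>j'<2^l. of_bool (int i' = i \<and> int j' = j) :: real) \<le> 1" .
  qed simp
  finally show ?thesis by (simp add: coef_def abs_mult field_simps)
qed

text \<open>The defining property of conditional expectation: against a cellwise constant function,
  \<open>g\<close> may be replaced by its cell means.\<close>

lemma integral_mult_at_cell:
  assumes g[measurable]: "g \<in> borel_measurable borel" and gB: "\<And>x. \<bar>g x\<bar> \<le> 1"
    and b: "\<And>i j. \<bar>b i j\<bar> \<le> (B :: real)"
  shows "(\<E> p. g p * at_cell b k l p) = (\<E> p. at_cell (coef g k l) k l p * at_cell b k l p)"
proof -
  let ?I = "\<lambda>i j p. of_bool (cell k (fst p) = i \<and> cell l (snd p) = j) :: real"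
  have int: "integrable sq_meas (\<lambda>p. g p * ?I i j p)" for i j
    by (rule integrable_sq[where B=1]) (use gB in \<open>auto simp: abs_mult\<close>)
  have "(\<E> p. g p * at_cell b k l p)
    = (\<E> p. (\<Sum>i<2^k. \<Sum>j<2^l. b (int i) (int j) * (g p * ?I (int i) (int j) p)))"
  proof (rule integral_cong_AE)
    show "AE p in sq_meas. g p * at_cell b k l p =
      (\<Sum>i<2^k. \<Sum>j<2^l. b (int i) (int j) * (g p * ?I (int i) (int j) p))"
      using AE_sq_in
    proof eventually_elim
      fix p :: "point" assume "fst p \<in> {0..<1} \<and> snd p \<in> {0..<1}"
      then show "g p * at_cell b k l p =
        (\<Sum>i<2^k. \<Sum>j<2^l. b (int i) (int j) * (g p * ?I (int i) (int j) p))"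
        by (subst at_cell_eq_sum) (auto simp: sum_distrib_left mult_ac)
    qed
  qed measurable
  also have "\<dots> = (\<Sum>i<2^k. \<Sum>j<2^l. b (int i) (int j) * (\<E> p. g p * ?I (int i) (int j) p))"
    using int by simp
  also have "\<dots> = (\<Sum>i<2^k. \<Sum>j<2^l. coef g k l (int i) (int j) * b (int i) (int j)) / 2 ^ (k + l)"
    by (simp add: coef_def sum_divide_distrib field_simps)
  also have "\<dots> = (\<E> p. at_cell (\<lambda>i j. coef g k l i j * b i j) k l p)"
  proof (rule integral_at_cell[symmetric, where B="B"])
    fix i j
    have "\<bar>coef g k l i j\<bar> * \<bar>b i j\<bar> \<le> 1 * B"
      by (intro mult_mono abs_coef_le) (use g gB b in auto)
    then show "\<bar>coef g k l i j * b i j\<bar> \<le> B" by (simp add: abs_mult)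
  qed
  finally show ?thesis by simp
qed

section \<open>Haar functions and Parseval\<close>

definition haar :: "real \<Rightarrow> real" where "haar t = (if t < 1/2 then 1 else - 1)"

lemma measurable_haar [measurable]: "haar \<in> borel_measurable borel"
  unfolding haar_def by measurable

lemma abs_haar [simp]: "\<bar>haar t\<bar> = 1" by (simp add: haar_def)

lemma integral_haar: "(\<integral>t. haar t \<partial>unit_meas) = 0"
proof -
  have "(\<integral>y. haar y \<partial>unit_meas) =
    (\<Sum>j<2. \<integral>t. haar ((real j + t) / real 2) \<partial>unit_meas) / real 2"
    by (rule unit_split[where B=1]) auto
  also have "(\<Sum>j<2. \<integral>t. haar ((real j + t) / real 2) \<partial>unit_meas) = (\<Sum>j<2::nat. if j = 0 then 1 else -1)"
  proof (rule sum.cong)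
    fix j :: nat assume "j \<in> {..<2}"
    then have j: "j = 0 \<or> j = 1" by auto
    have "(\<integral>t. haar ((real j + t) / real 2) \<partial>unit_meas) = (\<integral>t. (if j = 0 then 1 else -1) \<partial>unit_meas)"
    proof (rule integral_cong_AE)
      show "AE t in unit_meas. haar ((real j + t) / real 2) = (if j = 0 then 1 else -1)"
        using AE_unit by eventually_elim (use j in \<open>auto simp: haar_def\<close>)
    qed auto
    then show "(\<integral>t. haar ((real j + t) / real 2) \<partial>unit_meas) = (if j = 0 then 1 else -1)"
      by simp
  qed simp
  also have "\<dots> = 0" by (simp add: numeral_2_eq_2)
  finally show ?thesis by simp
qed

lemma cell_Suc_div: "cell k y = cell (Suc k) y div 2"
proof -
  have "\<lfloor>2 ^ k * y\<rfloor> = \<lfloor>(2 ^ Suc k * y) / of_int 2\<rfloor>" by simp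
  also have "\<dots> = \<lfloor>2 ^ Suc k * y\<rfloor> div 2" by (rule floor_divide_real_eq_div) simp
  finally show ?thesis by (simp add: cell_def)
qed

text \<open>The half of a level-k interval that contains \<open>y\<close> is the parity of its index
  at level k + 1. Hence the Haar factor is constant on all finer cells.\<close>

lemma haar_frac_cell: "haar (frac (2 ^ k * y)) = (if even (cell (Suc k) y) then 1 else - 1)"
proof -
  define z where "z = 2 ^ k * y"
  have c: "cell (Suc k) y = \<lfloor>2 * z\<rfloor>" by (simp add: cell_def z_def mult_ac)
  show ?thesis
  proof (cases "frac z < 1/2")
    case True
    then have "\<lfloor>2 * z\<rfloor> = 2 * \<lfloor>z\<rfloor>" unfolding frac_def by linarith
    then show ?thesis using True by (simp add: haar_def c z_def)
  next
    case False
    then have "\<lfloor>2 * z\<rfloor> = 2 * \<lfloor>z\<rfloor> + 1" unfolding frac_def by linarith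
    then show ?thesis using False by (simp add: haar_def c z_def)
  qed
qed

lemma coef_Suc:
  assumes g[measurable]: "g \<in> borel_measurable borel" and gB: "\<And>x. \<bar>g x\<bar> \<le> 1"
  shows "coef g k l i j = (coef g k (Suc l) i (2 * j) + coef g k (Suc l) i (2 * j + 1)) / 2"
    and "coef (\<lambda>p. g p * haar (frac (2 ^ l * snd p))) k l i j =
      (coef g k (Suc l) i (2 * j) - coef g k (Suc l) i (2 * j + 1)) / 2"
proof -
  let ?I = "\<lambda>l j p. of_bool (cell k (fst p) = i \<and> cell l (snd p) = j) :: real"
  have int: "integrable sq_meas (\<lambda>p. g p * ?I l j p)" for l j
    by (rule integrable_sq[where B=1]) (use gB in \<open>auto simp: abs_mult\<close>)
  have *: "(cell l (snd p) = j) \<longleftrightarrow> cell (Suc l) (snd p) = 2 * j \<or> cell (Suc l) (snd p) = 2 * j + 1"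
    for p :: "point"
    unfolding cell_Suc_div[of l] by presburger
  have 1: "g p * ?I l j p = g p * ?I (Suc l) (2 * j) p + g p * ?I (Suc l) (2 * j + 1) p" for p
    unfolding * by auto
  have 2: "g p * haar (frac (2 ^ l * snd p)) * ?I l j p =
     g p * ?I (Suc l) (2 * j) p - g p * ?I (Suc l) (2 * j + 1) p" for p
    unfolding * haar_frac_cell by auto
  show "coef g k l i j = (coef g k (Suc l) i (2 * j) + coef g k (Suc l) i (2 * j + 1)) / 2"
    unfolding coef_def 1 using int by (simp add: Bochner_Integration.integral_add algebra_simps)
  show "coef (\<lambda>p. g p * haar (frac (2 ^ l * snd p))) k l i j =
      (coef g k (Suc l) i (2 * j) - coef g k (Suc l) i (2 * j + 1)) / 2"
    unfolding coef_def 2 using int by (simp add: Bochner_Integration.integral_diff algebra_simps)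
qed

text \<open>The squared L^2 norm of the conditional expectation on the grid. For the indicator of a
  compact set of area m it climbs from m^2 on the trivial grid towards m, so its total increase is
  the variance.\<close>

definition energy :: "(point \<Rightarrow> real) \<Rightarrow> nat \<Rightarrow> nat \<Rightarrow> real" where
  "energy g k l = (\<E> p. (at_cell (coef g k l) k l p)\<^sup>2)"

lemma energy_eq_sum:
  assumes g: "g \<in> borel_measurable borel" "\<And>x. \<bar>g x\<bar> \<le> 1"
  shows "energy g k l = (\<Sum>i<2^k. \<Sum>j<2^l. (coef g k l (int i) (int j))\<^sup>2) / 2 ^ (k + l)"
  unfolding energy_def
  by (rule integral_at_cell[where b="\<lambda>i j. (coef g k l i j)\<^sup>2" and B=1])
     (use abs_coef_le[OF g] in \<open>simp add: abs_square_le_1\<close>)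

text \<open>Halving a cell turns its mean into (a + b) / 2 and its Haar coefficient into (a - b) /
  2, where a and b are the means of the halves; the identity for the squares does the rest.
  Telescoped, this is Parseval.\<close>

lemma energy_Suc_diff:
  assumes g[measurable]: "g \<in> borel_measurable borel" and gB: "\<And>x. \<bar>g x\<bar> \<le> 1"
  shows "energy g k (Suc l) - energy g k l = energy (\<lambda>p. g p * haar (frac (2 ^ l * snd p))) k l"
proof -
  let ?h = "\<lambda>p. g p * haar (frac (2 ^ l * snd p))"
  let ?c = "coef g k (Suc l)"
  have hm: "?h \<in> borel_measurable borel" by measurable
  have hB: "\<bar>?h x\<bar> \<le> 1" for x using gB by (simp add: abs_mult)
  have split: "(\<Sum>j<2 ^ Suc l. F j) = (\<Sum>j<2 ^ l. F (2 * j) + F (2 * j + 1))" for F :: "nat \<Rightarrow> real"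
    using sum.nat_group[of F 2 "2^l"] by (simp add: mult.commute numeral_2_eq_2 atLeast0LessThan add.commute)
  have "energy g k (Suc l) = (\<Sum>i<2^k. \<Sum>j<2^l. ((?c (int i) (2 * int j))\<^sup>2 + (?c (int i) (2 * int j + 1))\<^sup>2) / 2) / 2 ^ (k + l)"
    unfolding energy_eq_sum[OF g gB] split
    by (simp add: sum_divide_distrib[symmetric] add.commute)
  moreover have "energy g k l = (\<Sum>i<2^k. \<Sum>j<2^l. ((?c (int i) (2 * int j) + ?c (int i) (2 * int j + 1)) / 2)\<^sup>2) / 2 ^ (k + l)"
    unfolding energy_eq_sum[OF g gB] coef_Suc(1)[OF g gB, where l=l] ..
  moreover have "energy ?h k l = (\<Sum>i<2^k. \<Sum>j<2^l. ((?c (int i) (2 * int j) - ?c (int i) (2 * int j + 1)) / 2)\<^sup>2) / 2 ^ (k + l)"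
    unfolding energy_eq_sum[OF hm hB] coef_Suc(2)[OF g gB, where l=l] ..
  moreover have "((a::real)\<^sup>2 + b\<^sup>2) / 2 - ((a + b)/2)\<^sup>2 = ((a - b)/2)\<^sup>2" for a b
    by (simp add: power2_eq_square field_simps)
  ultimately show ?thesis
    by (simp add: diff_divide_distrib[symmetric] sum_subtractf[symmetric])
qed

section \<open>Haar-type functions\<close>

definition tent :: "real \<Rightarrow> real" where "tent t = max 0 (min t (1 - t))"

text \<open>The ramp width 1/16 is a compromise: it keeps the squared L^2 norm of the part cut off
  below 1/8, which can be absorbed in \<open>energy_increments_le\<close>, at the price of a
  horizontal derivative of size 16.\<close>

definition plateau :: "real \<Rightarrow> real" where "plateau t = min 1 (16 * tent t)"

definition slope :: "real \<Rightarrow> real" where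
  "slope t = (if t < 1/16 then 16 else if t < 15/16 then 0 else - 16)"

lemma tent_bounds: "0 \<le> tent t" "tent t \<le> 1/2"
  by (auto simp: tent_def max_def min_def)

lemma plateau_bounds: "0 \<le> plateau t" "plateau t \<le> 1"
  by (auto simp: plateau_def tent_def)

lemma abs_slope_le: "\<bar>slope t\<bar> \<le> 16" by (simp add: slope_def)

lemma tent_lipschitz: "\<bar>tent s - tent t\<bar> \<le> \<bar>s - t\<bar>"
  by (auto simp: tent_def max_def min_def)

lemma plateau_lipschitz: "\<bar>plateau s - plateau t\<bar> \<le> 16 * \<bar>s - t\<bar>"
proof -
  have "\<bar>plateau s - plateau t\<bar> \<le> \<bar>16 * tent s - 16 * tent t\<bar>"
  proof -
    have "\<bar>min 1 a - min 1 b\<bar> \<le> \<bar>a - b\<bar>" for a b :: real by (auto simp: min_def)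
    then show ?thesis by (simp only: plateau_def)
  qed
  also have "\<dots> = 16 * \<bar>tent s - tent t\<bar>" by (subst right_diff_distrib[symmetric]) (simp only: abs_mult abs_numeral)
  also have "\<dots> \<le> 16 * \<bar>s - t\<bar>" by (intro mult_left_mono tent_lipschitz) simp
  finally show ?thesis .
qed

lemma measurable_tent [measurable]: "tent \<in> borel_measurable borel"
  unfolding tent_def by measurable

lemma measurable_plateau [measurable]: "plateau \<in> borel_measurable borel"
  unfolding plateau_def by measurable

lemma measurable_slope [measurable]: "slope \<in> borel_measurable borel"
  unfolding slope_def by measurable

lemma cell_div:
  assumes "k \<le> m"
  shows "cell k y = cell m y div 2 ^ (m - k)"
proof -
  have "\<lfloor>2 ^ k * y\<rfloor> = \<lfloor>(2 ^ m * y) / of_int (2 ^ (m - k))\<rfloor>"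
  proof -
    have "(2::real) ^ m = 2 ^ k * 2 ^ (m - k)" using assms by (simp flip: power_add)
    then show ?thesis by simp
  qed
  also have "\<dots> = \<lfloor>2 ^ m * y\<rfloor> div 2 ^ (m - k)" by (rule floor_divide_real_eq_div) simp
  finally show ?thesis by (simp add: cell_def)
qed

lemma cell_eq_mono: "cell m y = cell m y' \<Longrightarrow> k \<le> m \<Longrightarrow> cell k y = cell k y'"
  by (simp add: cell_div)

lemma slope_frac_cell: "slope (frac (2 ^ k * y)) =
   (if cell (k + 4) y mod 16 = 0 then 16 else if cell (k + 4) y mod 16 = 15 then - 16 else 0)"
proof -
  define z where "z = 2 ^ k * y"
  have c: "cell (k + 4) y = \<lfloor>16 * z\<rfloor>" by (simp add: cell_def z_def power_add mult_ac)
  define r where "r = \<lfloor>16 * frac z\<rfloor>"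
  have "16 * z = of_int (16 * \<lfloor>z\<rfloor>) + 16 * frac z" by (simp add: frac_def)
  then have "\<lfloor>16 * z\<rfloor> = 16 * \<lfloor>z\<rfloor> + r" unfolding r_def by linarith
  moreover have "0 \<le> r" "r < 16"
    using frac_ge_0[of z] frac_lt_1[of z] unfolding r_def by (simp, linarith)
  ultimately have m: "cell (k + 4) y mod 16 = r" unfolding c by simp
  have "r = 0 \<longleftrightarrow> frac z < 1/16"
    using frac_ge_0[of z] unfolding r_def by linarith
  moreover have "r = 15 \<longleftrightarrow> 15/16 \<le> frac z"
    using frac_lt_1[of z] unfolding r_def by linarith
  ultimately show ?thesis unfolding m slope_def z_def[symmetric] by auto
qed

lemma integral_slope: "(\<integral>t. slope t \<partial>unit_meas) = 0"
proof -
  have "(\<integral>y. slope y \<partial>unit_meas) =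
    (\<Sum>j<16. \<integral>t. slope ((real j + t) / real 16) \<partial>unit_meas) / real 16"
    by (rule unit_split[where B=16]) (auto simp: abs_slope_le)
  also have "(\<Sum>j<16. \<integral>t. slope ((real j + t) / real 16) \<partial>unit_meas) =
     (\<Sum>j<16::nat. if j = 0 then 16 else if j = 15 then -16 else 0)"
  proof (rule sum.cong)
    fix j :: nat assume "j \<in> {..<16}"
    then have j: "j = 0 \<or> j = 15 \<or> 1 \<le> real j \<and> real j \<le> 14 \<and> j \<noteq> 0 \<and> j \<noteq> 15" by auto
    have "(\<integral>t. slope ((real j + t) / real 16) \<partial>unit_meas) =
       (\<integral>t. (if j = 0 then 16 else if j = 15 then -16 else 0) \<partial>unit_meas)"
    proof (rule integral_cong_AE)
      show "AE t in unit_meas. slope ((real j + t) / real 16) = (if j = 0 then 16 else if j = 15 then -16 else 0)"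
        using AE_unit by eventually_elim (use j in \<open>auto simp: slope_def\<close>)
    qed auto
    then show "(\<integral>t. slope ((real j + t) / real 16) \<partial>unit_meas) = (if j = 0 then 16 else if j = 15 then -16 else 0)"
      by simp
  qed simp
  also have "\<dots> = 0" by (simp add: eval_nat_numeral)
  finally show ?thesis by simp
qed

text \<open>The integrand vanishes except on the first and the last sixteenth, where it is at most
  1.\<close>

lemma integral_plateau_defect: "(\<integral>t. (1 - plateau t)\<^sup>2 \<partial>unit_meas) \<le> 1/8"
proof -
  have b: "0 \<le> (1 - plateau x)\<^sup>2" "(1 - plateau x)\<^sup>2 \<le> 1" for x
    using plateau_bounds[of x] by (auto simp: power_le_one_iff)
  have "(\<integral>y. (1 - plateau y)\<^sup>2 \<partial>unit_meas) =
    (\<Sum>j<16. \<integral>t. (1 - plateau ((real j + t) / real 16))\<^sup>2 \<partial>unit_meas) / real 16"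
    by (rule unit_split[where B=1]) (use b in auto)
  also have "\<dots> \<le> (\<Sum>j<16::nat. if j = 0 \<or> j = 15 then 1 else 0) / real 16"
  proof (intro divide_right_mono sum_mono)
    fix j :: nat assume "j \<in> {..<16}"
    then have j: "j = 0 \<or> j = 15 \<or> 1 \<le> real j \<and> real j \<le> 14 \<and> j \<noteq> 0 \<and> j \<noteq> 15" by auto
    have "(\<integral>t. (1 - plateau ((real j + t) / real 16))\<^sup>2 \<partial>unit_meas) \<le>
       (\<integral>t. (if j = 0 \<or> j = 15 then 1 else 0) \<partial>unit_meas)"
    proof (rule integral_mono_AE)
      show "AE t in unit_meas. (1 - plateau ((real j + t) / real 16))\<^sup>2 \<le> (if j = 0 \<or> j = 15 then 1 else 0)"
        using AE_unit
      proof eventually_elim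
        fix t :: real assume t: "0 \<le> t \<and> t < 1"
        show "(1 - plateau ((real j + t) / real 16))\<^sup>2 \<le> (if j = 0 \<or> j = 15 then 1 else 0)"
        proof (cases "j = 0 \<or> j = 15")
          case True then show ?thesis using b by auto
        next
          case False
          then have "plateau ((real j + t) / real 16) = 1"
            using j t by (auto simp: plateau_def tent_def min_def max_def)
          then show ?thesis using False by simp
        qed
      qed
    qed (use b in \<open>auto intro!: integrable_unit[where B=1]\<close>)
    then show "(\<integral>t. (1 - plateau ((real j + t) / real 16))\<^sup>2 \<partial>unit_meas) \<le> (if j = 0 \<or> j = 15 then 1 else 0)"
      by simp
  qed simp
  also have "\<dots> \<le> 1/8" by (simp add: eval_nat_numeral)
  finally show ?thesis .
qed

text \<open>\<open>vert\<close> and \<open>horiz\<close> are the partial derivatives of a single term of the displacement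
  \<open>displ\<close> below, and \<open>defect\<close> is the part of the Haar function that \<open>vert\<close> misses. The cells
  have side \<open>2\<^sup>-\<^sup>k\<close> vertically and \<open>2\<^sup>-\<^sup>k\<^sup>-\<^sup>e\<close> horizontally; \<open>e = 0\<close> serves the splitting of squares
  and \<open>e = 1\<close>, after swapping the coordinates, the splitting of half squares.\<close>

definition vert :: "nat \<Rightarrow> nat \<Rightarrow> point \<Rightarrow> real" where
  "vert e k p = plateau (frac (2 ^ (k + e) * fst p)) * haar (frac (2 ^ k * snd p))"

definition defect :: "nat \<Rightarrow> nat \<Rightarrow> point \<Rightarrow> real" where
  "defect e k p = (1 - plateau (frac (2 ^ (k + e) * fst p))) * haar (frac (2 ^ k * snd p))"

definition horiz :: "nat \<Rightarrow> nat \<Rightarrow> point \<Rightarrow> real" where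
  "horiz e k p = 2 ^ e * slope (frac (2 ^ (k + e) * fst p)) * tent (frac (2 ^ k * snd p))"

lemma measurable_vert [measurable]: "vert e k \<in> borel_measurable borel"
  unfolding vert_def by measurable

lemma measurable_defect [measurable]: "defect e k \<in> borel_measurable borel"
  unfolding defect_def by measurable

lemma measurable_horiz [measurable]: "horiz e k \<in> borel_measurable borel"
  unfolding horiz_def by measurable

lemma abs_vert_le: "\<bar>vert e k p\<bar> \<le> 1"
  using plateau_bounds by (simp add: vert_def abs_mult)

lemma abs_defect_le: "\<bar>defect e k p\<bar> \<le> 1"
  using plateau_bounds by (simp add: defect_def abs_mult)

lemma abs_horiz_le:
  assumes "e \<le> 1" shows "\<bar>horiz e k p\<bar> \<le> 16"
proof -
  have e: "(2::real) ^ e \<le> 2" using power_increasing[OF assms, of "2::real"] by simp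
  have "\<bar>horiz e k p\<bar> = 2 ^ e * (\<bar>slope (frac (2 ^ (k + e) * fst p))\<bar> * tent (frac (2 ^ k * snd p)))"
    using tent_bounds by (simp add: horiz_def abs_mult)
  also have "\<dots> \<le> 2 * (16 * (1/2))"
    by (intro mult_mono e abs_slope_le tent_bounds) (auto simp: tent_bounds)
  finally show ?thesis by simp
qed

section \<open>Orthogonality and L^2 bounds for sums over levels\<close>

lemma integral_sum_square_orthogonal:
  fixes F :: "nat \<Rightarrow> point \<Rightarrow> real"
  assumes A: "finite A" and m: "\<And>k. F k \<in> borel_measurable borel" and B: "\<And>k p. \<bar>F k p\<bar> \<le> B"
    and orth: "\<And>k m. k \<in> A \<Longrightarrow> m \<in> A \<Longrightarrow> k < m \<Longrightarrow> (\<E> p. F k p * F m p) = 0"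
  shows "(\<E> p. (\<Sum>k\<in>A. F k p)\<^sup>2) = (\<Sum>k\<in>A. \<integral>p. (F k p)\<^sup>2 \<partial>sq_meas)"
proof -
  have B0: "0 \<le> B" using B[of 0 "(0,0)"] by linarith
  have int: "integrable sq_meas (\<lambda>p. F k p * F m p)" for k m
    by (rule integrable_sq[where B="B * B"])
       (use m B B0 in \<open>auto simp: abs_mult intro!: mult_mono\<close>)
  have "(\<E> p. (\<Sum>k\<in>A. F k p)\<^sup>2) = (\<Sum>k\<in>A. \<Sum>m\<in>A. \<integral>p. F k p * F m p \<partial>sq_meas)"
    using int by (simp add: power2_eq_square sum_product)
  also have "\<dots> = (\<Sum>k\<in>A. \<Sum>m\<in>A. if k = m then \<integral>p. (F k p)\<^sup>2 \<partial>sq_meas else 0)"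
  proof (intro sum.cong refl)
    fix k m assume km: "k \<in> A" "m \<in> A"
    consider "k < m" | "k = m" | "m < k" by linarith
    then show "(\<E> p. F k p * F m p) = (if k = m then \<integral>p. (F k p)\<^sup>2 \<partial>sq_meas else 0)"
    proof cases
      case 3 then show ?thesis using orth[OF km(2,1)] by (simp add: mult.commute)
    qed (use orth km in \<open>auto simp: power2_eq_square\<close>)
  qed
  also have "\<dots> = (\<Sum>k\<in>A. \<integral>p. (F k p)\<^sup>2 \<partial>sq_meas)" using A by simp
  finally show ?thesis .
qed

text \<open>For fixed x, everything except the finer Haar factor is constant in y on the intervals
  of level m, the coarser Haar factor because k + 1 \<le> m; the finer one has mean 0 there. The
  horizontal profile \<open>u\<close> is arbitrary, so the lemma serves both \<open>vert\<close> and
  \<open>defect\<close>.\<close>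

lemma haar_orthogonal:
  fixes u :: "real \<Rightarrow> real"
  assumes u [measurable]: "u \<in> borel_measurable borel" and uB: "\<And>x. \<bar>u x\<bar> \<le> 1"
    and c: "\<And>k i j. \<bar>c k i j\<bar> \<le> 1" and km: "k < m"
  shows "(\<E> p. (lev e c k p * (u (frac (2 ^ (k + e) * fst p)) * haar (frac (2 ^ k * snd p)))) *
     (lev e c m p * (u (frac (2 ^ (m + e) * fst p)) * haar (frac (2 ^ m * snd p))))) = 0"
    (is "integral\<^sup>L sq_meas ?F = 0")
proof -
  have "(\<integral>y. ?F (x, y) \<partial>unit_meas) = 0" for x
  proof -
    define C where "C j = c k (cell (k + e) x) (j div 2 ^ (m - k)) * u (frac (2 ^ (k + e) * x)) *
      (if even (j div 2 ^ (m - Suc k)) then 1 else - 1) *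
      (c m (cell (m + e) x) j * u (frac (2 ^ (m + e) * x)))" for j
    have CB: "\<bar>C j\<bar> \<le> 1" for j
      using c uB by (auto simp: C_def abs_mult intro!: mult_le_one)
    have eq: "?F (x, y) = C (cell m y) * haar (frac (2 ^ m * y))" for y
      unfolding C_def fst_conv snd_conv haar_frac_cell[of k] cell_div[of k m y, OF less_imp_le[OF km]]
        cell_div[of "Suc k" m y, OF Suc_leI[OF km]] by (simp add: mult_ac)
    have "(\<integral>y. C (cell m y) * haar (frac (2 ^ m * y)) \<partial>unit_meas) = 0"
      by (subst unit_cell_integral[where B=1 and B'=1]) (use CB in \<open>auto simp: integral_haar\<close>)
    then show ?thesis unfolding eq .
  qed
  moreover have "\<bar>?F p\<bar> \<le> 1" for p
    using c uB by (auto simp: abs_mult intro!: mult_le_one)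
  ultimately show ?thesis
    by (subst integral_sq_iterated(1)[where B=1]) auto
qed

text \<open>At level \<open>k\<close> the slope is constant on the cells of level \<open>k + 4\<close>, so orthogonality needs a gap
  of four levels; \<open>norm_horiz_sum_le\<close> therefore splits the levels modulo 4.\<close>

lemma slope_orthogonal:
  assumes c: "\<And>k i j. \<bar>c k i j\<bar> \<le> 1" and km: "k + 4 \<le> m" and e: "e \<le> 1"
  shows "(\<E> p. (lev e c k p * horiz e k p) * (lev e c m p * horiz e m p)) = 0"
    (is "integral\<^sup>L sq_meas ?F = 0")
proof -
  \<comment> \<open>The roles of the variables are exchanged with respect to
    \<open>haar_orthogonal\<close>: the factor of mean 0 is now the slope, a function of x, so the
    integration over x comes first.\<close>
  have "(\<integral>x. ?F (x, y) \<partial>unit_meas) = 0" for y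
  proof -
    define s where "s r = (if r mod 16 = 0 then 16 else if r mod 16 = 15 then - 16 else 0 :: real)" for r :: int
    have s: "\<bar>s r\<bar> \<le> 16" for r by (simp add: s_def)
    define C where "C i = c k (i div 2 ^ (m + e - (k + e))) (cell k y) * (2 ^ e *
      s (i div 2 ^ (m + e - (k + e + 4))) * tent (frac (2 ^ k * y))) *
      (c m i (cell m y) * (2 ^ e * tent (frac (2 ^ m * y))))" for i
    have k1: "k + e \<le> m + e" and k2: "k + e + 4 \<le> m + e" using km by auto
    have eq: "?F (x, y) = C (cell (m + e) x) * slope (frac (2 ^ (m + e) * x))" for x
    proof -
      have "slope (frac (2 ^ (k + e) * x)) = s (cell (m + e) x div 2 ^ (m + e - (k + e + 4)))"
        unfolding slope_frac_cell s_def cell_div[OF k2, of x] ..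
      then show ?thesis
        unfolding C_def horiz_def fst_conv snd_conv cell_div[OF k1, of x] by simp
    qed
    have t: "\<bar>tent s\<bar> \<le> 1" for s using tent_bounds[of s] by auto
    have CB: "\<bar>C i\<bar> \<le> 1 * (2 ^ e * 16 * 1) * (1 * (2 ^ e * 1))" for i
      unfolding C_def abs_mult
      by (intro mult_mono) (use c t s in auto)
    have "(\<integral>x. C (cell (m + e) x) * slope (frac (2 ^ (m + e) * x)) \<partial>unit_meas) = 0"
      by (subst unit_cell_integral[where B=16 and B'="1 * (2 ^ e * 16 * 1) * (1 * (2 ^ e * 1))"])
         (use CB abs_slope_le in \<open>auto simp: integral_slope\<close>)
    then show ?thesis unfolding eq .
  qed
  moreover have "\<bar>?F p\<bar> \<le> (1 * 16) * (1 * 16)" for p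
    unfolding abs_mult by (intro mult_mono) (use c abs_horiz_le[OF e] in auto)
  ultimately show ?thesis
    by (subst integral_sq_iterated(2)[where B="(1 * 16) * (1 * 16)"]) auto
qed

text \<open>The squared coefficients, each weighted by the area of its cell: the common yardstick
  for the gain in area and for both partial derivatives.\<close>

definition coef_norm :: "nat \<Rightarrow> (nat \<Rightarrow> int \<Rightarrow> int \<Rightarrow> real) \<Rightarrow> nat \<Rightarrow> real" where
  "coef_norm e c K = (\<Sum>k<K. \<integral>p. (lev e c k p)\<^sup>2 \<partial>sq_meas)"

lemma abs_mult_le:
  "\<bar>a\<bar> \<le> (1::real) \<Longrightarrow> \<bar>b\<bar> \<le> B \<Longrightarrow> \<bar>a * b\<bar> \<le> B"
  using mult_mono[of "\<bar>a\<bar>" 1 "\<bar>b\<bar>" B] by (simp add: abs_mult)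

lemma square_le_of_abs_le: "\<bar>a\<bar> \<le> b \<Longrightarrow> a\<^sup>2 \<le> (b::real)\<^sup>2"
  using power_mono[of "\<bar>a\<bar>" b 2] by simp

lemma integrable_square_at_cell:
  assumes "\<And>i j. \<bar>c i j\<bar> \<le> (1::real)"
  shows "integrable sq_meas (\<lambda>p. (at_cell c k l p)\<^sup>2)"
  by (rule integrable_sq[where B=1]) (use assms in \<open>auto simp: abs_square_le_1\<close>)

lemma integrable_square:
  fixes g :: "point \<Rightarrow> real"
  assumes g[measurable]: "g \<in> borel_measurable borel" and B: "\<And>p. \<bar>g p\<bar> \<le> B"
  shows "integrable sq_meas (\<lambda>p. (g p)\<^sup>2)"
proof (rule integrable_sq[where B="B\<^sup>2"])
  show "\<bar>(g p)\<^sup>2\<bar> \<le> B\<^sup>2" for p unfolding abs_power2 by (intro square_le_of_abs_le B)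
qed measurable

lemma abs_lev_sum_le:
  assumes "\<And>k i j. \<bar>c k i j\<bar> \<le> (1::real)" "\<And>k p. \<bar>w k p\<bar> \<le> B"
  shows "\<bar>\<Sum>k\<in>A. lev e c k p * w k p\<bar> \<le> real (card A) * B"
  by (rule order.trans[OF sum_abs]) (intro sum_bounded_above abs_mult_le assms)

lemma norm_vert_sum_le:
  assumes c: "\<And>k i j. \<bar>c k i j\<bar> \<le> 1"
  shows "(\<E> p. (\<Sum>k<K. lev e c k p * vert e k p)\<^sup>2) \<le> coef_norm e c K"
proof -
  have B: "\<bar>lev e c k p * vert e k p\<bar> \<le> 1" for k p
    using c abs_vert_le by (rule abs_mult_le)
  have "(\<E> p. (\<Sum>k<K. lev e c k p * vert e k p)\<^sup>2) =
     (\<Sum>k<K. \<integral>p. (lev e c k p * vert e k p)\<^sup>2 \<partial>sq_meas)"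
    by (rule integral_sum_square_orthogonal[where B=1])
       (use B haar_orthogonal[where u=plateau and c=c, folded vert_def] c plateau_bounds in auto)
  also have "\<dots> \<le> coef_norm e c K"
    unfolding coef_norm_def
  proof (intro sum_mono integral_mono)
    fix k p
    have "(vert e k p)\<^sup>2 \<le> 1" using abs_vert_le[of e k p] by (simp add: abs_square_le_1)
    then show "(lev e c k p * vert e k p)\<^sup>2 \<le> (lev e c k p)\<^sup>2"
      by (simp add: power_mult_distrib mult_left_le)
  qed (use B c in \<open>auto intro!: integrable_square_at_cell integrable_sq[where B=1] simp: abs_square_le_1\<close>)
  finally show ?thesis .
qed

text \<open>The constant is 4 * 16^2: Cauchy-Schwarz over the four residue classes of levels, within
  each of which the terms are orthogonal and \<open>horiz\<close> is at most 16.\<close>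

lemma norm_horiz_sum_le:
  assumes c: "\<And>k i j. \<bar>c k i j\<bar> \<le> 1" and e: "e \<le> 1"
  shows "(\<E> p. (\<Sum>k<K. lev e c k p * horiz e k p)\<^sup>2) \<le> 1024 * coef_norm e c K"
proof -
  let ?F = "\<lambda>k p. lev e c k p * horiz e k p"
  define A where "A r = {k. k < K \<and> k mod 4 = r}" for r :: nat
  have B: "\<bar>?F k p\<bar> \<le> 16" for k p
    using c abs_horiz_le[OF e] by (rule abs_mult_le)
  have split: "(\<Sum>k<K. G k) = (\<Sum>r<4. \<Sum>k\<in>A r. G k)" for G :: "nat \<Rightarrow> real"
    using sum.group[of "{..<K}" "{..<4}" "\<lambda>k. k mod 4" G] by (simp add: A_def image_subset_iff)
  have fin: "finite (A r)" for r by (simp add: A_def)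
  have sqint: "integrable sq_meas (\<lambda>p. (\<Sum>k\<in>A r. ?F k p)\<^sup>2)" for r
    by (rule integrable_square[OF _ abs_lev_sum_le[OF c abs_horiz_le[OF e]]]) measurable
  have "(\<E> p. (\<Sum>k<K. ?F k p)\<^sup>2) \<le> (\<E> p. 4 * (\<Sum>r<4. (\<Sum>k\<in>A r. ?F k p)\<^sup>2))"
  proof (rule integral_mono)
    show "integrable sq_meas (\<lambda>p. (\<Sum>k<K. ?F k p)\<^sup>2)"
      by (rule integrable_square[OF _ abs_lev_sum_le[OF c abs_horiz_le[OF e]]]) measurable
    show "integrable sq_meas (\<lambda>p. 4 * (\<Sum>r<4. (\<Sum>k\<in>A r. ?F k p)\<^sup>2))"
      using sqint by simp
    show "(\<Sum>k<K. ?F k p)\<^sup>2 \<le> 4 * (\<Sum>r<4. (\<Sum>k\<in>A r. ?F k p)\<^sup>2)" for p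
      unfolding split using sum_squared_le_sum_of_squares[of "\<lambda>r. \<Sum>k\<in>A r. ?F k p" "{..<4}"]
      by (simp add: mult.commute)
  qed
  moreover have "(\<E> p. 4 * (\<Sum>r<4. (\<Sum>k\<in>A r. ?F k p)\<^sup>2)) =
      4 * (\<Sum>r<4. \<integral>p. (\<Sum>k\<in>A r. ?F k p)\<^sup>2 \<partial>sq_meas)"
    by (subst integral_mult_right_zero, subst Bochner_Integration.integral_sum) (auto intro: sqint)
  moreover have "(\<E> p. (\<Sum>k\<in>A r. ?F k p)\<^sup>2) = (\<Sum>k\<in>A r. \<integral>p. (?F k p)\<^sup>2 \<partial>sq_meas)" for r
  proof (rule integral_sum_square_orthogonal[where B=16 and F="?F"])
    fix k m assume "k \<in> A r" "m \<in> A r" "k < m"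
    then have "4 dvd m - k" and km: "k < m"
      by (auto simp: A_def mod_eq_dvd_iff_nat[symmetric])
    then have "4 \<le> m - k" by (intro dvd_imp_le) auto
    then have "k + 4 \<le> m" using km by linarith
    then show "(\<E> p. ?F k p * ?F m p) = 0" using c e by (intro slope_orthogonal)
  qed (use fin B in auto)
  moreover have "(\<E> p. (?F k p)\<^sup>2) \<le> 256 * (\<E> p. (lev e c k p)\<^sup>2)" for k
  proof -
    have "(\<E> p. (?F k p)\<^sup>2) \<le> (\<E> p. 256 * (lev e c k p)\<^sup>2)"
    proof (rule integral_mono)
      fix p
      have "(horiz e k p)\<^sup>2 \<le> 16\<^sup>2" by (intro square_le_of_abs_le abs_horiz_le e)
      then show "(?F k p)\<^sup>2 \<le> 256 * (lev e c k p)\<^sup>2"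
        by (simp add: power_mult_distrib mult.commute mult_right_mono)
    next
      show "integrable sq_meas (\<lambda>p. (?F k p)\<^sup>2)"
        by (rule integrable_square[OF _ B]) measurable
    qed (use c in \<open>auto intro!: integrable_square_at_cell\<close>)
    then show ?thesis by simp
  qed
  then have "(\<Sum>k<K. \<integral>p. (?F k p)\<^sup>2 \<partial>sq_meas) \<le> 256 * coef_norm e c K"
    unfolding coef_norm_def sum_distrib_left by (intro sum_mono)
  then have "(\<Sum>r<4. \<Sum>k\<in>A r. \<integral>p. (?F k p)\<^sup>2 \<partial>sq_meas) \<le> 256 * coef_norm e c K"
    unfolding split .
  ultimately show ?thesis by simp
qed

text \<open>For fixed y the integral over x of each squared term factors into the mean of the
  squared coefficients and the integral of (1 - \<open>plateau\<close>)^2, which supplies the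
  1/8.\<close>

lemma norm_defect_sum_le:
  assumes c: "\<And>k i j. \<bar>c k i j\<bar> \<le> 1"
  shows "(\<E> p. (\<Sum>k<K. lev e c k p * defect e k p)\<^sup>2) \<le> coef_norm e c K / 8"
proof -
  have B: "\<bar>lev e c k p * defect e k p\<bar> \<le> 1" for k p
    using c abs_defect_le by (rule abs_mult_le)
  have u: "\<bar>1 - plateau x\<bar> \<le> 1" for x using plateau_bounds[of x] by auto
  have "(\<E> p. (\<Sum>k<K. lev e c k p * defect e k p)\<^sup>2) =
     (\<Sum>k<K. \<integral>p. (lev e c k p * defect e k p)\<^sup>2 \<partial>sq_meas)"
    by (rule integral_sum_square_orthogonal[where B=1])
       (use B haar_orthogonal[where u="\<lambda>x. 1 - plateau x" and c=c, folded defect_def] c u in auto)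
  also have "\<dots> \<le> (\<Sum>k<K. (\<E> p. (lev e c k p)\<^sup>2) / 8)"
  proof (intro sum_mono)
    fix k
    let ?a = "\<lambda>y. (\<Sum>i<2 ^ (k + e). (c k (int i) (cell k y))\<^sup>2) / 2 ^ (k + e)"
    have c1: "\<bar>(c k i j)\<^sup>2\<bar> \<le> 1" for i j using c by (simp add: abs_square_le_1)
    have h1: "\<bar>(1 - plateau x)\<^sup>2\<bar> \<le> 1" for x using u by (simp add: abs_square_le_1)
    have eq: "(lev e c k p * defect e k p)\<^sup>2 =
      (lev e c k p)\<^sup>2 * (1 - plateau (frac (2 ^ (k + e) * fst p)))\<^sup>2" for p
    proof -
      have "(haar t)\<^sup>2 = 1" for t by (simp add: haar_def)
      then show ?thesis by (simp add: defect_def power_mult_distrib)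
    qed
    have "(\<E> p. (lev e c k p * defect e k p)\<^sup>2) =
      (\<integral>y. \<integral>x. (c k (cell (k + e) x) (cell k y))\<^sup>2 * (1 - plateau (frac (2 ^ (k + e) * x)))\<^sup>2 \<partial>unit_meas \<partial>unit_meas)"
      unfolding eq
      by (subst integral_sq_iterated(2)[where B=1]) (use c1 h1 in \<open>auto simp: abs_mult intro!: mult_le_one\<close>)
    also have "\<dots> = (\<integral>y. ?a y * (\<integral>t. (1 - plateau t)\<^sup>2 \<partial>unit_meas) \<partial>unit_meas)"
      by (subst unit_cell_integral[where B=1 and B'=1 and h="\<lambda>t. (1 - plateau t)\<^sup>2" and
          c="\<lambda>i. (c k i (cell k y))\<^sup>2" for y]) (use c1 h1 in auto)
    also have "\<dots> = (\<integral>t. (1 - plateau t)\<^sup>2 \<partial>unit_meas) * (\<integral>y. ?a y \<partial>unit_meas)"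
      by (simp add: mult.commute)
    also have "\<dots> \<le> (1/8) * (\<integral>y. ?a y \<partial>unit_meas)"
      by (intro mult_right_mono integral_plateau_defect Bochner_Integration.integral_nonneg
            divide_nonneg_nonneg sum_nonneg) auto
    also have "(\<integral>y. ?a y \<partial>unit_meas) = (\<integral>y. \<integral>x. (c k (cell (k + e) x) (cell k y))\<^sup>2 * 1 \<partial>unit_meas \<partial>unit_meas)"
      by (subst unit_cell_integral[where B=1 and B'=1 and h="\<lambda>t. 1" and
          c="\<lambda>i. (c k i (cell k y))\<^sup>2" for y]) (use c1 in auto)
    also have "\<dots> = (\<E> p. (lev e c k p)\<^sup>2)"
      by (subst integral_sq_iterated(2)[where B=1]) (use c1 in auto)
    finally show "(\<E> p. (lev e c k p * defect e k p)\<^sup>2) \<le>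
      (\<E> p. (lev e c k p)\<^sup>2) / 8" by simp
  qed
  finally show ?thesis by (simp add: coef_norm_def sum_divide_distrib)
qed

text \<open>The Haar factor integrates to 0 in y. This allows a constant to be subtracted from the
  indicator in \<open>energy_increments_le\<close>.\<close>

lemma integral_defect_eq_0:
  assumes c: "\<And>i j. \<bar>c i j\<bar> \<le> (1::real)"
  shows "(\<E> p. at_cell c (k + e) k p * defect e k p) = 0"
proof -
  have "(\<integral>y. c (cell (k + e) x) (cell k y) * ((1 - plateau (frac (2 ^ (k + e) * x))) * haar (frac (2 ^ k * y))) \<partial>unit_meas) = 0" for x
  proof -
    have "\<bar>c (cell (k + e) x) j * (1 - plateau (frac (2 ^ (k + e) * x)))\<bar> \<le> 1" for j
      using c plateau_bounds[of "frac (2 ^ (k + e) * x)"] by (intro abs_mult_le) auto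
    then show ?thesis
      using unit_cell_integral[where B=1 and B'=1 and h=haar and k=k and
        c="\<lambda>j. c (cell (k + e) x) j * (1 - plateau (frac (2 ^ (k + e) * x)))"]
      by (simp add: integral_haar mult.assoc)
  qed
  moreover have "\<bar>at_cell c (k + e) k p * defect e k p\<bar> \<le> 1" for p
    using c abs_defect_le by (rule abs_mult_le)
  ultimately show ?thesis
    by (subst integral_sq_iterated(1)[where B=1]) (auto simp: defect_def)
qed

text \<open>Pairing \<open>f\<close> with a sum that carries the coefficients of \<open>f\<close>
  itself gives the sum of their squares, and this survives the deletion of any set of coefficients,
  since each \<open>b k i j\<close> is either the full coefficient or 0. Hence stopping cannot
  introduce negative terms into the gain.\<close>

lemma coef_norm_eq_integral:
  assumes f[measurable]: "f \<in> borel_measurable borel" and fB: "\<And>p. \<bar>f p\<bar> \<le> 1"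
    and w[measurable]: "\<And>k. w k \<in> borel_measurable borel" and wB: "\<And>k p. \<bar>w k p\<bar> \<le> 1"
    and b: "\<And>k i j. b k i j = of_bool (P k i j) * coef (\<lambda>p. f p * w k p) (k + e) k i j"
  shows "(\<E> p. f p * (\<Sum>k<K. lev e b k p * w k p)) = coef_norm e b K"
proof -
  have fw: "\<bar>f p * w k p\<bar> \<le> 1" for k p using fB wB by (rule abs_mult_le)
  have cB: "\<bar>coef (\<lambda>p. f p * w k p) (k + e) k i j\<bar> \<le> 1" for k i j
    by (rule abs_coef_le) (use fw in auto)
  then have bB: "\<bar>b k i j\<bar> \<le> 1" for k i j unfolding b by auto
  have "(\<E> p. f p * (\<Sum>k<K. lev e b k p * w k p))
    = (\<E> p. (\<Sum>k<K. (f p * w k p) * lev e b k p))"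
    by (simp add: sum_distrib_left mult_ac)
  also have "\<dots> = (\<Sum>k<K. \<integral>p. (f p * w k p) * lev e b k p \<partial>sq_meas)"
    by (intro Bochner_Integration.integral_sum integrable_sq[where B=1] abs_mult_le fw bB) measurable
  also have "\<dots> = coef_norm e b K"
    unfolding coef_norm_def
  proof (intro sum.cong refl)
    fix k
    have "(\<E> p. (f p * w k p) * lev e b k p) =
      (\<E> p. at_cell (coef (\<lambda>p. f p * w k p) (k + e) k) (k + e) k p * lev e b k p)"
      by (rule integral_mult_at_cell[OF _ fw bB]) measurable
    also have "\<dots> = (\<E> p. (lev e b k p)\<^sup>2)"
      by (rule Bochner_Integration.integral_cong) (auto simp: b power2_eq_square)
    finally show "(\<E> p. (f p * w k p) * lev e b k p) =
       (\<E> p. (lev e b k p)\<^sup>2)" .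
  qed
  finally show ?thesis .
qed

section \<open>Stopping where the gradient is large\<close>

text \<open>The third component of \<open>stopped R sim u w k p\<close> tells whether \<open>p\<close> is still live at level \<open>k\<close>:
  the class of \<open>p\<close> dies as soon as one of the partial sums of \<open>u\<close> and \<open>w\<close> exceeds \<open>R\<close> somewhere
  on it, and no further terms are added on a dead class.\<close>

primrec stopped :: "real \<Rightarrow> (nat \<Rightarrow> 'p \<Rightarrow> 'p \<Rightarrow> bool) \<Rightarrow> (nat \<Rightarrow> 'p \<Rightarrow> real) \<Rightarrow> (nat \<Rightarrow> 'p \<Rightarrow> real) \<Rightarrow>
    nat \<Rightarrow> 'p \<Rightarrow> real \<times> real \<times> bool" where
  "stopped R sim u w 0 = (\<lambda>p. (0, 0, True))"
| "stopped R sim u w (Suc k) = (\<lambda>p.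
     let gu = (\<lambda>q. fst (stopped R sim u w k q) + of_bool (snd (snd (stopped R sim u w k q))) * u k q);
         gw = (\<lambda>q. fst (snd (stopped R sim u w k q)) + of_bool (snd (snd (stopped R sim u w k q))) * w k q)
     in (gu p, gw p, snd (snd (stopped R sim u w k p)) \<and>
          (\<forall>q. sim (Suc k) p q \<longrightarrow> \<bar>gu q\<bar> \<le> R \<and> \<bar>gw q\<bar> \<le> R)))"

text \<open>A live class has both sums at most R, so one more term gives R + C0, and a dead class is
  frozen. When a class dies, some point of it exceeds R; the oscillations of the terms on the class
  add up to a geometric series of total at most C, so every point of the class has at least R - C in
  that sum, and keeps it.\<close>

lemma stopping:
  fixes u w :: "nat \<Rightarrow> 'p \<Rightarrow> real" and sim :: "nat \<Rightarrow> 'p \<Rightarrow> 'p \<Rightarrow> bool"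
  assumes equiv: "\<And>k. equivp (sim k)" and mono: "\<And>k m p q. sim m p q \<Longrightarrow> k \<le> m \<Longrightarrow> sim k p q"
    and bound: "\<And>k p. \<bar>u k p\<bar> \<le> C0" "\<And>k p. \<bar>w k p\<bar> \<le> C0"
    and osc: "\<And>k m p q. k < m \<Longrightarrow> sim m p q \<Longrightarrow> \<bar>u k p - u k q\<bar> \<le> C / 2 ^ (m - k)"
      "\<And>k m p q. k < m \<Longrightarrow> sim m p q \<Longrightarrow> \<bar>w k p - w k q\<bar> \<le> C / 2 ^ (m - k)"
    and R: "0 \<le> R" and C: "0 \<le> C"
  obtains live :: "nat \<Rightarrow> 'p \<Rightarrow> bool" where
    "\<And>k p q. sim k p q \<Longrightarrow> live k p = live k q"
    "\<And>k m p. live m p \<Longrightarrow> k \<le> m \<Longrightarrow> live k p"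
    "\<And>K p. \<bar>\<Sum>k<K. of_bool (live k p) * u k p\<bar> \<le> R + C0"
    "\<And>K p. \<bar>\<Sum>k<K. of_bool (live k p) * w k p\<bar> \<le> R + C0"
    "\<And>K p. \<not> live K p \<Longrightarrow> R - C \<le> \<bar>\<Sum>k<K. of_bool (live k p) * u k p\<bar> \<or>
        R - C \<le> \<bar>\<Sum>k<K. of_bool (live k p) * w k p\<bar>"
proof -
  define live where "live k p = snd (snd (stopped R sim u w k p))" for k p
  define G where "G f K p = (\<Sum>k<K. of_bool (live k p) * f k p)" for f :: "nat \<Rightarrow> 'p \<Rightarrow> real" and K p
  have Gu: "fst (stopped R sim u w k p) = G u k p" for k p
    by (induction k) (auto simp: G_def live_def Let_def)
  have Gw: "fst (snd (stopped R sim u w k p)) = G w k p" for k p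
    by (induction k) (auto simp: G_def live_def Let_def)
  have G_Suc: "G f (Suc k) p = G f k p + of_bool (live k p) * f k p" for f k p
    by (simp add: G_def)
  have live_0: "live 0 p" for p by (simp add: live_def)
  have live_Suc: "live (Suc k) p \<longleftrightarrow> live k p \<and>
      (\<forall>q. sim (Suc k) p q \<longrightarrow> \<bar>G u (Suc k) q\<bar> \<le> R \<and> \<bar>G w (Suc k) q\<bar> \<le> R)" for k p
    unfolding G_Suc Gu[symmetric] Gw[symmetric] live_def by (simp add: Let_def)
  have sim_refl: "sim k p p" for k p using equiv by (rule equivp_reflp)
  have inv: "live k p = live k q" if "sim k p q" for k p q
    using that
  proof (induction k)
    case 0 then show ?case by (simp add: live_0)
  next
    case (Suc k)
    have "sim (Suc k) p r = sim (Suc k) q r" for r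
      using Suc.prems equiv[of "Suc k"] by (metis equivp_symp equivp_transp)
    moreover have "live k p = live k q" using Suc mono[of "Suc k" p q k] by simp
    ultimately show ?case unfolding live_Suc by simp
  qed
  have dec: "live k p" if "live m p" "k \<le> m" for k m p
    using that(2,1) by (induction rule: dec_induct) (auto simp: live_Suc)
  have live_bd: "\<bar>G u k p\<bar> \<le> R \<and> \<bar>G w k p\<bar> \<le> R" if "live k p" for k p
  proof (cases k)
    case 0 then show ?thesis using R by (simp add: G_def)
  next
    case (Suc j) then show ?thesis using that sim_refl[of k p] live_Suc by blast
  qed
  have C0: "0 \<le> C0" using bound(1)[of 0 undefined] by linarith
  have bd: "\<bar>G f K p\<bar> \<le> R + C0" if f: "f = u \<or> f = w" for f K p
  proof (induction K)
    case 0 then show ?case using R C0 by (simp add: G_def)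
  next
    case (Suc K)
    show ?case
    proof (cases "live K p")
      case True
      then have "\<bar>G f K p\<bar> \<le> R" using live_bd f by auto
      moreover have "\<bar>f K p\<bar> \<le> C0" using f bound by auto
      ultimately show ?thesis using True by (simp add: G_Suc)
    qed (use Suc in \<open>simp add: G_Suc\<close>)
  qed
  have geo: "(\<Sum>k<m. C / 2 ^ (m - k)) \<le> C" for m
  proof -
    have "(\<Sum>k<m. C / 2 ^ (m - k)) = C * (1 - 1 / 2 ^ m)"
    proof (induction m)
      case (Suc m)
      have "(\<Sum>k<Suc m. C / 2 ^ (Suc m - k)) = (\<Sum>k<m. (C / 2 ^ (m - k)) / 2) + C / 2"
        by (simp add: Suc_diff_le mult.commute)
      also have "\<dots> = C * (1 - 1 / 2 ^ m) / 2 + C / 2"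
        unfolding Suc[symmetric] sum_divide_distrib ..
      finally show ?case by (simp add: field_simps)
    qed simp
    also have "\<dots> \<le> C * 1" by (intro mult_left_mono C) simp
    finally show ?thesis by simp
  qed
  have G_osc: "\<bar>G f m p - G f m q\<bar> \<le> C" if f: "f = u \<or> f = w" and s: "sim m p q" for f m p q
  proof -
    have "\<bar>G f m p - G f m q\<bar> = \<bar>\<Sum>k<m. of_bool (live k p) * f k p - of_bool (live k q) * f k q\<bar>"
      by (simp add: G_def sum_subtractf)
    also have "\<dots> \<le> (\<Sum>k<m. C / 2 ^ (m - k))"
    proof (rule order.trans[OF sum_abs sum_mono])
      fix k assume "k \<in> {..<m}"
      then have km: "k < m" by simp
      have l: "live k p = live k q" using inv mono[OF s] km by simp
      have "\<bar>f k p - f k q\<bar> \<le> C / 2 ^ (m - k)" using f osc[OF km s] by auto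
      then show "\<bar>of_bool (live k p) * f k p - of_bool (live k q) * f k q\<bar> \<le> C / 2 ^ (m - k)"
        unfolding l using C by auto
    qed
    finally show ?thesis using geo[of m] by linarith
  qed
  have dead: "R - C \<le> \<bar>G u K p\<bar> \<or> R - C \<le> \<bar>G w K p\<bar>" if "\<not> live K p" for K p
    using that
  proof (induction K)
    case 0 then show ?case by (simp add: live_0)
  next
    case (Suc K)
    show ?case
    proof (cases "live K p")
      case False then show ?thesis using Suc by (simp add: G_Suc)
    next
      case True
      then obtain q where s: "sim (Suc K) p q" and "\<not> (\<bar>G u (Suc K) q\<bar> \<le> R \<and> \<bar>G w (Suc K) q\<bar> \<le> R)"
        using Suc.prems unfolding live_Suc by blast
      then consider "R < \<bar>G u (Suc K) q\<bar>" | "R < \<bar>G w (Suc K) q\<bar>" by linarith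
      then show ?thesis
        using G_osc[of u, OF disjI1[OF refl] s] G_osc[of w, OF disjI2[OF refl] s] by cases linarith+
    qed
  qed
  show thesis
    by (rule that[of live]) (use inv dec bd dead in \<open>auto simp: G_def\<close>)
qed

lemma frac_osc:
  assumes "cell m x = cell m x'" "k \<le> m"
  shows "\<bar>frac (2 ^ k * x) - frac (2 ^ k * x')\<bar> \<le> 1 / 2 ^ (m - k)"
proof -
  have "\<lfloor>2 ^ k * x\<rfloor> = \<lfloor>2 ^ k * x'\<rfloor>" using cell_eq_mono[OF assms] by (simp add: cell_def)
  then have "\<bar>frac (2 ^ k * x) - frac (2 ^ k * x')\<bar> = \<bar>2 ^ k * x - 2 ^ k * x'\<bar>" by (simp add: frac_def)
  also have "\<dots> = \<bar>2 ^ m * x - 2 ^ m * x'\<bar> / 2 ^ (m - k)"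
  proof -
    have "(2::real) ^ m = 2 ^ k * 2 ^ (m - k)" using assms by (simp flip: power_add)
    then have "2 ^ m * x - 2 ^ m * x' = (2 ^ k * x - 2 ^ k * x') * 2 ^ (m - k)"
      by (simp add: algebra_simps)
    then show ?thesis by (simp add: abs_mult)
  qed
  also have "\<dots> \<le> 1 / 2 ^ (m - k)"
  proof (rule divide_right_mono)
    have "\<lfloor>2 ^ m * x\<rfloor> = \<lfloor>2 ^ m * x'\<rfloor>" using assms by (simp add: cell_def)
    then show "\<bar>2 ^ m * x - 2 ^ m * x'\<bar> \<le> 1" by linarith
  qed simp
  finally show ?thesis .
qed

lemma vert_osc:
  assumes "k < m" "cell (m + e) (fst p) = cell (m + e) (fst q)" "cell m (snd p) = cell m (snd q)"
  shows "\<bar>vert e k p - vert e k q\<bar> \<le> 256 / 2 ^ (m - k)"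
proof -
  have h: "haar (frac (2 ^ k * snd p)) = haar (frac (2 ^ k * snd q))"
    unfolding haar_frac_cell using cell_eq_mono[OF assms(3), of "Suc k"] assms(1) by simp
  have "\<bar>vert e k p - vert e k q\<bar> =
     \<bar>(plateau (frac (2 ^ (k + e) * fst p)) - plateau (frac (2 ^ (k + e) * fst q))) * haar (frac (2 ^ k * snd q))\<bar>"
    unfolding vert_def h by (simp add: algebra_simps)
  also have "\<dots> \<le> 16 * \<bar>frac (2 ^ (k + e) * fst p) - frac (2 ^ (k + e) * fst q)\<bar>"
    by (simp add: abs_mult plateau_lipschitz)
  also have "\<dots> \<le> 16 * (1 / 2 ^ (m + e - (k + e)))"
    by (intro mult_left_mono frac_osc assms) (use assms in auto)
  also have "\<dots> \<le> 256 / 2 ^ (m - k)" by (simp add: divide_right_mono)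
  finally show ?thesis .
qed

text \<open>From four levels on, the slope is constant on the cell and only the 1-Lipschitz tent
  varies. Before that only the trivial bound 16 + 16 is available, and 32 = 256 / 2^3 dictates the
  constant, which \<open>vert_osc\<close> shares.\<close>

lemma horiz_osc:
  assumes "k < m" "cell (m + e) (fst p) = cell (m + e) (fst q)" "cell m (snd p) = cell m (snd q)"
    and e: "e \<le> 1"
  shows "\<bar>horiz e k p - horiz e k q\<bar> \<le> 256 / 2 ^ (m - k)"
proof (cases "k + 4 \<le> m")
  case True
  have s: "slope (frac (2 ^ (k + e) * fst p)) = slope (frac (2 ^ (k + e) * fst q))"
    unfolding slope_frac_cell using cell_eq_mono[OF assms(2), of "k + e + 4"] True by simp
  have e2: "(2::real) ^ e \<le> 2" using power_increasing[OF e, of "2::real"] by simp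
  have "\<bar>horiz e k p - horiz e k q\<bar> =
     2 ^ e * \<bar>slope (frac (2 ^ (k + e) * fst q))\<bar> * \<bar>tent (frac (2 ^ k * snd p)) - tent (frac (2 ^ k * snd q))\<bar>"
    unfolding horiz_def s right_diff_distrib[symmetric] by (simp add: abs_mult)
  also have "\<dots> \<le> 2 * 16 * (1 / 2 ^ (m - k))"
    by (intro mult_mono e2 abs_slope_le order.trans[OF tent_lipschitz] frac_osc assms(3)) (use assms in auto)
  also have "\<dots> \<le> 256 / 2 ^ (m - k)" by (simp add: divide_right_mono)
  finally show ?thesis .
next
  case False
  then have "(2::real) ^ (m - k) \<le> 2 ^ 3" by (intro power_increasing) auto
  then have "32 \<le> 256 / (2::real) ^ (m - k)" by (simp add: field_simps)
  then show ?thesis using abs_horiz_le[OF e, of k p] abs_horiz_le[OF e, of k q] by linarith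
qed

text \<open>Here the stopping level is \<open>R = 320\<close>, a single term is at most 16 and the oscillation of the
  partial sums on a cell at most 256: this gives the bound \<open>336 = 320 + 16\<close>, and on the dead cells one
  of the two sums is at least \<open>64 = 320 - 256\<close>, where \<open>64\<^sup>2\<close> exceeds the constant \<open>1024 + 1\<close> of
  the norm bounds.\<close>

lemma stopped_coefficients:
  fixes f :: "point \<Rightarrow> real"
  assumes f[measurable]: "f \<in> borel_measurable borel" and f01: "\<And>p. 0 \<le> f p" "\<And>p. f p \<le> 1"
    and e: "e \<le> 1"
  obtains c :: "nat \<Rightarrow> int \<Rightarrow> int \<Rightarrow> real" where
    "\<And>k i j. \<bar>c k i j\<bar> \<le> 1"
    "\<And>p. \<bar>\<Sum>k<K. lev e c k p * horiz e k p\<bar> \<le> 336"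
    "\<And>p. \<bar>\<Sum>k<K. lev e c k p * vert e k p\<bar> \<le> 336"
    "coef_norm e (\<lambda>k. coef (\<lambda>p. f p * vert e k p) (k + e) k) K / 2 \<le>
      (\<E> p. f p * (\<Sum>k<K. lev e c k p * vert e k p))"
proof -
  have fB: "\<bar>f p\<bar> \<le> 1" for p using f01[of p] by simp
  define a where "a k = coef (\<lambda>p. f p * vert e k p) (k + e) k" for k
  have aB: "\<bar>a k i j\<bar> \<le> 1" for k i j
    unfolding a_def by (rule abs_coef_le) (use abs_mult_le[OF fB abs_vert_le] in auto)
  define sim :: "nat \<Rightarrow> point \<Rightarrow> point \<Rightarrow> bool" where
    "sim k p q \<longleftrightarrow> cell (k + e) (fst p) = cell (k + e) (fst q) \<and> cell k (snd p) = cell k (snd q)" for k p q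
  define u where "u k p = lev e a k p * horiz e k p" for k p
  define w where "w k p = lev e a k p * vert e k p" for k p
  have sim_equiv: "equivp (sim k)" for k
    by (rule equivpI) (auto simp: reflp_def symp_def transp_def sim_def)
  have sim_mono: "sim k p q" if "sim m p q" "k \<le> m" for k m p q
    using that cell_eq_mono[of "m + e" "fst p" "fst q" "k + e"] cell_eq_mono[of m "snd p" "snd q" k]
    by (simp add: sim_def)
  have osc: "\<bar>lev e a k p * g p - lev e a k q * g q\<bar> \<le> 256 / 2 ^ (m - k)"
    if "k < m" "sim m p q" and g: "\<bar>g p - g q\<bar> \<le> 256 / 2 ^ (m - k)" for k m p q and g :: "point \<Rightarrow> real"
  proof -
    have "sim k p q" using sim_mono that by simp
    then have eq: "lev e a k p = lev e a k q" by (simp add: sim_def)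
    show ?thesis unfolding eq right_diff_distrib[symmetric] using aB g by (rule abs_mult_le)
  qed
  have ub: "\<bar>u k p\<bar> \<le> 16" for k p unfolding u_def using aB abs_horiz_le[OF e] by (rule abs_mult_le)
  have wb: "\<bar>w k p\<bar> \<le> 16" for k p
    unfolding w_def by (rule order.trans[OF abs_mult_le[OF aB abs_vert_le]]) simp
  have uo: "\<bar>u k p - u k q\<bar> \<le> 256 / 2 ^ (m - k)" if "k < m" "sim m p q" for k m p q
    unfolding u_def by (rule osc[OF that]) (use that horiz_osc e in \<open>simp add: sim_def\<close>)
  have wo: "\<bar>w k p - w k q\<bar> \<le> 256 / 2 ^ (m - k)" if "k < m" "sim m p q" for k m p q
    unfolding w_def by (rule osc[OF that]) (use that vert_osc in \<open>simp add: sim_def\<close>)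
  obtain live where
    inv: "\<And>k p q. sim k p q \<Longrightarrow> live k p = live k q" and
    dec: "\<And>k m p. live m p \<Longrightarrow> k \<le> m \<Longrightarrow> live k p" and
    bu: "\<And>K p. \<bar>\<Sum>k<K. of_bool (live k p) * u k p\<bar> \<le> 320 + 16" and
    bw: "\<And>K p. \<bar>\<Sum>k<K. of_bool (live k p) * w k p\<bar> \<le> 320 + 16" and
    dead: "\<And>K p. \<not> live K p \<Longrightarrow> 320 - 256 \<le> \<bar>\<Sum>k<K. of_bool (live k p) * u k p\<bar> \<or>
        320 - 256 \<le> \<bar>\<Sum>k<K. of_bool (live k p) * w k p\<bar>"
  proof (rule stopping[where sim=sim and u=u and w=w and C=256 and R=320])
    show "sim k p q" if "sim m p q" "k \<le> m" for k m p q using that by (rule sim_mono)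
  qed (rule sim_equiv, rule ub, rule wb, erule (1) uo, erule (1) wo, simp, simp, rule that)
  \<comment> \<open>\<open>live\<close> speaks of points, coefficients of cells. As
    \<open>live\<close> is constant on cells, one point of the cell decides, and stopping becomes a
    choice of coefficients: \<open>c\<close> keeps the live ones and \<open>d\<close> the dropped
    ones.\<close>
  define L where "L k i j \<longleftrightarrow> (\<exists>p. cell (k + e) (fst p) = i \<and> cell k (snd p) = j \<and> live k p)" for k i j
  have L: "lev e L k p = live k p" for k p
  proof
    assume "lev e L k p"
    then obtain q where "sim k q p" "live k q" unfolding L_def sim_def by auto
    then show "live k p" using inv by blast
  next
    assume "live k p"
    then show "lev e L k p" unfolding L_def by blast
  qed
  define c where "c k i j = of_bool (L k i j) * a k i j" for k i j
  define d where "d k i j = of_bool (\<not> L k i j) * a k i j" for k i j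
  have cB: "\<bar>c k i j\<bar> \<le> 1" and dB: "\<bar>d k i j\<bar> \<le> 1" for k i j
    using aB[of k i j] by (auto simp: c_def d_def)
  define U where "U p = (\<Sum>k<K. lev e c k p * horiz e k p)" for p
  define W where "W p = (\<Sum>k<K. lev e c k p * vert e k p)" for p
  define D where "D p = (\<Sum>k<K. lev e d k p * vert e k p)" for p
  have U_eq: "U p = (\<Sum>k<K. of_bool (live k p) * u k p)" for p
    by (simp add: U_def u_def c_def L mult.assoc)
  have W_eq: "W p = (\<Sum>k<K. of_bool (live k p) * w k p)" for p
    by (simp add: W_def w_def c_def L mult.assoc)
  have Ub: "\<bar>U p\<bar> \<le> 336" and Wb: "\<bar>W p\<bar> \<le> 336" for p
    using bu[where p=p] bw[where p=p] unfolding U_eq W_eq by auto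
  have [measurable]: "U \<in> borel_measurable borel" "W \<in> borel_measurable borel" "D \<in> borel_measurable borel"
    unfolding U_def W_def D_def by measurable
  have Db: "\<bar>D p\<bar> \<le> K" for p
    using abs_lev_sum_le[OF dB abs_vert_le, where A="{..<K}"] by (simp add: D_def)
  define dd where "dd = (\<lambda>p. of_bool (\<not> lev e L K p) :: real)"
  have [measurable]: "dd \<in> borel_measurable borel"
    unfolding dd_def using measurable_at_cell[of "\<lambda>i j. of_bool (\<not> L K i j)"] by simp
  have ddB: "\<bar>dd p\<bar> \<le> 1" for p by (simp add: dd_def)
  have nS: "coef_norm e a K = coef_norm e c K + coef_norm e d K"
  proof -
    have "(\<E> p. (lev e a k p)\<^sup>2) = (\<E> p. (lev e c k p)\<^sup>2) +
      (\<E> p. (lev e d k p)\<^sup>2)" for k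
      by (subst Bochner_Integration.integral_add[symmetric])
         (use cB dB in \<open>auto intro!: integrable_square_at_cell Bochner_Integration.integral_cong simp: c_def d_def\<close>)
    then show ?thesis by (simp add: coef_norm_def sum.distrib)
  qed
  have A: "(\<E> p. f p * W p) = coef_norm e c K"
    unfolding W_def by (rule coef_norm_eq_integral[where P=L and w="vert e"])
       (use f fB abs_vert_le in \<open>auto simp: c_def a_def\<close>)
  have "(\<E> p. f p * D p) = coef_norm e d K"
    unfolding D_def by (rule coef_norm_eq_integral[where P="\<lambda>k i j. \<not> L k i j" and w="vert e"])
       (use f fB abs_vert_le in \<open>auto simp: d_def a_def\<close>)
  \<comment> \<open>\<open>D\<close> vanishes on cells live at level K, which were live at all
    earlier levels. On the dead ones f D \<le> (1 + D^2) / 2, and the D^2 term is absorbed by the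
    norm of \<open>d\<close>, which equals the left side. So the dropped norm is at most the area of
    the dead cells.\<close>
  moreover have "(\<E> p. f p * D p) \<le> (\<E> p. dd p / 2 + (D p)\<^sup>2 / 2)"
  proof (rule integral_mono)
    show "integrable sq_meas (\<lambda>p. f p * D p)"
      by (rule integrable_sq[where B="real K"]) (use abs_mult_le[OF fB Db] in auto)
    show "integrable sq_meas (\<lambda>p. dd p / 2 + (D p)\<^sup>2 / 2)"
      using integrable_sq[of dd 1, OF _ ddB] integrable_square[OF _ Db] by simp
    fix p
    show "f p * D p \<le> dd p / 2 + (D p)\<^sup>2 / 2"
    proof (cases "live K p")
      case True
      then have "lev e d k p = 0" if "k < K" for k
        using dec[OF True, of k] that by (simp add: d_def L)
      then have "D p = 0" by (simp add: D_def)
      then show ?thesis by (simp add: dd_def)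
    next
      case False
      have "f p * D p \<le> \<bar>D p\<bar>" using abs_mult_le[OF fB[of p], of "D p" "\<bar>D p\<bar>"] by simp
      also have "\<dots> \<le> 1 / 2 + (D p)\<^sup>2 / 2"
        using zero_le_power2[of "\<bar>D p\<bar> - 1"] by (simp add: power2_eq_square algebra_simps)
      finally show ?thesis using False by (simp add: dd_def L)
    qed
  qed
  moreover have "(\<E> p. dd p / 2 + (D p)\<^sup>2 / 2) = (\<E> p. dd p) / 2 + (\<E> p. (D p)\<^sup>2) / 2"
    using integrable_sq[of dd 1, OF _ ddB] integrable_square[OF _ Db] by simp
  moreover have "(\<E> p. (D p)\<^sup>2) \<le> coef_norm e d K"
    unfolding D_def using dB by (rule norm_vert_sum_le)
  ultimately have nd: "coef_norm e d K \<le> (\<E> p. dd p)" by linarith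
  \<comment> \<open>Chebyshev: the area of the dead cells is at most the kept norm. Together with
    the previous bound, at least half of the full norm is kept.\<close>
  have "(\<E> p. 4096 * dd p) \<le> (\<E> p. (U p)\<^sup>2 + (W p)\<^sup>2)"
  proof (rule integral_mono)
    show "integrable sq_meas (\<lambda>p. 4096 * dd p)" using integrable_sq[of dd 1, OF _ ddB] by simp
    show "integrable sq_meas (\<lambda>p. (U p)\<^sup>2 + (W p)\<^sup>2)" using integrable_square[OF _ Ub] integrable_square[OF _ Wb] by simp
    fix p
    show "4096 * dd p \<le> (U p)\<^sup>2 + (W p)\<^sup>2"
    proof (cases "live K p")
      case False
      then have "64 \<le> \<bar>U p\<bar> \<or> 64 \<le> \<bar>W p\<bar>" using dead[of K p] unfolding U_eq W_eq by simp
      then have "64\<^sup>2 \<le> (U p)\<^sup>2 \<or> 64\<^sup>2 \<le> (W p)\<^sup>2"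
        using power_mono[of 64 "\<bar>U p\<bar>" 2] power_mono[of 64 "\<bar>W p\<bar>" 2] by auto
      then show ?thesis using False zero_le_power2[of "U p"] zero_le_power2[of "W p"]
        by (auto simp: dd_def L intro: add_increasing add_increasing2)
    qed (simp add: dd_def L)
  qed
  also have "\<dots> = (\<E> p. (U p)\<^sup>2) + (\<E> p. (W p)\<^sup>2)"
    using integrable_square[OF _ Ub] integrable_square[OF _ Wb] by simp
  also have "\<dots> \<le> 1024 * coef_norm e c K + coef_norm e c K"
    unfolding U_def W_def by (intro add_mono norm_horiz_sum_le norm_vert_sum_le cB e)
  finally have "4096 * integral\<^sup>L sq_meas dd \<le> 1025 * coef_norm e c K" by simp
  also have "1025 * coef_norm e c K \<le> 4096 * coef_norm e c K"
    by (intro mult_right_mono) (simp_all add: coef_norm_def sum_nonneg)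
  finally have "integral\<^sup>L sq_meas dd \<le> coef_norm e c K" by simp
  then have "coef_norm e d K \<le> coef_norm e c K" using nd by simp
  then have "coef_norm e a K / 2 \<le> (\<E> p. f p * W p)"
    unfolding A nS by simp
  moreover have "a = (\<lambda>k. coef (\<lambda>p. f p * vert e k p) (k + e) k)" by (simp add: a_def fun_eq_iff)
  ultimately show thesis
    by (intro that[of c]) (use cB Ub Wb in \<open>auto simp: U_def W_def\<close>)
qed

text \<open>Each Haar coefficient is the sum of a damped one and a defect one, and (a + r)^2 \<le> 2
  a^2 + 2 r^2. The defect norm is controlled by duality: it is the pairing of \<open>f\<close> with
  its own defect sum, whose L^2 norm is small compared with the coefficients. The error has to be a
  fraction of m (1 - m), and not merely of m, to be of use when m is close to 1.\<close>

lemma energy_increments_le: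
  fixes f :: "point \<Rightarrow> real"
  assumes f[measurable]: "f \<in> borel_measurable borel" and f01: "\<And>p. f p = 0 \<or> f p = 1"
  shows "(\<Sum>k<K. energy f (k + e) (Suc k) - energy f (k + e) k) \<le>
    2 * coef_norm e (\<lambda>k. coef (\<lambda>p. f p * vert e k p) (k + e) k) K +
    (\<E> p. f p) * (1 - (\<E> p. f p)) / 4"
proof -
  have fB: "\<bar>f p\<bar> \<le> 1" for p using f01[of p] by auto
  define a where "a k = coef (\<lambda>p. f p * vert e k p) (k + e) k" for k
  define r where "r k = coef (\<lambda>p. f p * defect e k p) (k + e) k" for k
  have aB: "\<bar>a k i j\<bar> \<le> 1" for k i j
    unfolding a_def by (rule abs_coef_le) (use abs_mult_le[OF fB abs_vert_le] in auto)
  have rB: "\<bar>r k i j\<bar> \<le> 1" for k i j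
    unfolding r_def by (rule abs_coef_le) (use abs_mult_le[OF fB abs_defect_le] in auto)
  define m where "m = (\<E> p. f p)"
  have inc: "energy f (k + e) (Suc k) - energy f (k + e) k \<le>
     2 * (\<E> p. (lev e a k p)\<^sup>2) + 2 * (\<E> p. (lev e r k p)\<^sup>2)" for k
  proof -
    have co: "coef (\<lambda>p. f p * haar (frac (2 ^ k * snd p))) (k + e) k i j = a k i j + r k i j" for i j
    proof -
      let ?I = "\<lambda>p. of_bool (cell (k + e) (fst p) = i \<and> cell k (snd p) = j) :: real"
      have "(\<E> p. f p * haar (frac (2 ^ k * snd p)) * ?I p) =
        (\<E> p. f p * vert e k p * ?I p + f p * defect e k p * ?I p)"
        by (rule Bochner_Integration.integral_cong) (auto simp: vert_def defect_def algebra_simps)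
      also have "\<dots> = (\<E> p. f p * vert e k p * ?I p) + (\<E> p. f p * defect e k p * ?I p)"
        by (intro Bochner_Integration.integral_add integrable_sq[where B=1] abs_mult_le fB abs_vert_le abs_defect_le)
           auto
      finally show ?thesis unfolding a_def r_def coef_def by (simp add: distrib_left)
    qed
    have "energy f (k + e) (Suc k) - energy f (k + e) k =
        energy (\<lambda>p. f p * haar (frac (2 ^ k * snd p))) (k + e) k"
      by (rule energy_Suc_diff[OF f fB])
    also have "\<dots> = (\<E> p. (lev e a k p + lev e r k p)\<^sup>2)"
      unfolding energy_def co ..
    also have "\<dots> \<le> (\<E> p. 2 * (lev e a k p)\<^sup>2 + 2 * (lev e r k p)\<^sup>2)"
    proof (rule integral_mono)
      fix p
      show "(lev e a k p + lev e r k p)\<^sup>2 \<le>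
         2 * (lev e a k p)\<^sup>2 + 2 * (lev e r k p)\<^sup>2"
        using zero_le_power2[of "lev e a k p - lev e r k p"]
        unfolding power2_sum power2_diff by linarith
    next
      show "integrable sq_meas (\<lambda>p. (lev e a k p + lev e r k p)\<^sup>2)"
      proof (rule integrable_sq[where B="2\<^sup>2"])
        show "\<bar>(lev e a k p + lev e r k p)\<^sup>2\<bar> \<le> 2\<^sup>2" for p
          unfolding abs_power2
          using aB[of k "cell (k + e) (fst p)" "cell k (snd p)"] rB[of k "cell (k + e) (fst p)" "cell k (snd p)"]
          by (intro square_le_of_abs_le) linarith
      qed measurable
    qed (use integrable_square_at_cell[of "a k"] integrable_square_at_cell[of "r k"] aB rB in simp)
    also have "\<dots> = 2 * (\<E> p. (lev e a k p)\<^sup>2) + 2 * (\<E> p. (lev e r k p)\<^sup>2)"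
      using integrable_square_at_cell[of "a k"] integrable_square_at_cell[of "r k"] aB rB by simp
    finally show ?thesis .
  qed
  have sum: "(\<Sum>k<K. energy f (k + e) (Suc k) - energy f (k + e) k) \<le> 2 * coef_norm e a K + 2 * coef_norm e r K"
    unfolding coef_norm_def sum_distrib_left sum.distrib[symmetric] by (intro sum_mono inc)
  define D where "D p = (\<Sum>k<K. lev e r k p * defect e k p)" for p
  have [measurable]: "D \<in> borel_measurable borel" unfolding D_def by measurable
  have Db: "\<bar>D p\<bar> \<le> K" for p
    using abs_lev_sum_le[OF rB abs_defect_le, where A="{..<K}"] by (simp add: D_def)
  have Dsq: "integrable sq_meas (\<lambda>p. (D p)\<^sup>2)"
    by (rule integrable_square[OF _ Db]) measurable
  have fi: "integrable sq_meas f" by (rule integrable_sq[where B=1]) (use fB in auto)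
  have Di: "integrable sq_meas D" by (rule integrable_sq[where B="real K"]) (use Db in auto)
  have fDi: "integrable sq_meas (\<lambda>p. f p * D p)"
    by (rule integrable_sq[where B="real K"]) (use abs_mult_le[OF fB Db] in auto)
  have fD: "(\<E> p. f p * D p) = coef_norm e r K"
    unfolding D_def by (rule coef_norm_eq_integral[where P="\<lambda>_ _ _. True" and w="defect e"])
       (use f fB abs_defect_le in \<open>auto simp: r_def\<close>)
  have D0: "(\<E> p. D p) = 0"
  proof -
    have "(\<E> p. D p) = (\<Sum>k<K. \<integral>p. lev e r k p * defect e k p \<partial>sq_meas)"
      unfolding D_def
      by (intro Bochner_Integration.integral_sum integrable_sq[where B=1] abs_mult_le rB abs_defect_le) measurable
    moreover have "(\<E> p. lev e r k p * defect e k p) = 0" for k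
      by (rule integral_defect_eq_0) (rule rB)
    ultimately show ?thesis by simp
  qed
  have fm: "(f p - m)\<^sup>2 = (1 - 2 * m) * f p + m\<^sup>2" for p
    using f01[of p] by (auto simp: power2_eq_square algebra_simps)
  have V: "(\<E> p. (f p - m)\<^sup>2) = m * (1 - m)"
    unfolding fm using fi by (simp add: m_def[symmetric] power2_eq_square algebra_simps)
  have Vi: "integrable sq_meas (\<lambda>p. (f p - m)\<^sup>2)" unfolding fm using fi by simp
  \<comment> \<open>\<open>D\<close> has mean 0, so \<open>f\<close> may be replaced by
    \<open>f - m\<close>. In the next line the weight 4 times the factor 1/8 of
    \<open>norm_defect_sum_le\<close> is 1/2, which the left side absorbs; the weight 1/16 is what
    is left for the variance.\<close>
  have "coef_norm e r K = (\<E> p. f p * D p - m * D p)"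
    using fDi Di fD D0 by simp
  also have "\<dots> \<le> (\<E> p. (f p - m)\<^sup>2 / 16 + 4 * (D p)\<^sup>2)"
  proof (rule integral_mono)
    fix p
    have "(f p - m)\<^sup>2 / 16 + 4 * (D p)\<^sup>2 - (f p * D p - m * D p) = ((f p - m) / 4 - 2 * D p)\<^sup>2"
      by (simp add: power2_eq_square field_simps)
    then show "f p * D p - m * D p \<le> (f p - m)\<^sup>2 / 16 + 4 * (D p)\<^sup>2"
      using zero_le_power2[of "(f p - m) / 4 - 2 * D p"] by linarith
  qed (use fDi Di Vi Dsq in auto)
  also have "\<dots> = m * (1 - m) / 16 + 4 * (\<E> p. (D p)\<^sup>2)"
    using Vi Dsq by (simp add: V)
  also have "(\<E> p. (D p)\<^sup>2) \<le> coef_norm e r K / 8"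
    unfolding D_def using rB by (rule norm_defect_sum_le)
  finally have "coef_norm e r K \<le> m * (1 - m) / 8" by simp
  moreover have "a = (\<lambda>k. coef (\<lambda>p. f p * vert e k p) (k + e) k)" by (simp add: a_def fun_eq_iff)
  ultimately show ?thesis using sum unfolding m_def by simp
qed

section \<open>Shears\<close>

text \<open>The coefficient may jump between cells because \<open>h\<close> vanishes at both ends of
  a period: for points in different cells each value is bounded by the distance to an end of its own
  cell, and these two distances add up to at most the distance of the points.\<close>

lemma cellwise_lipschitz:
  fixes C :: "int \<Rightarrow> real" and h :: "real \<Rightarrow> real"
  assumes C: "\<And>n. \<bar>C n\<bar> \<le> B" and L: "0 \<le> L"
    and h: "\<And>s t. \<bar>h s - h t\<bar> \<le> L * \<bar>s - t\<bar>" "h 0 = 0" "h 1 = 0"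
  shows "\<bar>C \<lfloor>z\<rfloor> * h (frac z) - C \<lfloor>z'\<rfloor> * h (frac z')\<bar> \<le> B * L * \<bar>z - z'\<bar>"
proof -
  have B: "0 \<le> B" using C[of 0] by linarith
  have *: "\<bar>C \<lfloor>z\<rfloor> * h (frac z) - C \<lfloor>z'\<rfloor> * h (frac z')\<bar> \<le> B * L * \<bar>z - z'\<bar>" if "z \<le> z'" for z z'
  proof (cases "\<lfloor>z\<rfloor> = \<lfloor>z'\<rfloor>")
    case True
    have "\<bar>C \<lfloor>z\<rfloor> * h (frac z) - C \<lfloor>z'\<rfloor> * h (frac z')\<bar> = \<bar>C \<lfloor>z'\<rfloor>\<bar> * \<bar>h (frac z) - h (frac z')\<bar>"
      unfolding True by (simp add: abs_mult flip: right_diff_distrib)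
    also have "\<dots> \<le> B * (L * \<bar>frac z - frac z'\<bar>)" by (intro mult_mono C h B) simp
    also have "\<bar>frac z - frac z'\<bar> = \<bar>z - z'\<bar>" by (simp add: frac_def True)
    finally show ?thesis by simp
  next
    case False
    then have fl: "\<lfloor>z\<rfloor> + 1 \<le> \<lfloor>z'\<rfloor>" using floor_mono[OF that] by linarith
    have 1: "\<bar>C \<lfloor>z\<rfloor> * h (frac z)\<bar> \<le> B * (L * (1 - frac z))"
    proof -
      have "\<bar>h (frac z)\<bar> \<le> L * (1 - frac z)" using h(1)[of "frac z" 1] h(3) frac_lt_1[of z] by simp
      then show ?thesis unfolding abs_mult by (intro mult_mono C B) auto
    qed
    have 2: "\<bar>C \<lfloor>z'\<rfloor> * h (frac z')\<bar> \<le> B * (L * frac z')"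
    proof -
      have "\<bar>h (frac z')\<bar> \<le> L * frac z'" using h(1)[of "frac z'" 0] h(2) frac_ge_0[of z'] by simp
      then show ?thesis unfolding abs_mult by (intro mult_mono C B) auto
    qed
    have "1 - frac z + frac z' \<le> \<bar>z - z'\<bar>" using fl that unfolding frac_def by linarith
    then have "B * L * (1 - frac z + frac z') \<le> B * L * \<bar>z - z'\<bar>" using B L by (intro mult_left_mono) auto
    then show ?thesis using 1 2 by (simp add: algebra_simps)
  qed
  show ?thesis
  proof (cases "z \<le> z'")
    case False
    then show ?thesis using *[of z' z] by (simp add: abs_minus_commute)
  qed (rule *)
qed

lemma cellwise_derivative_tent:
  fixes C :: "int \<Rightarrow> real"
  assumes z: "2 * z \<notin> \<int>"
  shows "((\<lambda>z. C \<lfloor>z\<rfloor> * tent (frac z)) has_field_derivative C \<lfloor>z\<rfloor> * haar (frac z)) (at z)"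
proof -
  define m where "m = \<lfloor>z\<rfloor>"
  define n where "n = \<lfloor>2 * z\<rfloor>"
  have "real_of_int n \<noteq> 2 * z" using z by (metis Ints_of_int)
  then have n: "n < 2 * z" "2 * z < n + 1" unfolding n_def by linarith+
  have nm: "n = 2 * m \<or> n = 2 * m + 1" unfolding n_def m_def by linarith
  have fl: "\<lfloor>y\<rfloor> = m" if "y \<in> {n / 2<..<(n + 1) / 2}" for y :: real
    using that nm unfolding floor_eq_iff by auto
  have zin: "z \<in> {n / 2<..<(n + 1) / 2}" using n by auto
  show ?thesis
  proof (rule has_field_derivative_transform_within_open[of "\<lambda>y. C m * (if n = 2 * m then y - m else 1 - (y - m))"])
    show "((\<lambda>y. C m * (if n = 2 * m then y - m else 1 - (y - m))) has_field_derivative C \<lfloor>z\<rfloor> * haar (frac z)) (at z)"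
    proof (cases "n = 2 * m")
      case True
      then have "haar (frac z) = 1" using n by (simp add: haar_def frac_def m_def[symmetric])
      then show ?thesis using True unfolding m_def[symmetric] by (auto intro!: derivative_eq_intros)
    next
      case False
      then have "haar (frac z) = -1" using n nm by (simp add: haar_def frac_def m_def[symmetric])
      then show ?thesis using False unfolding m_def[symmetric] by (auto intro!: derivative_eq_intros)
    qed
    show "C m * (if n = 2 * m then y - m else 1 - (y - m)) = C \<lfloor>y\<rfloor> * tent (frac y)"
      if y: "y \<in> {n / 2<..<(n + 1) / 2}" for y :: real
    proof -
      have "tent (y - m) = (if n = 2 * m then y - m else 1 - (y - m))"
        using y nm by (auto simp: tent_def)
      then show ?thesis by (simp add: fl[OF y] frac_def)
    qed
  qed (use zin in auto)
qed

lemma cellwise_derivative_plateau: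
  fixes C :: "int \<Rightarrow> real"
  assumes z: "16 * z \<notin> \<int>"
  shows "((\<lambda>z. C \<lfloor>z\<rfloor> * plateau (frac z)) has_field_derivative C \<lfloor>z\<rfloor> * slope (frac z)) (at z)"
proof -
  define m where "m = \<lfloor>z\<rfloor>"
  define n where "n = \<lfloor>16 * z\<rfloor>"
  have "real_of_int n \<noteq> 16 * z" using z by (metis Ints_of_int)
  then have n: "n < 16 * z" "16 * z < n + 1" unfolding n_def by linarith+
  have nm: "16 * m \<le> n" "n \<le> 16 * m + 15" unfolding n_def m_def by linarith+
  have fl: "\<lfloor>y\<rfloor> = m" if "y \<in> {n / 16<..<(n + 1) / 16}" for y :: real
  proof -
    have "real_of_int (16 * m) \<le> n" "real_of_int n \<le> 16 * m + 15" using nm by linarith+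
    then show ?thesis using that unfolding floor_eq_iff by auto
  qed
  have zin: "z \<in> {n / 16<..<(n + 1) / 16}" using n by auto
  let ?g = "\<lambda>y::real. C m * (if n = 16 * m then 16 * (y - m) else if n = 16 * m + 15 then 16 * (1 - (y - m)) else 1)"
  have cases: "n = 16 * m \<or> n = 16 * m + 15 \<or>
    n \<noteq> 16 * m \<and> n \<noteq> 16 * m + 15 \<and> 16 * m + 1 \<le> real_of_int n \<and> n \<le> 16 * real_of_int m + 14"
    using nm by linarith
  show ?thesis
  proof (rule has_field_derivative_transform_within_open[of ?g])
    have s: "slope (frac z) = (if n = 16 * m then 16 else if n = 16 * m + 15 then - 16 else 0)"
      using cases n by (auto simp: slope_def frac_def m_def[symmetric])
    show "(?g has_field_derivative C \<lfloor>z\<rfloor> * slope (frac z)) (at z)"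
      unfolding s m_def[symmetric] by (auto intro!: derivative_eq_intros)
    show "?g y = C \<lfloor>y\<rfloor> * plateau (frac y)"
      if y: "y \<in> {n / 16<..<(n + 1) / 16}" for y :: real
    proof -
      have "plateau (y - m) = (if n = 16 * m then 16 * (y - m) else if n = 16 * m + 15 then 16 * (1 - (y - m)) else 1)"
        using y cases by (auto simp: plateau_def tent_def min_def max_def)
      then show ?thesis by (simp add: fl[OF y] frac_def)
    qed
  qed (use zin in auto)
qed

section \<open>The displacement and its partial derivatives\<close>

lemma plateau_0 [simp]: "plateau 0 = 0" and plateau_1 [simp]: "plateau 1 = 0"
  and tent_0 [simp]: "tent 0 = 0" and tent_1 [simp]: "tent 1 = 0"
  by (simp_all add: plateau_def tent_def)

text \<open>Division by \<open>2 ^ k\<close> makes the y-derivatives of all levels comparable,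
  exactly \<open>vert\<close>. In x the chain rule gives \<open>2 ^ (k + e)\<close>, which leaves
  the factor \<open>2 ^ e\<close> of \<open>horiz\<close>.\<close>

definition displ :: "nat \<Rightarrow> (nat \<Rightarrow> int \<Rightarrow> int \<Rightarrow> real) \<Rightarrow> nat \<Rightarrow> point \<Rightarrow> real" where
  "displ e c K p = (\<Sum>k<K. lev e c k p * plateau (frac (2 ^ (k + e) * fst p)) *
      tent (frac (2 ^ k * snd p)) / 2 ^ k)"

lemma finite_grid: "finite {y \<in> {a..b}. N * y \<in> \<int>}" if "N > 0" for N a b :: real
proof (rule finite_subset)
  show "{y \<in> {a..b}. N * y \<in> \<int>} \<subseteq> (\<lambda>j. real_of_int j / N) ` {\<lfloor>N * a\<rfloor>..\<lceil>N * b\<rceil>}"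
  proof
    fix y assume "y \<in> {y \<in> {a..b}. N * y \<in> \<int>}"
    then obtain j where j: "N * y = of_int j" and y: "a \<le> y" "y \<le> b" by (auto elim: Ints_cases)
    have "N * a \<le> j" "j \<le> N * b" using y that by (auto simp flip: j)
    then have "j \<in> {\<lfloor>N * a\<rfloor>..\<lceil>N * b\<rceil>}" by (auto simp: floor_le_iff le_ceiling_iff)
    moreover have "y = of_int j / N" using j that by (simp add: field_simps)
    ultimately show "y \<in> (\<lambda>j. real_of_int j / N) ` {\<lfloor>N * a\<rfloor>..\<lceil>N * b\<rceil>}" by blast
  qed
qed simp

text \<open>The tents of levels below K have their kinks at multiples of half a cell, hence on the
  grid of level K. In \<open>displ_deriv_fst\<close> the kinks of the plateaus lie at sixteenths,
  whence the exponent there.\<close>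

lemma displ_deriv_snd:
  assumes "2 ^ K * y \<notin> \<int>"
  shows "((\<lambda>y. displ e c K (x, y)) has_field_derivative
      (\<Sum>k<K. lev e c k (x, y) * vert e k (x, y))) (at y)"
  unfolding displ_def fst_conv snd_conv
proof (rule DERIV_sum)
  fix k assume "k \<in> {..<K}"
  then have k: "Suc k \<le> K" by simp
  have "2 * (2 ^ k * y) \<notin> \<int>"
  proof
    assume "2 * (2 ^ k * y) \<in> \<int>"
    from Ints_mult[OF Ints_power[OF Ints_numeral] this]
    have "2 ^ (K - Suc k) * (2 * (2 ^ k * y)) \<in> \<int>" .
    moreover have "2 ^ (K - Suc k) * (2 * (2 ^ k * y)) = 2 ^ (K - Suc k + Suc k) * y"
      unfolding power_add by simp
    ultimately show False using assms k by simp
  qed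
  from cellwise_derivative_tent[OF this, of "c k (cell (k + e) x)"]
  have "((\<lambda>y. c k (cell (k + e) x) \<lfloor>2 ^ k * y\<rfloor> * tent (frac (2 ^ k * y))) has_field_derivative
    c k (cell (k + e) x) \<lfloor>2 ^ k * y\<rfloor> * haar (frac (2 ^ k * y)) * 2 ^ k) (at y)"
    by (rule DERIV_chain2) (auto intro!: derivative_eq_intros)
  from DERIV_cmult[OF this, of "plateau (frac (2 ^ (k + e) * x)) / 2 ^ k"]
  show "((\<lambda>y. c k (cell (k + e) x) (cell k y) * plateau (frac (2 ^ (k + e) * x)) * tent (frac (2 ^ k * y)) / 2 ^ k)
    has_field_derivative c k (cell (k + e) x) (cell k y) * vert e k (x, y)) (at y)"
    unfolding cell_def[of k] vert_def by (simp add: mult_ac)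
qed

lemma displ_deriv_fst:
  assumes "2 ^ (K + e + 4) * x \<notin> \<int>"
  shows "((\<lambda>x. displ e c K (x, y)) has_field_derivative
      (\<Sum>k<K. lev e c k (x, y) * horiz e k (x, y))) (at x)"
  unfolding displ_def fst_conv snd_conv
proof (rule DERIV_sum)
  fix k assume "k \<in> {..<K}"
  then have k: "k \<le> K" by simp
  have "16 * (2 ^ (k + e) * x) \<notin> \<int>"
  proof
    assume "16 * (2 ^ (k + e) * x) \<in> \<int>"
    from Ints_mult[OF Ints_power[OF Ints_numeral] this]
    have "2 ^ (K - k) * (16 * (2 ^ (k + e) * x)) \<in> \<int>" .
    moreover have "2 ^ (K - k) * (16 * (2 ^ (k + e) * x)) = 2 ^ (K - k + k + e + 4) * x"
      unfolding power_add by simp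
    ultimately show False using assms k by simp
  qed
  from cellwise_derivative_plateau[OF this, of "\<lambda>i. c k i (cell k y)"]
  have "((\<lambda>x. c k \<lfloor>2 ^ (k + e) * x\<rfloor> (cell k y) * plateau (frac (2 ^ (k + e) * x))) has_field_derivative
    c k \<lfloor>2 ^ (k + e) * x\<rfloor> (cell k y) * slope (frac (2 ^ (k + e) * x)) * 2 ^ (k + e)) (at x)"
    by (rule DERIV_chain2) (auto intro!: derivative_eq_intros)
  from DERIV_cmult[OF this, of "tent (frac (2 ^ k * y)) / 2 ^ k"]
  show "((\<lambda>x. c k (cell (k + e) x) (cell k y) * plateau (frac (2 ^ (k + e) * x)) * tent (frac (2 ^ k * y)) / 2 ^ k)
    has_field_derivative c k (cell (k + e) x) (cell k y) * horiz e k (x, y)) (at x)"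
    unfolding cell_def[of "k + e"] horiz_def by (simp add: mult_ac power_add)
qed

lemma continuous_if_lipschitz:
  fixes g :: "real \<Rightarrow> real"
  assumes "\<And>s t. \<bar>g s - g t\<bar> \<le> L * \<bar>s - t\<bar>"
  shows "continuous_on A g"
proof -
  have "L-lipschitz_on UNIV g" if "0 \<le> L"
    using that assms by (auto simp: lipschitz_on_def dist_real_def)
  moreover have "0 \<le> L" using assms[of 0 1] by simp
  ultimately have "continuous_on UNIV g" by (intro lipschitz_on_continuous_on)
  then show ?thesis by (rule continuous_on_subset) simp
qed

lemma displ_continuous:
  assumes c: "\<And>k i j. \<bar>c k i j\<bar> \<le> 1"
  shows "continuous_on A (\<lambda>y. displ e c K (x, y))" "continuous_on A (\<lambda>x. displ e c K (x, y))"
proof -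
  have 1: "continuous_on UNIV (\<lambda>z. c k i \<lfloor>z\<rfloor> * tent (frac z))" for k i
    by (rule continuous_if_lipschitz[where L="1 * 1"])
       (rule cellwise_lipschitz, use c tent_lipschitz in auto)
  have 2: "continuous_on UNIV (\<lambda>z. c k \<lfloor>z\<rfloor> j * plateau (frac z))" for k j
    by (rule continuous_if_lipschitz[where L="1 * 16"])
       (rule cellwise_lipschitz[where C="\<lambda>i. c k i j" for k j], use c plateau_lipschitz in auto)
  show "continuous_on A (\<lambda>y. displ e c K (x, y))"
  proof -
    have "continuous_on A (\<lambda>y. c k i \<lfloor>2 ^ k * y\<rfloor> * tent (frac (2 ^ k * y)))" for k i
      by (rule continuous_on_compose2[OF 1[of k i]]) (auto intro!: continuous_intros)
    then have "continuous_on A (\<lambda>y. (c k i \<lfloor>2 ^ k * y\<rfloor> * tent (frac (2 ^ k * y))) * w)" for k i and w :: real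
      by (rule continuous_on_mult[OF _ continuous_on_const])
    from this[of _ "cell (k + e) x" "plateau (frac (2 ^ (k + e) * x)) / 2 ^ k" for k]
    show ?thesis unfolding displ_def fst_conv snd_conv
      by (intro continuous_on_sum) (simp add: cell_def mult_ac)
  qed
  show "continuous_on A (\<lambda>x. displ e c K (x, y))"
  proof -
    have "continuous_on A (\<lambda>x. c k \<lfloor>2 ^ (k + e) * x\<rfloor> j * plateau (frac (2 ^ (k + e) * x)))" for k j
      by (rule continuous_on_compose2[OF 2[of k j]]) (auto intro!: continuous_intros)
    then have "continuous_on A (\<lambda>x. (c k \<lfloor>2 ^ (k + e) * x\<rfloor> j * plateau (frac (2 ^ (k + e) * x))) * w)" for k j and w :: real
      by (rule continuous_on_mult[OF _ continuous_on_const])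
    from this[of _ "cell k y" "tent (frac (2 ^ k * y)) / 2 ^ k" for k]
    show ?thesis unfolding displ_def fst_conv snd_conv
      by (intro continuous_on_sum) (simp add: cell_def mult_ac)
  qed
qed

lemma lipschitz_of_derivative_bound:
  fixes g g' :: "real \<Rightarrow> real"
  assumes cont: "\<And>A. continuous_on A g" and N: "N > 0"
    and der: "\<And>t. N * t \<notin> \<int> \<Longrightarrow> (g has_field_derivative g' t) (at t)"
    and B: "\<And>t. \<bar>g' t\<bar> \<le> B"
  shows "\<bar>g s - g t\<bar> \<le> B * \<bar>s - t\<bar>"
proof -
  have *: "\<bar>g b - g a\<bar> \<le> B * (b - a)" if "a \<le> b" for a b
  proof -
    have "(g' has_integral (g b - g a)) {a..b}"
    proof (rule fundamental_theorem_of_calculus_interior_strong[OF finite_grid[OF N, of a b] that])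
      fix t assume "t \<in> {a<..<b} - {y \<in> {a..b}. N * y \<in> \<int>}"
      then have "N * t \<notin> \<int>" by auto
      then show "(g has_vector_derivative g' t) (at t)"
        using der by (simp add: has_real_derivative_iff_has_vector_derivative)
    qed (rule cont)
    then have "norm (g b - g a) \<le> B * measure lborel (cbox a b)"
      by (intro has_integral_bound[where f=g']) (use order.trans[OF abs_ge_zero B] B in auto)
    then show ?thesis using that by simp
  qed
  show ?thesis using *[of s t] *[of t s] by (cases "s \<le> t") (auto simp: abs_minus_commute)
qed

lemma displ_zero:
  assumes "x \<in> \<int> \<or> y \<in> \<int>"
  shows "displ e c K (x, y) = 0"
proof -
  have *: "frac (2 ^ m * z :: real) = 0" if "z \<in> \<int>" for z m
    using that by (intro frac_eq_0_iff[THEN iffD2] Ints_mult) auto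
  show ?thesis using assms by (auto simp: displ_def * simp del: frac_eq_0_iff)
qed

section \<open>Area of the image under a shear\<close>

lemma emeasure_image_real:
  fixes g g' :: "real \<Rightarrow> real"
  assumes A: "compact A" and cont: "continuous_on A g" and inj: "inj g" and N: "N > 0"
    and der: "\<And>t. N * t \<notin> \<int> \<Longrightarrow> (g has_field_derivative g' t) (at t)"
    and m[measurable]: "g' \<in> borel_measurable borel" and B: "\<And>t. 0 \<le> g' t" "\<And>t. g' t \<le> B"
  shows "emeasure lborel (g ` A) = (\<integral>\<^sup>+y. ennreal (indicator A y * g' y) \<partial>lborel)"
proof -
  obtain b where b: "A \<subseteq> {- b..b}"
    using compact_imp_bounded[OF A] by (metis bounded_subset_cbox_symmetric box_real(2))
  \<comment> \<open>The kinks inside \<open>A\<close>. They are finitely many, so they and their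
    images are null, and change of variables is applied, to the constant function 1, on the
    differentiable rest \<open>S\<close>.\<close>
  define F where "F = {y \<in> A. N * y \<in> \<int>}"
  have F: "finite F" "F \<subseteq> A" unfolding F_def
    by (rule finite_subset[OF _ finite_grid[OF N, of "- b" b]]) (use b in auto)
  define S where "S = A - F"
  have Ab[measurable]: "A \<in> sets borel" using A by (simp add: borel_compact)
  have Fb: "F \<in> sets borel" using F(1) by (simp add: borel_closed finite_imp_closed)
  have Sb[measurable]: "S \<in> sets borel" using Ab Fb by (simp add: S_def)
  have gA: "compact (g ` A)" using cont A by (rule compact_continuous_image)
  have gF: "finite (g ` F)" using F by simp
  have gS: "g ` S = g ` A - g ` F" unfolding S_def using inj by (auto simp: inj_def)
  have gSb: "g ` S \<in> sets borel"
    unfolding gS using gA gF by (intro sets.Diff borel_compact borel_closed finite_imp_closed) auto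
  have fin: "emeasure lborel A < \<infinity>" using emeasure_compact_finite[OF A] by simp
  have "emeasure lborel S \<le> emeasure lborel A" using Ab by (intro emeasure_mono) (auto simp: S_def)
  then have finS: "emeasure lborel S < \<infinity>" using fin by (rule le_less_trans)
  have int: "integrable lborel (\<lambda>y. indicator A y * g' y)"
    by (rule integrableI_bounded_set[where A=A and B=B]) (use fin B in \<open>auto simp: indicator_def\<close>)
  have intS: "integrable lborel (\<lambda>y. indicator S y * g' y)"
    by (rule integrableI_bounded_set[where A=S and B=B]) (use finS B in \<open>auto simp: indicator_def\<close>)
  have aeF: "AE y in lborel. y \<notin> F"
    using F(1) by (intro AE_not_in finite_imp_null_set_lborel)
  have eqA: "(\<integral>y. indicator S y * g' y \<partial>lborel) = (\<integral>y. indicator A y * g' y \<partial>lborel)"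
  proof (rule integral_cong_AE)
    show "AE y in lborel. indicator S y * g' y = indicator A y * g' y"
      using aeF by eventually_elim (simp add: S_def indicator_def)
  qed auto
  have si: "set_integrable lebesgue S g'"
    unfolding set_integrable_def using integrable_completion[of "\<lambda>y. indicator S y * g' y" lborel] intS by simp
  have sI: "integral S g' = (\<integral>y. indicator A y * g' y \<partial>lborel)"
    using set_lebesgue_integral_eq_integral(2)[OF si] integral_completion[of "\<lambda>y. indicator S y * g' y" lborel]
    by (simp add: set_lebesgue_integral_def eqA)
  have "(\<lambda>x. \<bar>g' x\<bar> * 1) absolutely_integrable_on S \<and> integral S (\<lambda>x. \<bar>g' x\<bar> * 1) = integral S g' \<longleftrightarrow>
     (\<lambda>_. 1::real) absolutely_integrable_on (g ` S) \<and> integral (g ` S) (\<lambda>_. 1) = integral S g'"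
  proof (rule has_absolute_integral_change_of_variables_1')
    show "S \<in> sets lebesgue" using Sb by (intro sets_completionI_sets) simp
    show "(g has_field_derivative g' x) (at x within S)" if "x \<in> S" for x
      by (rule has_field_derivative_at_within, rule der) (use that in \<open>auto simp: S_def F_def\<close>)
    show "inj_on g S" using inj by (rule inj_on_subset) simp
  qed
  moreover have "(\<lambda>x. \<bar>g' x\<bar> * 1) = g'" using B(1) by auto
  ultimately have one: "(\<lambda>_. 1::real) absolutely_integrable_on (g ` S)" "integral (g ` S) (\<lambda>_. 1::real) = integral S g'"
    using si by auto
  then have lm: "g ` S \<in> lmeasurable"
    unfolding lmeasurable_iff_integrable_on using set_lebesgue_integral_eq_integral(1) by blast
  have "emeasure lborel (g ` A) = emeasure lborel (g ` S)"
  proof (rule emeasure_eq_AE)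
    have "AE y in lborel. y \<notin> g ` F" using gF by (intro AE_not_in finite_imp_null_set_lborel)
    then show "AE y in lborel. (y \<in> g ` A) = (y \<in> g ` S)"
      unfolding gS by eventually_elim auto
    show "g ` A \<in> sets lborel" using borel_compact[OF gA] by simp
    show "g ` S \<in> sets lborel" using gSb by simp
  qed
  also have "\<dots> = emeasure lebesgue (g ` S)" using gSb by simp
  also have "\<dots> = ennreal (measure lebesgue (g ` S))"
    using lm by (rule emeasure_eq_measure2)
  also have "measure lebesgue (g ` S) = (\<integral>y. indicator A y * g' y \<partial>lborel)"
    using lmeasure_integral[OF lm] one(2) sI by simp
  also have "ennreal \<dots> = (\<integral>\<^sup>+y. ennreal (indicator A y * g' y) \<partial>lborel)"
    by (rule nn_integral_eq_integral[OF int, symmetric]) (use B in auto)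
  finally show ?thesis .
qed

text \<open>A shear maps every vertical line to itself, so Fubini reduces the area formula to one
  dimension, and only the derivative along the line enters.\<close>

lemma emeasure_shear_image:
  fixes w w' :: "point \<Rightarrow> real"
  assumes Q: "compact Q" and cont: "continuous_on UNIV w"
    and inj: "\<And>x. inj (\<lambda>y. w (x, y))" and N: "N > 0"
    and der: "\<And>x y. N * y \<notin> \<int> \<Longrightarrow> ((\<lambda>y. w (x, y)) has_field_derivative w' (x, y)) (at y)"
    and m[measurable]: "w' \<in> borel_measurable borel" and B: "\<And>p. 0 \<le> w' p" "\<And>p. w' p \<le> B"
  shows "emeasure lborel ((\<lambda>p. (fst p, w p)) ` Q) = (\<integral>\<^sup>+p. ennreal (indicator Q p * w' p) \<partial>lborel)"
proof -
  let ?\<phi> = "\<lambda>p. (fst p, w p)"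
  have cw: "continuous_on S w" for S using cont by (rule continuous_on_subset) simp
  have "compact (?\<phi> ` Q)"
    by (intro compact_continuous_image Q continuous_on_Pair continuous_on_fst continuous_on_id cw)
  then have b: "?\<phi> ` Q \<in> sets (lborel \<Otimes>\<^sub>M lborel)" by (subst lborel_prod) (simp add: borel_compact)
  have Qb: "Q \<in> sets borel" using Q by (rule borel_compact)
  have sec: "emeasure lborel (Pair x -` (?\<phi> ` Q)) = (\<integral>\<^sup>+y. ennreal (indicator Q (x, y) * w' (x, y)) \<partial>lborel)" for x
  proof -
    let ?A = "Pair x -` Q"
    have A: "compact ?A"
    proof -
      have "closed ?A"
        by (intro continuous_closed_vimage compact_imp_closed Q) (auto intro!: continuous_intros)
      moreover have "?A \<subseteq> snd ` Q" by force
      moreover have "bounded (snd ` Q)"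
        by (intro compact_imp_bounded compact_continuous_image Q continuous_on_snd continuous_on_id)
      ultimately show ?thesis using bounded_subset compact_eq_bounded_closed by blast
    qed
    have eq: "Pair x -` (?\<phi> ` Q) = (\<lambda>y. w (x, y)) ` ?A" by force
    have c: "continuous_on ?A (\<lambda>y. w (x, y))"
      by (rule continuous_on_compose2[OF cont]) (auto intro!: continuous_intros)
    have mx: "(\<lambda>y. w' (x, y)) \<in> borel_measurable borel"
      by (rule measurable_compose[OF _ m]) (intro borel_measurable_continuous_onI continuous_intros)
    have "emeasure lborel ((\<lambda>y. w (x, y)) ` ?A) = (\<integral>\<^sup>+y. ennreal (indicator ?A y * w' (x, y)) \<partial>lborel)"
      by (rule emeasure_image_real[OF A c inj N der mx]) (use B in auto)
    then show ?thesis unfolding eq by (simp add: indicator_def)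
  qed
  have "emeasure (lborel \<Otimes>\<^sub>M lborel) (?\<phi> ` Q) = (\<integral>\<^sup>+x. \<integral>\<^sup>+y. ennreal (indicator Q (x, y) * w' (x, y)) \<partial>lborel \<partial>lborel)"
    by (subst lborel.emeasure_pair_measure_alt[OF b]) (simp add: sec)
  also have "\<dots> = (\<integral>\<^sup>+p. ennreal (indicator Q p * w' p) \<partial>(lborel \<Otimes>\<^sub>M lborel))"
    by (rule lborel.nn_integral_fst) (use Qb in \<open>simp add: lborel_prod\<close>)
  finally show ?thesis by (simp add: lborel_prod)
qed

section \<open>Bi-Lipschitz maps of the square\<close>

definition bilip :: "real \<Rightarrow> (point \<Rightarrow> point) \<Rightarrow> bool" where
  "bilip M \<phi> \<longleftrightarrow> (\<forall>p\<in>unit_sq. \<phi> p \<in> unit_sq) \<and>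
     (\<forall>p\<in>frontier (unit_sq). \<phi> p = p) \<and>
     (\<forall>p\<in>unit_sq. \<forall>q\<in>unit_sq.
        dist p q \<le> M * dist (\<phi> p) (\<phi> q) \<and> dist (\<phi> p) (\<phi> q) \<le> M * dist p q)"

lemma mem_square: "p \<in> square n \<longleftrightarrow> 0 \<le> fst p \<and> fst p \<le> real n \<and> 0 \<le> snd p \<and> snd p \<le> real n"
  by (cases p) (simp add: square_def)

lemma mem_frontier_square:
  "p \<in> frontier (square n) \<longleftrightarrow> p \<in> square n \<and> (fst p = 0 \<or> fst p = real n \<or> snd p = 0 \<or> snd p = real n)"
proof -
  have fr: "frontier (square n) = square n - box (0,0) (real n, real n)"
    by (simp add: square_def frontier_def)
  have b: "p \<in> box (0,0) (real n, real n) \<longleftrightarrow> 0 < fst p \<and> fst p < real n \<and> 0 < snd p \<and> snd p < real n"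
    by (cases p) (simp add: box_prod)
  show ?thesis unfolding fr Diff_iff b mem_square by linarith
qed

lemma square_1: "square 1 = unit_sq"
  by (simp add: square_def)

lemma mem_unit: "p \<in> unit_sq \<longleftrightarrow> 0 \<le> fst p \<and> fst p \<le> 1 \<and> 0 \<le> snd p \<and> snd p \<le> 1"
  using mem_square[of p 1] by (simp only: square_1 of_nat_1)

lemma frontier_unit: "frontier (unit_sq) =
   {p \<in> unit_sq. fst p = 0 \<or> fst p = 1 \<or> snd p = 0 \<or> snd p = 1}"
  using mem_frontier_square[of _ 1] by (auto simp only: square_1 of_nat_1 mem_Collect_eq)

lemma dist_Pair_bounds:
  fixes x y x' y' :: real
  shows "\<bar>x - x'\<bar> \<le> dist (x, y) (x', y')" "\<bar>y - y'\<bar> \<le> dist (x, y) (x', y')"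
    "dist (x, y) (x', y') \<le> \<bar>x - x'\<bar> + \<bar>y - y'\<bar>"
proof -
  show "\<bar>x - x'\<bar> \<le> dist (x, y) (x', y')" "\<bar>y - y'\<bar> \<le> dist (x, y) (x', y')"
    using dist_fst_le[of "(x,y)" "(x',y')"] dist_snd_le[of "(x,y)" "(x',y')"] by (simp_all add: dist_real_def)
  show "dist (x, y) (x', y') \<le> \<bar>x - x'\<bar> + \<bar>y - y'\<bar>"
    unfolding dist_Pair_Pair dist_real_def by (rule order.trans[OF sqrt_sum_squares_le_sum_abs]) simp
qed

text \<open>With d the distance of the images, |x - x'| \<le> d and |y - y'| \<le> 2 d + |x - x'|
  \<le> 3 d, which gives the constant 4. The square is preserved because v vanishes at y = 0 and y =
  1 and grows at most half as fast as the distance from there.\<close>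

lemma bilip_shear:
  fixes v :: "point \<Rightarrow> real"
  assumes Lx: "\<And>x x' y. \<bar>v (x, y) - v (x', y)\<bar> \<le> \<bar>x - x'\<bar> / 2"
    and Ly: "\<And>x y y'. \<bar>v (x, y) - v (x, y')\<bar> \<le> \<bar>y - y'\<bar> / 2"
    and v0: "\<And>x y. x \<in> \<int> \<or> y \<in> \<int> \<Longrightarrow> v (x, y) = 0"
  shows "bilip 4 (\<lambda>p. (fst p, snd p + v p))"
proof -
  have L: "\<bar>v (x, y) - v (x', y')\<bar> \<le> \<bar>x - x'\<bar> / 2 + \<bar>y - y'\<bar> / 2" for x y x' y'
    using Lx[of x y x'] Ly[of x' y y'] by linarith
  have 1: "dist (x, y) (x', y') \<le> 4 * dist (x, y + v (x, y)) (x', y' + v (x', y'))" for x y x' y'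
  proof -
    let ?d = "dist (x, y + v (x, y)) (x', y' + v (x', y'))"
    have "\<bar>y - y'\<bar> \<le> \<bar>(y + v (x, y)) - (y' + v (x', y'))\<bar> + \<bar>v (x, y) - v (x', y')\<bar>" by linarith
    also have "\<dots> \<le> ?d + (\<bar>x - x'\<bar> / 2 + \<bar>y - y'\<bar> / 2)" by (intro add_mono dist_Pair_bounds L)
    finally have "\<bar>y - y'\<bar> \<le> 2 * ?d + \<bar>x - x'\<bar>" by simp
    moreover have "\<bar>x - x'\<bar> \<le> ?d" by (rule dist_Pair_bounds)
    ultimately show ?thesis using dist_Pair_bounds(3)[of x y x' y'] by linarith
  qed
  have 2: "dist (x, y + v (x, y)) (x', y' + v (x', y')) \<le> 4 * dist (x, y) (x', y')" for x y x' y'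
  proof -
    have "dist (x, y + v (x, y)) (x', y' + v (x', y')) \<le> \<bar>x - x'\<bar> + \<bar>(y + v (x, y)) - (y' + v (x', y'))\<bar>"
      by (rule dist_Pair_bounds)
    also have "\<dots> \<le> \<bar>x - x'\<bar> + (\<bar>y - y'\<bar> + \<bar>v (x, y) - v (x', y')\<bar>)" by (intro add_left_mono) linarith
    also have "\<dots> \<le> \<bar>x - x'\<bar> + (\<bar>y - y'\<bar> + (\<bar>x - x'\<bar> / 2 + \<bar>y - y'\<bar> / 2))" by (intro add_left_mono L)
    finally have "2 * dist (x, y + v (x, y)) (x', y' + v (x', y')) \<le> 3 * \<bar>x - x'\<bar> + 3 * \<bar>y - y'\<bar>" by simp
    also have "\<dots> \<le> 3 * dist (x, y) (x', y') + 3 * dist (x, y) (x', y')"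
      by (intro add_mono mult_left_mono dist_Pair_bounds) auto
    also have "\<dots> \<le> 2 * (4 * dist (x, y) (x', y'))" by simp
    finally show ?thesis by simp
  qed
  have 3: "0 \<le> y + v (x, y) \<and> y + v (x, y) \<le> 1" if "0 \<le> y" "y \<le> 1" for x y
    using Ly[of x y 0] Ly[of x y 1] v0[of x 0] v0[of x 1] that by auto
  show ?thesis
    unfolding bilip_def frontier_unit using 1 2 3 v0 by (auto simp: cbox_Pair_eq)
qed

text \<open>Write V for m (1 - m). From 3/8 V the defect takes V/4; halving for the factor 2 in
  \<open>energy_increments_le\<close> and again for the stopping leaves V/32, and the scaling by 672
  gives 32 * 672 = 21504.\<close>

lemma vertical_step:
  fixes Q :: "point set"
  assumes Q: "compact Q" "Q \<subseteq> unit_sq" and e: "e \<le> 1"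
    and m: "m = measure lborel Q"
    and T: "3 / 8 * (m * (1 - m)) \<le> (\<Sum>k<K. energy (indicator Q) (k + e) (Suc k) - energy (indicator Q) (k + e) k)"
  shows "\<exists>\<phi>. bilip 4 \<phi> \<and> measure lborel (\<phi> ` Q) \<ge> m + m * (1 - m) / 21504"
proof -
  let ?f = "indicator Q :: point \<Rightarrow> real"
  have Qb: "Q \<in> sets borel" using Q(1) by (rule borel_compact)
  have f[measurable]: "?f \<in> borel_measurable borel" using Qb by simp
  have mf: "(\<E> p. ?f p) = m"
    using Qb by (simp add: m measure_sq_meas Q(2))
  obtain c where c: "\<And>k i j. \<bar>c k i j\<bar> \<le> 1"
    and U: "\<And>p. \<bar>\<Sum>k<K. lev e c k p * horiz e k p\<bar> \<le> 336"
    and W: "\<And>p. \<bar>\<Sum>k<K. lev e c k p * vert e k p\<bar> \<le> 336"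
    and gain: "coef_norm e (\<lambda>k. coef (\<lambda>p. ?f p * vert e k p) (k + e) k) K / 2 \<le>
      (\<E> p. ?f p * (\<Sum>k<K. lev e c k p * vert e k p))"
    by (rule stopped_coefficients[OF f _ _ e, where K=K]) auto
  define W where "W p = (\<Sum>k<K. lev e c k p * vert e k p)" for p
  have [measurable]: "W \<in> borel_measurable borel" unfolding W_def by measurable
  have Wb: "\<bar>W p\<bar> \<le> 336" for p using W by (simp add: W_def)
  have g: "m * (1 - m) / 32 \<le> (\<E> p. ?f p * W p)"
  proof -
    have "(\<Sum>k<K. energy ?f (k + e) (Suc k) - energy ?f (k + e) k) \<le>
      2 * coef_norm e (\<lambda>k. coef (\<lambda>p. ?f p * vert e k p) (k + e) k) K + m * (1 - m) / 4"
      using energy_increments_le[OF f, where K=K and e=e] unfolding mf by (auto simp: indicator_def)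
    then show ?thesis using T gain unfolding W_def by simp
  qed
  \<comment> \<open>672 = 2 * 336 turns the gradient bound 336 into the slope 1/2 required by
    \<open>bilip_shear\<close>.\<close>
  define v where "v p = displ e c K p / 672" for p
  have Ly0: "\<bar>displ e c K (x, s) - displ e c K (x, t)\<bar> \<le> 336 * \<bar>s - t\<bar>" for x s t
    by (rule lipschitz_of_derivative_bound[where N="2 ^ K" and g="\<lambda>y. displ e c K (x, y)" and
          g'="\<lambda>y. \<Sum>k<K. lev e c k (x, y) * vert e k (x, y)"])
       (use displ_continuous[of c] c displ_deriv_snd W in auto)
  have Lx0: "\<bar>displ e c K (s, y) - displ e c K (t, y)\<bar> \<le> 336 * \<bar>s - t\<bar>" for y s t
    by (rule lipschitz_of_derivative_bound[where N="2 ^ (K + e + 4)" and g="\<lambda>x. displ e c K (x, y)" and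
          g'="\<lambda>x. \<Sum>k<K. lev e c k (x, y) * horiz e k (x, y)"])
       (use displ_continuous[of c] c displ_deriv_fst U in auto)
  have Ly: "\<bar>v (x, s) - v (x, t)\<bar> \<le> \<bar>s - t\<bar> / 2" for x s t
    using Ly0[of x s t] unfolding v_def by (simp flip: diff_divide_distrib)
  have Lx: "\<bar>v (s, y) - v (t, y)\<bar> \<le> \<bar>s - t\<bar> / 2" for y s t
    using Lx0[of s y t] unfolding v_def by (simp flip: diff_divide_distrib)
  have v0: "v (x, y) = 0" if "x \<in> \<int> \<or> y \<in> \<int>" for x y using displ_zero[OF that] by (simp add: v_def)
  let ?\<phi> = "\<lambda>p. (fst p, snd p + v p)"
  have bl: "bilip 4 ?\<phi>" using Lx Ly v0 by (rule bilip_shear)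
  have inj: "inj (\<lambda>y. snd (x, y) + v (x, y))" for x
  proof (rule injI)
    fix s t assume "snd (x, s) + v (x, s) = snd (x, t) + v (x, t)"
    then have "\<bar>s - t\<bar> = \<bar>v (x, s) - v (x, t)\<bar>" by (simp add: abs_eq_iff)
    then show "s = t" using Ly[of x s t] by simp
  qed
  have vc: "continuous_on UNIV v"
  proof -
    have "\<bar>v p - v q\<bar> \<le> 1 * dist p q" for p q
    proof -
      have "\<bar>v p - v q\<bar> \<le> \<bar>v p - v (fst q, snd p)\<bar> + \<bar>v (fst q, snd p) - v q\<bar>" by linarith
      also have "\<dots> \<le> \<bar>fst p - fst q\<bar> / 2 + \<bar>snd p - snd q\<bar> / 2"
        using Lx[of "fst p" "snd p" "fst q"] Ly[of "fst q" "snd p" "snd q"] by (intro add_mono) auto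
      also have "\<dots> \<le> dist p q / 2 + dist p q / 2"
        using dist_fst_le[of p q] dist_snd_le[of p q] unfolding dist_real_def
        by (intro add_mono divide_right_mono) auto
      finally show ?thesis by simp
    qed
    then have "1-lipschitz_on UNIV v" by (auto simp: lipschitz_on_def dist_real_def)
    then show ?thesis by (rule lipschitz_on_continuous_on)
  qed
  have W1: "0 \<le> 1 + W p / 672" and W2: "1 + W p / 672 \<le> 2" for p using Wb[of p] by auto
  have "emeasure lborel (?\<phi> ` Q) = (\<integral>\<^sup>+p. ennreal (?f p * (1 + W p / 672)) \<partial>lborel)"
  proof (rule emeasure_shear_image[OF Q(1) _ inj, where N="2 ^ K" and B=2])
    show "continuous_on UNIV (\<lambda>p. snd p + v p)" by (intro continuous_intros vc)
    show "((\<lambda>y. snd (x, y) + v (x, y)) has_field_derivative 1 + W (x, y) / 672) (at y)"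
      if "2 ^ K * y \<notin> \<int>" for x y
      using DERIV_add[OF DERIV_ident DERIV_cdivide[OF displ_deriv_snd[OF that, of e c x], of 672]]
      by (simp add: v_def W_def)
  qed (use W1 W2 in auto)
  also have "\<dots> = ennreal (\<integral>p. ?f p * (1 + W p / 672) \<partial>lborel)"
  proof (rule nn_integral_eq_integral)
    show "integrable lborel (\<lambda>p. ?f p * (1 + W p / 672))"
    proof (rule integrableI_bounded_set[where A=Q and B=2])
      show "AE x in lborel. x \<in> Q \<longrightarrow> norm (?f x * (1 + W x / 672)) \<le> 2"
        using W1 W2 by (intro AE_I2) (simp add: indicator_def)
    qed (use Qb emeasure_compact_finite[OF Q(1)] in auto)
    show "AE p in lborel. 0 \<le> ?f p * (1 + W p / 672)"
      using W1 by (intro AE_I2 mult_nonneg_nonneg) auto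
  qed
  finally have em0: "emeasure lborel (?\<phi> ` Q) = ennreal (\<integral>p. ?f p * (1 + W p / 672) \<partial>lborel)" .
  have em1: "(\<integral>p. ?f p * (1 + W p / 672) \<partial>lborel) = (\<E> p. ?f p * (1 + W p / 672))"
    by (rule integral_sq_meas_eq[symmetric]) (measurable, use Q(2) in \<open>auto simp: indicator_def\<close>)
  have em2: "(\<E> p. ?f p * (1 + W p / 672)) = (\<E> p. ?f p) + (\<E> p. ?f p * W p) / 672"
  proof -
    have i1: "integrable sq_meas ?f" by (rule integrable_sq[where B=1]) (auto simp: indicator_def)
    have i2: "integrable sq_meas (\<lambda>p. ?f p * W p)"
      by (rule integrable_sq[where B=336]) (measurable, rule abs_mult_le[OF _ Wb], simp add: indicator_def)
    have "(\<E> p. ?f p * (1 + W p / 672)) = (\<E> p. ?f p + ?f p * W p / 672)"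
      by (simp only: distrib_left mult_1_right times_divide_eq_right)
    also have "\<dots> = (\<E> p. ?f p) + (\<E> p. ?f p * W p / 672)"
      by (rule Bochner_Integration.integral_add[OF i1 integrable_divide_zero[OF i2]])
    also have "(\<E> p. ?f p * W p / 672) = (\<E> p. ?f p * W p) / 672"
      by (rule integral_divide_zero)
    finally show ?thesis .
  qed
  have em: "emeasure lborel (?\<phi> ` Q) = ennreal (m + (\<E> p. ?f p * W p) / 672)"
    unfolding em0 em1 em2 mf ..
  have m01: "0 \<le> m" "m \<le> 1"
    using mf sqm.prob_le_1[of Q] measure_sq_meas[OF Qb Q(2)] unfolding m by auto
  then have "0 \<le> m * (1 - m) / 32" by simp
  then have I0: "0 \<le> (\<E> p. ?f p * W p)" using g by (rule order.trans)
  have "measure lborel (?\<phi> ` Q) = m + (\<E> p. ?f p * W p) / 672"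
    unfolding measure_def em using I0 m01 by (intro enn2real_ennreal) auto
  moreover have "m * (1 - m) / 21504 \<le> (\<E> p. ?f p * W p) / 672"
    using divide_right_mono[OF g, of 672] by simp
  ultimately have "m + m * (1 - m) / 21504 \<le> measure lborel (?\<phi> ` Q)" by simp
  then show ?thesis using bl by blast
qed

section \<open>Filling the square\<close>

lemma integral_sq_swap:
  fixes F :: "point \<Rightarrow> real"
  assumes F: "F \<in> borel_measurable borel" "\<And>p. \<bar>F p\<bar> \<le> B"
  shows "(\<E> p. F (prod.swap p)) = (\<E> p. F p)"
proof -
  have m: "(\<lambda>p. F (prod.swap p)) \<in> borel_measurable borel"
    by (rule measurable_compose[OF _ F(1)])
       (auto intro!: borel_measurable_continuous_onI continuous_on_swap)
  show ?thesis
    unfolding integral_sq_iterated(1)[OF m F(2)] integral_sq_iterated(2)[OF F] by simp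
qed

lemma coef_swap:
  fixes g :: "point \<Rightarrow> real"
  assumes g[measurable]: "g \<in> borel_measurable borel" and gB: "\<And>x. \<bar>g x\<bar> \<le> 1"
  shows "coef (\<lambda>p. g (prod.swap p)) k l i j = coef g l k j i"
proof -
  have "(\<E> p. g (prod.swap p) * of_bool (cell k (fst p) = i \<and> cell l (snd p) = j)) =
    (\<E> p. (\<lambda>p. g p * of_bool (cell l (fst p) = j \<and> cell k (snd p) = i)) (prod.swap p))"
    by (simp add: conj_commute)
  also have "\<dots> = (\<E> p. g p * of_bool (cell l (fst p) = j \<and> cell k (snd p) = i))"
    by (rule integral_sq_swap[where B=1]) (use gB in \<open>auto simp: abs_mult\<close>)
  finally show ?thesis by (simp add: coef_def add.commute)
qed

lemma energy_swap:
  fixes g :: "point \<Rightarrow> real"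
  assumes g: "g \<in> borel_measurable borel" and gB: "\<And>x. \<bar>g x\<bar> \<le> 1"
  shows "energy (\<lambda>p. g (prod.swap p)) k l = energy g l k"
proof -
  have "energy (\<lambda>p. g (prod.swap p)) k l =
     (\<E> p. (\<lambda>p. (at_cell (coef g l k) l k p)\<^sup>2) (prod.swap p))"
    unfolding energy_def coef_swap[OF assms] by simp
  also have "\<dots> = energy g l k"
    unfolding energy_def
    by (rule integral_sq_swap[where B=1]) (use abs_coef_le[OF assms] in \<open>auto simp: abs_square_le_1\<close>)
  finally show ?thesis .
qed

lemma energy_0_0:
  fixes g :: "point \<Rightarrow> real"
  assumes g[measurable]: "g \<in> borel_measurable borel" and gB: "\<And>x. \<bar>g x\<bar> \<le> 1"
  shows "energy g 0 0 = (\<E> p. g p)\<^sup>2"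
proof -
  have "(\<E> p. g p * of_bool (cell 0 (fst p) = 0 \<and> cell 0 (snd p) = 0)) = (\<E> p. g p)"
  proof (rule integral_cong_AE)
    show "AE p in sq_meas. g p * of_bool (cell 0 (fst p) = 0 \<and> cell 0 (snd p) = 0) = g p"
      using AE_sq_in
    proof eventually_elim
      case (elim p)
      then have "cell 0 (fst p) = 0 \<and> cell 0 (snd p) = 0" by (simp add: cell_def floor_eq_iff)
      then show ?case by simp
    qed
  qed measurable
  then show ?thesis unfolding energy_eq_sum[OF assms] by (simp add: coef_def)
qed

text \<open>With c the cell means, c - c^2 \<le> [c \<noteq> 0] - c. So the deficit is at most the
  area outside \<open>Q\<close> of the cells with nonzero mean; these lie within 2 / 2^K of
  \<open>Q\<close>, and as \<open>Q\<close> is closed such neighbourhoods shrink to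
  \<open>Q\<close>.\<close>

lemma energy_tendsto:
  fixes Q :: "point set"
  assumes Q: "compact Q" "Q \<noteq> {}" and r: "r > 0"
  shows "\<exists>K. measure sq_meas Q - r \<le> energy (indicator Q) K K"
proof -
  let ?f = "indicator Q :: point \<Rightarrow> real"
  have Qb: "Q \<in> sets borel" using Q(1) by (rule borel_compact)
  have f[measurable]: "?f \<in> borel_measurable borel" using Qb by simp
  have fB: "\<bar>?f p\<bar> \<le> 1" for p by (simp add: indicator_def)
  define c where "c K = coef ?f K K" for K
  have c1: "\<bar>c K i j\<bar> \<le> 1" for K i j unfolding c_def by (rule abs_coef_le[OF f fB])
  define s where "s K p = (of_bool (p \<notin> Q \<and> infdist p Q \<le> 2 / 2 ^ K) :: real)" for K :: nat and p :: "point"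
  have sm[measurable]: "s K \<in> borel_measurable borel" for K
  proof -
    have "closed {p. infdist p Q \<le> 2 / 2 ^ K}"
      by (rule closed_Collect_le[OF continuous_on_infdist[OF continuous_on_id] continuous_on_const])
    from sets.Int[OF borel_comp[OF Qb] borel_closed[OF this]]
    have "(indicator (- Q \<inter> {p. infdist p Q \<le> 2 / 2 ^ K}) :: point \<Rightarrow> real) \<in> borel_measurable borel"
      by (rule borel_measurable_indicator)
    moreover have "(indicator (- Q \<inter> {p. infdist p Q \<le> 2 / 2 ^ K}) :: point \<Rightarrow> real) = s K"
      by (rule ext) (simp add: s_def indicator_def)
    ultimately show ?thesis by simp
  qed
  have *: "measure sq_meas Q - energy ?f K K \<le> (\<E> p. s K p)" for K
  proof -
    let ?c = "at_cell (c K) K K"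
    let ?d = "at_cell (\<lambda>i j. of_bool (c K i j \<noteq> 0) :: real) K K"
    have i: "integrable sq_meas F" if "F \<in> borel_measurable borel" "\<And>p. \<bar>F p\<bar> \<le> 1" for F :: "point \<Rightarrow> real"
      using that by (rule integrable_sq)
    have dm[measurable]: "?d \<in> borel_measurable borel" by measurable
    have e2: "(\<E> p. ?f p * ?d p) = (\<E> p. ?c p * ?d p)"
      using integral_mult_at_cell[OF f fB, of "\<lambda>i j. of_bool (c K i j \<noteq> 0)" 1 K K]
      unfolding c_def by simp
    have e3: "(\<E> p. ?c p * ?d p) = (\<E> p. ?c p)"
      by (rule Bochner_Integration.integral_cong) auto
    have e4: "(\<E> p. ?f p * 1) = (\<E> p. ?c p * 1)"
      using integral_mult_at_cell[OF f fB, of "\<lambda>i j. 1" 1 K K] unfolding c_def by simp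
    have ip: "integrable sq_meas ?f" "integrable sq_meas ?c"
      "integrable sq_meas ?d" "integrable sq_meas (\<lambda>p. ?f p * ?d p)" "integrable sq_meas (s K)"
      "integrable sq_meas (\<lambda>p. (?c p)\<^sup>2)"
      using c1 by (auto intro!: i abs_mult_le fB simp: s_def abs_square_le_1)
    have "energy ?f K K = (\<E> p. (?c p)\<^sup>2)" by (simp add: energy_def c_def)
    then have "measure sq_meas Q - energy ?f K K = (\<E> p. ?c p - (?c p)\<^sup>2)"
      using e4 ip Qb by simp
    also have "\<dots> \<le> (\<E> p. ?d p - ?c p)"
    proof (rule integral_mono)
      fix p
      show "?c p - (?c p)\<^sup>2 \<le> ?d p - ?c p"
      proof (cases "?c p = 0")
        case False
        have "0 \<le> (1 - ?c p)\<^sup>2" by simp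
        then show ?thesis using False by (simp add: power2_eq_square algebra_simps)
      qed simp
    qed (use ip in auto)
    also have "\<dots> = (\<E> p. ?d p - ?f p * ?d p)"
      using ip e2 e3 by simp
    also have "\<dots> \<le> (\<E> p. s K p)"
    proof (rule integral_mono)
      fix p
      show "?d p - ?f p * ?d p \<le> s K p"
      proof (cases "p \<notin> Q \<and> ?c p \<noteq> 0")
        case True
        then obtain q where q: "q \<in> Q" "cell K (fst q) = cell K (fst p)" "cell K (snd q) = cell K (snd p)"
        proof -
          have "\<exists>q. ?f q * of_bool (cell K (fst q) = cell K (fst p) \<and> cell K (snd q) = cell K (snd p)) \<noteq> 0"
          proof (rule ccontr)
            assume "\<not> ?thesis"
            then have "?f q * of_bool (cell K (fst q) = cell K (fst p) \<and> cell K (snd q) = cell K (snd p)) = 0" for q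
              by blast
            then have "?c p = 0"
              unfolding c_def coef_def by (simp only: Bochner_Integration.integral_zero mult_zero_right)
            then show False using True by simp
          qed
          then show thesis using that by (auto simp: indicator_def)
        qed
        have close: "\<bar>t - u\<bar> \<le> 1 / 2 ^ K" if "cell K t = cell K u" for t u
        proof -
          have "\<bar>2 ^ K * t - 2 ^ K * u\<bar> \<le> 1" using that unfolding cell_def by linarith
          then have "2 ^ K * \<bar>t - u\<bar> \<le> 1" by (simp add: abs_mult flip: right_diff_distrib)
          then show ?thesis by (simp add: field_simps)
        qed
        have "infdist p Q \<le> dist p q" using q(1) by (rule infdist_le)
        also have "\<dots> \<le> \<bar>fst p - fst q\<bar> + \<bar>snd p - snd q\<bar>"
          using dist_Pair_bounds(3)[of "fst p" "snd p" "fst q" "snd q"] by simp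
        also have "\<dots> \<le> 1 / 2 ^ K + 1 / 2 ^ K" by (intro add_mono close) (use q in auto)
        finally have "infdist p Q \<le> 2 / 2 ^ K" by simp
        then show ?thesis using True by (simp add: s_def)
      qed (auto simp: s_def)
    qed (use ip in auto)
    finally show ?thesis .
  qed
  have "(\<lambda>K. \<integral>p. s K p \<partial>sq_meas) \<longlonglongrightarrow> (\<E> p. 0)"
  proof (rule integral_dominated_convergence[where w="\<lambda>_. 1"])
    show "AE p in sq_meas. (\<lambda>K. s K p) \<longlonglongrightarrow> 0"
    proof (rule AE_I2)
      fix p
      show "(\<lambda>K. s K p) \<longlonglongrightarrow> 0"
      proof (cases "p \<in> Q")
        case True then show ?thesis by (simp add: s_def)
      next
        case False
        have "infdist p Q > 0"
          using False Q compact_imp_closed[OF Q(1)] in_closed_iff_infdist_zero[of Q p] infdist_nonneg[of p Q]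
          by (simp add: less_le)
        moreover have "(\<lambda>K. 2 / 2 ^ K :: real) \<longlonglongrightarrow> 0"
          by (rule LIMSEQ_divide_realpow_zero) simp
        ultimately have "\<forall>\<^sub>F K in sequentially. 2 / 2 ^ K < infdist p Q" by (simp add: order_tendstoD(2))
        then have "\<forall>\<^sub>F K in sequentially. s K p = 0" by eventually_elim (auto simp: s_def)
        then show ?thesis by (rule tendsto_eventually)
      qed
    qed
    show "AE p in sq_meas. norm (s K p) \<le> 1" for K by (simp add: s_def)
  qed (auto simp: measurable_cong_sets[OF sets_sq_meas refl])
  then have "(\<lambda>K. \<integral>p. s K p \<partial>sq_meas) \<longlonglongrightarrow> 0" by simp
  then have "\<forall>\<^sub>F K in sequentially. (\<E> p. s K p) < r" using r by (rule order_tendstoD(2))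
  then obtain K where "(\<E> p. s K p) < r" unfolding eventually_sequentially by blast
  then show ?thesis using *[of K] by (intro exI[of _ K]) linarith
qed

lemma measure_swap_image:
  assumes "compact (A :: point set)"
  shows "measure lborel (prod.swap ` A) = measure lborel A"
proof -
  have Ab: "A \<in> sets (lborel \<Otimes>\<^sub>M lborel)" using borel_compact[OF assms] by (subst lborel_prod) simp
  have "emeasure (lborel \<Otimes>\<^sub>M lborel) A =
      emeasure (distr (lborel \<Otimes>\<^sub>M lborel) (lborel \<Otimes>\<^sub>M lborel) (\<lambda>(x, y). (y, x))) A"
    by (rule arg_cong[OF lborel_pair.distr_pair_swap])
  also have "\<dots> = emeasure (lborel \<Otimes>\<^sub>M lborel) ((\<lambda>(x, y). (y, x)) -` A \<inter> space (lborel \<Otimes>\<^sub>M lborel))"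
    using Ab by (intro emeasure_distr measurable_pair_swap') auto
  also have "(\<lambda>(x, y). (y, x)) -` A \<inter> space (lborel \<Otimes>\<^sub>M lborel) = prod.swap ` A"
    by (force simp: space_pair_measure)
  finally show ?thesis unfolding lborel_prod measure_def by simp
qed

lemma swap_unit [simp]: "prod.swap p \<in> unit_sq \<longleftrightarrow> p \<in> unit_sq"
  by (cases p) auto

lemma dist_swap [simp]: "dist (prod.swap p) (prod.swap q) = dist (p :: point) q"
  by (cases p, cases q) (simp add: dist_Pair_Pair add.commute)

lemma bilip_swap:
  assumes "bilip M \<phi>" shows "bilip M (\<lambda>p. prod.swap (\<phi> (prod.swap p)))"
proof -
  have fr: "prod.swap p \<in> frontier (unit_sq) \<longleftrightarrow> p \<in> frontier (unit_sq)" for p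
    unfolding frontier_unit by auto
  show ?thesis
    unfolding bilip_def
  proof (intro conjI ballI)
    fix p q :: "point" assume pq: "p \<in> unit_sq" "q \<in> unit_sq"
    have "\<forall>p\<in>unit_sq. \<forall>q\<in>unit_sq.
        dist p q \<le> M * dist (\<phi> p) (\<phi> q) \<and> dist (\<phi> p) (\<phi> q) \<le> M * dist p q"
      using assms unfolding bilip_def by blast
    from this[rule_format, of "prod.swap p" "prod.swap q"] pq
    show "dist p q \<le> M * dist (prod.swap (\<phi> (prod.swap p))) (prod.swap (\<phi> (prod.swap q)))"
      "dist (prod.swap (\<phi> (prod.swap p))) (prod.swap (\<phi> (prod.swap q))) \<le> M * dist p q"
      by simp_all
  qed (use assms fr in \<open>auto simp: bilip_def\<close>)
qed

lemma bilip_continuous: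
  assumes "bilip M \<phi>" shows "continuous_on (unit_sq) \<phi>"
proof -
  have "0 \<le> M"
  proof -
    have "dist (0::real,0::real) (0,1) \<le> M * dist (\<phi> (0,0)) (\<phi> (0,1))" using assms by (simp add: bilip_def)
    then have "0 < M * dist (\<phi> (0,0)) (\<phi> (0,1))" by (simp add: dist_Pair_Pair)
    then show ?thesis by (simp add: zero_less_mult_iff)
  qed
  then have "M-lipschitz_on (unit_sq) \<phi>" using assms by (simp add: lipschitz_on_def bilip_def)
  then show ?thesis by (rule lipschitz_on_continuous_on)
qed

lemma bilip_id: "1 \<le> M \<Longrightarrow> bilip M (\<lambda>p. p)"
  unfolding bilip_def by (auto simp: mult_le_cancel_right1 intro: order.trans[OF _ mult_right_mono[of 1 M]])

lemma density_step:
  fixes Q :: "point set"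
  assumes Q: "compact Q" "Q \<subseteq> unit_sq"
  defines "m \<equiv> measure lborel Q"
  shows "\<exists>\<phi>. bilip 4 \<phi> \<and> measure lborel (\<phi> ` Q) \<ge> m + m * (1 - m) / 21504"
proof (cases "m * (1 - m) = 0")
  case True
  then show ?thesis unfolding m_def using bilip_id[of 4] by (intro exI[of _ "\<lambda>p. p"]) auto
next
  case False
  let ?f = "indicator Q :: point \<Rightarrow> real"
  have Qb: "Q \<in> sets borel" using Q(1) by (rule borel_compact)
  have f: "?f \<in> borel_measurable borel" using Qb by simp
  have fB: "\<bar>?f p\<bar> \<le> 1" for p by (simp add: indicator_def)
  have mm: "measure sq_meas Q = m" unfolding m_def by (rule measure_sq_meas[OF Qb Q(2)])
  have "0 \<le> m" "m \<le> 1" using sqm.prob_le_1[of Q] by (auto simp flip: mm)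
  then have V: "0 < m * (1 - m)" using False by (auto simp: less_le)
  have "Q \<noteq> {}" using False by (auto simp: m_def)
  \<comment> \<open>\<open>K\<close> depends on \<open>Q\<close>, but no later bound depends on
    \<open>K\<close>. The tolerance leaves 3/4 of the variance.\<close>
  then obtain K where K: "m - m * (1 - m) / 4 \<le> energy ?f K K"
    using energy_tendsto[OF Q(1), of "m * (1 - m) / 4"] V unfolding mm by auto
  define Q' where "Q' = prod.swap ` Q"
  have Q': "compact Q'" "Q' \<subseteq> unit_sq" "measure lborel Q' = m"
    using Q compact_continuous_image[OF continuous_on_swap Q(1)] measure_swap_image[OF Q(1)]
    by (auto simp: Q'_def m_def)
  have ind: "indicator Q' = (\<lambda>p. ?f (prod.swap p))"
    by (force simp: Q'_def indicator_def fun_eq_iff image_iff)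
  \<comment> \<open>A level is refined in two moves: squares are halved in y, then the half squares
    in x, which is a vertical refinement of the swapped set with \<open>e = 1\<close>. The
    increments telescope, and the better direction carries at least half of the total, that is 3/8
    of the variance.\<close>
  define T0 where "T0 = (\<Sum>k<K. energy ?f (k + 0) (Suc k) - energy ?f (k + 0) k)"
  define T1 where "T1 = (\<Sum>k<K. energy (indicator Q') (k + 1) (Suc k) - energy (indicator Q') (k + 1) k)"
  have "T0 + T1 = (\<Sum>k<K. energy ?f (Suc k) (Suc k) - energy ?f k k)"
    unfolding T0_def T1_def ind energy_swap[OF f fB] sum.distrib[symmetric] by (intro sum.cong) auto
  also have "\<dots> = energy ?f K K - energy ?f 0 0" by (rule sum_lessThan_telescope)
  also have "energy ?f 0 0 = m\<^sup>2" using energy_0_0[OF f fB] Qb by (simp add: mm)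
  finally have T: "T0 + T1 = energy ?f K K - m\<^sup>2" .
  have "m * (1 - m) = m - m\<^sup>2" by (simp add: power2_eq_square algebra_simps)
  then have "3 / 4 * (m * (1 - m)) = (m - m * (1 - m) / 4) - m\<^sup>2" by (simp add: field_simps)
  also have "\<dots> \<le> T0 + T1" unfolding T using K by (rule diff_right_mono)
  finally have "3 / 4 * (m * (1 - m)) \<le> T0 + T1" .
  then consider "3 / 8 * (m * (1 - m)) \<le> T0" | "3 / 8 * (m * (1 - m)) \<le> T1" by linarith
  then show ?thesis
  proof cases
    case 1
    then show ?thesis using vertical_step[OF Q _ meta_eq_to_obj_eq[OF m_def], of 0 K] unfolding T0_def by simp
  next
    case 2
    then obtain \<phi> where \<phi>: "bilip 4 \<phi>" "m + m * (1 - m) / 21504 \<le> measure lborel (\<phi> ` Q')"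
      using vertical_step[OF Q'(1,2) _ Q'(3)[symmetric], of 1 K] unfolding T1_def by auto
    have "compact (\<phi> ` Q')"
      by (rule compact_continuous_image[OF continuous_on_subset[OF bilip_continuous[OF \<phi>(1)] Q'(2)] Q'(1)])
    then have "measure lborel ((\<lambda>p. prod.swap (\<phi> (prod.swap p))) ` Q) = measure lborel (\<phi> ` Q')"
      using measure_swap_image[of "\<phi> ` Q'"] by (simp add: Q'_def image_image)
    then show ?thesis using \<phi> bilip_swap[OF \<phi>(1)] by (intro exI[of _ "\<lambda>p. prod.swap (\<phi> (prod.swap p))"]) simp
  qed
qed

section \<open>Iteration of the gain\<close>

lemma bilip_compose:
  assumes "bilip M \<phi>" "bilip N \<psi>" "0 \<le> M" "0 \<le> N"
  shows "bilip (M * N) (\<lambda>p. \<psi> (\<phi> p))"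
  unfolding bilip_def
proof (intro conjI ballI)
  fix p q :: "point" assume pq: "p \<in> unit_sq" "q \<in> unit_sq"
  then have u: "\<phi> p \<in> unit_sq" "\<phi> q \<in> unit_sq" using assms by (auto simp: bilip_def)
  have "dist p q \<le> M * dist (\<phi> p) (\<phi> q)" using assms pq by (simp add: bilip_def)
  also have "\<dots> \<le> M * (N * dist (\<psi> (\<phi> p)) (\<psi> (\<phi> q)))"
    using assms u by (intro mult_left_mono) (simp_all add: bilip_def)
  finally show "dist p q \<le> M * N * dist (\<psi> (\<phi> p)) (\<psi> (\<phi> q))" by simp
  have "dist (\<psi> (\<phi> p)) (\<psi> (\<phi> q)) \<le> N * dist (\<phi> p) (\<phi> q)" using assms u by (simp add: bilip_def)
  also have "\<dots> \<le> N * (M * dist p q)"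
    using assms pq by (intro mult_left_mono) (simp_all add: bilip_def)
  finally show "dist (\<psi> (\<phi> p)) (\<psi> (\<phi> q)) \<le> M * N * dist p q" by (simp add: mult_ac)
next
  fix p :: "point" assume p: "p \<in> frontier (unit_sq)"
  then show "\<psi> (\<phi> p) = p" using assms by (simp add: bilip_def)
qed (use assms in \<open>auto simp: bilip_def\<close>)

lemma bilip_mono:
  assumes "bilip M \<phi>" "M \<le> N" shows "bilip N \<phi>"
  unfolding bilip_def
proof (intro conjI ballI)
  fix p q :: "point" assume pq: "p \<in> unit_sq" "q \<in> unit_sq"
  have *: "M * d \<le> N * d" if "0 \<le> d" for d using assms(2) that by (rule mult_right_mono)
  show "dist p q \<le> N * dist (\<phi> p) (\<phi> q)" "dist (\<phi> p) (\<phi> q) \<le> N * dist p q"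
    using assms(1) pq order.trans[OF _ *] by (auto simp: bilip_def)
qed (use assms in \<open>auto simp: bilip_def\<close>)

text \<open>As long as the area lies between d and 1 - r, a step gains at least d r / 21504. The
  \<open>min\<close> covers the case that 1 - r is already reached; the map is then left alone. The
  lower bound d has to be carried along to keep the gain uniform.\<close>

lemma density_iterate:
  fixes Q :: "point set"
  assumes Q: "compact Q" "Q \<subseteq> unit_sq" and d: "0 < d" "d \<le> measure lborel Q" and r: "0 < r"
  shows "\<exists>\<phi>. bilip (4 ^ J) \<phi> \<and> d \<le> measure lborel (\<phi> ` Q) \<and>
    min (1 - r) (d + real J * (d * r / 21504)) \<le> measure lborel (\<phi> ` Q)"
proof (induction J)
  case 0
  then show ?case using d bilip_id[of 1] by (intro exI[of _ "\<lambda>p. p"]) auto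
next
  case (Suc J)
  then obtain \<phi> where \<phi>: "bilip (4 ^ J) \<phi>" and dm: "d \<le> measure lborel (\<phi> ` Q)"
    and mi: "min (1 - r) (d + real J * (d * r / 21504)) \<le> measure lborel (\<phi> ` Q)" by blast
  define m where "m = measure lborel (\<phi> ` Q)"
  show ?case
  proof (cases "1 - r \<le> m")
    case True
    have "bilip (4 ^ Suc J) \<phi>" by (rule bilip_mono[OF \<phi>]) simp
    then show ?thesis using True dm by (intro exI[of _ \<phi>]) (simp add: m_def)
  next
    case False
    have c: "compact (\<phi> ` Q)"
      by (rule compact_continuous_image[OF continuous_on_subset[OF bilip_continuous[OF \<phi>] Q(2)] Q(1)])
    have sub: "\<phi> ` Q \<subseteq> unit_sq" using \<phi> Q(2) unfolding bilip_def by blast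
    obtain \<psi> where \<psi>: "bilip 4 \<psi>" "m + m * (1 - m) / 21504 \<le> measure lborel (\<psi> ` \<phi> ` Q)"
      using density_step[OF c sub] unfolding m_def by blast
    have "d * r \<le> m * (1 - m)" using False dm d r unfolding m_def by (intro mult_mono) auto
    define t where "t = d * r / 21504"
    have "m + t \<le> measure lborel (\<psi> ` \<phi> ` Q)"
      using \<psi>(2) divide_right_mono[OF \<open>d * r \<le> m * (1 - m)\<close>, of 21504] by (simp add: t_def)
    moreover have "0 < t" using d r by (simp add: t_def)
    moreover have "d + real J * t \<le> m" using mi False by (simp add: m_def t_def min_le_iff_disj)
    moreover have "d + real (Suc J) * t = (d + real J * t) + t" by (simp add: algebra_simps)
    ultimately have "d \<le> measure lborel (\<psi> ` \<phi> ` Q)" "d + real (Suc J) * (d * r / 21504) \<le> measure lborel (\<psi> ` \<phi> ` Q)"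
      using dm unfolding t_def[symmetric] m_def[symmetric] by linarith+
    moreover have "bilip (4 ^ Suc J) (\<lambda>p. \<psi> (\<phi> p))"
      using bilip_compose[OF \<phi> \<psi>(1)] by (simp add: mult.commute)
    ultimately show ?thesis by (intro exI[of _ "\<lambda>p. \<psi> (\<phi> p)"]) (auto simp: image_image)
  qed
qed

lemma bilip_fill:
  assumes d: "0 < d" and r: "0 < r"
  shows "\<exists>M>0. \<forall>Q. compact Q \<and> Q \<subseteq> unit_sq \<and> d \<le> measure lborel Q \<longrightarrow>
    (\<exists>\<phi>. bilip M \<phi> \<and> 1 - r \<le> measure lborel (\<phi> ` Q))"
proof -
  \<comment> \<open>After \<open>J\<close> steps the guaranteed gain exceeds 1. The number of steps,
    hence the constant \<open>4 ^ J\<close>, depends on d and r only.\<close>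
  obtain J :: nat where "1 / (d * r / 21504) \<le> real J" using real_arch_simple by blast
  then have "1 \<le> real J * (d * r / 21504)" using d r by (simp add: field_simps)
  then have J: "min (1 - r) (d + real J * (d * r / 21504)) = 1 - r" using d r by simp
  show ?thesis
  proof (intro exI[of _ "4 ^ J"] conjI allI impI)
    fix Q :: "point set"
    assume "compact Q \<and> Q \<subseteq> unit_sq \<and> d \<le> measure lborel Q"
    then show "\<exists>\<phi>. bilip (4 ^ J) \<phi> \<and> 1 - r \<le> measure lborel (\<phi> ` Q)"
      using density_iterate[of Q d r J] d r unfolding J by blast
  qed simp
qed

section \<open>The Poisson event\<close>

text \<open>Half-open blocks of side 1 / N. The parameter is real because the same q by q grid is
  used on the unit square with N = q and on the large square with N = q / n.\<close>

definition gcell :: "real \<Rightarrow> int \<times> int \<Rightarrow> point set" where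
  "gcell N c = {p. \<lfloor>N * fst p\<rfloor> = fst c \<and> \<lfloor>N * snd p\<rfloor> = snd c}"

lemma gcell_eq:
  assumes "N > 0"
  shows "gcell N (a, b) = {a / N..<(a + 1) / N} \<times> {b / N..<(b + 1) / N}"
  using assms by (auto simp: gcell_def floor_eq_iff field_simps)

lemma gcell_borel: "N > 0 \<Longrightarrow> gcell N c \<in> sets borel"
  by (cases c) (auto simp: gcell_eq intro!: borel_Times)

lemma emeasure_gcell:
  assumes "N > 0" shows "emeasure lborel (gcell N c) = ennreal (1 / N\<^sup>2)"
proof -
  obtain a b where c: "c = (a, b)" by (cases c)
  have "emeasure lborel (gcell N c) = emeasure (lborel \<Otimes>\<^sub>M lborel)
      ({of_int a / N..<(of_int a + 1) / N} \<times> {of_int b / N..<(of_int b + 1) / N})"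
    unfolding c gcell_eq[OF assms] lborel_prod ..
  also have "\<dots> = emeasure lborel {of_int a / N..<(of_int a + 1) / N} * emeasure lborel {of_int b / N..<(of_int b + 1) / N}"
    by (rule lborel.emeasure_pair_measure_Times) auto
  also have "\<dots> = ennreal (1 / N) * ennreal (1 / N)"
  proof -
    have "emeasure lborel {x / N..<(x + 1) / N} = ennreal (1 / N)" for x
      using emeasure_lborel_Ico[OF divide_right_mono[of x "x + 1" N]] assms by (simp add: add_divide_distrib)
    then show ?thesis by (simp only:)
  qed
  also have "\<dots> = ennreal (1 / N\<^sup>2)"
    using assms by (simp add: ennreal_mult[symmetric] power2_eq_square)
  finally show ?thesis .
qed

lemma gcell_disjoint: "c \<noteq> d \<Longrightarrow> gcell N c \<inter> gcell N d = {}"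
  by (auto simp: gcell_def prod_eq_iff)

lemma measure_gcells:
  assumes "N > 0" "finite I"
  shows "measure lborel (\<Union>c\<in>I. gcell N c) = card I / N\<^sup>2"
proof -
  have e: "emeasure lborel (\<Union>c\<in>I. gcell N c) = ennreal (card I / N\<^sup>2)"
  proof -
    have "emeasure lborel (\<Union>c\<in>I. gcell N c) = (\<Sum>c\<in>I. emeasure lborel (gcell N c))"
      using assms gcell_borel gcell_disjoint
      by (intro sum_emeasure[symmetric]) (auto simp: disjoint_family_on_def)
    also have "\<dots> = ennreal (card I / N\<^sup>2)"
      using assms by (simp add: emeasure_gcell ennreal_of_nat_eq_real_of_nat ennreal_mult[symmetric])
    finally show ?thesis .
  qed
  show "measure lborel (\<Union>c\<in>I. gcell N c) = card I / N\<^sup>2"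
    unfolding measure_def e by simp
qed

section \<open>Counting assignments of points to blocks\<close>

definition balanced :: "nat \<Rightarrow> 'i set \<Rightarrow> 'g set \<Rightarrow> ('i \<Rightarrow> 'g) set" where
  "balanced j S G = {f \<in> S \<rightarrow>\<^sub>E G. \<forall>g\<in>G. card {i \<in> S. f i = g} = j}"

lemma finite_balanced: "finite S \<Longrightarrow> finite G \<Longrightarrow> finite (balanced j S G)"
  unfolding balanced_def by (rule finite_subset[OF _ finite_PiE[of S "\<lambda>_. G"]]) auto

text \<open>The lower bound for the multinomial coefficient (j |G|)! / (j!)^|G|. The induction on
  \<open>G\<close> chooses the j points that go to the new block and distributes the others.\<close>

lemma card_balanced:
  fixes S :: "'i set" and G :: "'g set"
  assumes "finite G" "finite S" "card S = j * card G"
  shows "fact (card S) \<le> card (balanced j S G) * fact j ^ card G"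
  using assms
proof (induction G arbitrary: S rule: finite_induct)
  case empty
  then have "S = {}" by simp
  then have "balanced j S ({} :: 'g set) = {\<lambda>_. undefined}" by (auto simp: balanced_def)
  then show ?case using \<open>S = {}\<close> by simp
next
  case (insert g G)
  have cS: "card S = j + j * card G" using insert by simp
  define \<A> where "\<A> = {A. A \<subseteq> S \<and> card A = j}"
  have fA: "finite \<A>" unfolding \<A>_def using insert.prems(1) by simp
  define P where "P = (SIGMA A:\<A>. balanced j (S - A) G)"
  \<comment> \<open>Glues a chosen set \<open>A\<close>, sent to \<open>g\<close>, with a balanced
    assignment of the remaining points. Since \<open>g\<close> is not in \<open>G\<close>, the set
    \<open>A\<close> can be read off from the result, so the gluing is injective.\<close>
  define \<Phi> where "\<Phi> = (\<lambda>(A, h) i. if i \<in> A then g else if i \<in> S then h i else undefined)"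
  have finb: "finite (balanced j S (insert g G))" using insert by (intro finite_balanced) auto
  have cA: "card (S - A) = j * card G" if "A \<in> \<A>" for A
    using that insert.prems cS finite_subset[of A S] by (auto simp: \<A>_def card_Diff_subset)
  have range: "\<Phi> ` P \<subseteq> balanced j S (insert g G)"
  proof
    fix f assume "f \<in> \<Phi> ` P"
    then obtain A h where A: "A \<subseteq> S" "card A = j" and h: "h \<in> balanced j (S - A) G" and f: "f = \<Phi> (A, h)"
      by (auto simp: P_def \<A>_def)
    have hG: "h i \<in> G" if "i \<in> S - A" for i using h that by (auto simp: balanced_def)
    have f1: "f \<in> S \<rightarrow>\<^sub>E insert g G" using A hG by (auto simp: f \<Phi>_def)
    have "{i \<in> S. f i = g} = A" using A hG insert.hyps(2) by (auto simp: f \<Phi>_def)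
    moreover have "card {i \<in> S. f i = x} = j" if "x \<in> G" for x
    proof -
      have "{i \<in> S. f i = x} = {i \<in> S - A. h i = x}" using that insert.hyps(2) by (auto simp: f \<Phi>_def)
      then show ?thesis using h that by (simp add: balanced_def)
    qed
    ultimately show "f \<in> balanced j S (insert g G)" using f1 A by (auto simp: balanced_def)
  qed
  have inj: "inj_on \<Phi> P"
  proof (rule inj_onI)
    fix u w assume "u \<in> P" "w \<in> P" and eq: "\<Phi> u = \<Phi> w"
    then obtain A h B k where u: "u = (A, h)" "w = (B, k)" and A: "A \<subseteq> S" "B \<subseteq> S"
      and h: "h \<in> balanced j (S - A) G" and k: "k \<in> balanced j (S - B) G"
      by (auto simp: P_def \<A>_def)
    have e: "\<Phi> (A, h) i = \<Phi> (B, k) i" for i using eq by (simp add: u)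
    have hG: "h i \<in> G" if "i \<in> S - A" for i using h that by (auto simp: balanced_def)
    have kG: "k i \<in> G" if "i \<in> S - B" for i using k that by (auto simp: balanced_def)
    have AB: "A = B"
    proof (rule set_eqI)
      fix i show "i \<in> A \<longleftrightarrow> i \<in> B"
      proof (cases "i \<in> S")
        case True
        then show ?thesis using e[of i] hG[of i] kG[of i] insert.hyps(2) by (auto simp: \<Phi>_def split: if_splits)
      qed (use A in auto)
    qed
    have "h = k"
    proof (rule ext)
      fix i show "h i = k i"
      proof (cases "i \<in> S - A")
        case True then show ?thesis using e[of i] AB by (auto simp: \<Phi>_def)
      next
        case False
        then have "h i = undefined" "k i = undefined"
          using h k AB by (auto simp: balanced_def PiE_def extensional_def)
        then show ?thesis by simp
      qed
    qed
    then show "u = w" using AB by (simp add: u)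
  qed
  have "fact (card S) = (card S choose j) * fact j * fact (j * card G)"
    using binomial_fact_lemma[of j "card S"] cS by (simp add: mult_ac)
  also have "\<dots> = (\<Sum>A\<in>\<A>. fact (card (S - A))) * fact j"
  proof -
    have "(\<Sum>A\<in>\<A>. fact (card (S - A))) = (\<Sum>A\<in>\<A>. fact (j * card G) :: nat)"
      by (rule sum.cong) (simp_all add: cA)
    also have "\<dots> = (card S choose j) * fact (j * card G)"
      using n_subsets[OF insert.prems(1), of j] by (simp add: \<A>_def)
    finally show ?thesis by simp
  qed
  also have "\<dots> \<le> (\<Sum>A\<in>\<A>. card (balanced j (S - A) G) * fact j ^ card G) * fact j"
    by (intro mult_right_mono sum_mono insert.IH) (use insert.prems cA in auto)
  also have "\<dots> = card P * fact j ^ card (insert g G)"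
    using insert.hyps fA insert.prems(1)
    by (simp add: P_def card_SigmaI finite_balanced sum_distrib_right sum_distrib_left mult_ac)
  also have "\<dots> \<le> card (balanced j S (insert g G)) * fact j ^ card (insert g G)"
    by (intro mult_right_mono card_inj_on_le[OF inj range finb]) simp
  finally show ?case .
qed

section \<open>Stirling-type lower bounds\<close>

lemma power_div_fact_ge: "1 \<le> j \<Longrightarrow> exp (real j - 1) / real j \<le> real j ^ j / fact j"
proof (induction j rule: dec_induct)
  case base then show ?case by simp
next
  case (step j)
  have j: "real j > 0" using step by simp
  \<comment> \<open>From ln x \<le> x - 1 at x = j / (j + 1). It yields (1 + 1/j)^(j+1) \<ge> e,
    which is the growth factor needed in the induction step.\<close>
  have "1 / (real j + 1) \<le> ln (1 + 1 / real j)"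
  proof -
    have "ln (real j / (real j + 1)) \<le> real j / (real j + 1) - 1"
      using j by (intro ln_le_minus_one) simp
    moreover have "ln (1 + 1 / real j) = - ln (real j / (real j + 1))"
      using j by (simp add: ln_div add_divide_distrib[symmetric] field_simps)
    moreover have "real j / (real j + 1) - 1 = - (1 / (real j + 1))" using j by (simp add: field_simps)
    ultimately show ?thesis by simp
  qed
  then have "1 \<le> real (Suc j) * ln (1 + 1 / real j)" using j by (simp add: field_simps)
  then have "exp 1 \<le> exp (real (Suc j) * ln (1 + 1 / real j))" by simp
  also have "\<dots> = (1 + 1 / real j) ^ Suc j"
    using j by (subst exp_of_nat_mult) (simp add: exp_ln add_pos_pos)
  finally have e: "exp 1 \<le> (1 + 1 / real j) ^ Suc j" .
  have "exp (real (Suc j) - 1) / real (Suc j) = exp 1 * (exp (real j - 1) / real j) * (real j / real (Suc j))"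
  proof -
    have "exp (real (Suc j) - 1) = exp 1 * exp (real j - 1)" by (simp flip: exp_add)
    then show ?thesis using j by (simp only: times_divide_eq_right times_divide_eq_left) simp
  qed
  also have "\<dots> \<le> (1 + 1 / real j) ^ Suc j * (real j ^ j / fact j) * (real j / real (Suc j))"
    by (intro mult_right_mono mult_mono e step.IH) auto
  also have "\<dots> = real (Suc j) ^ Suc j / fact (Suc j)"
  proof -
    have "(1 + 1 / real j) ^ Suc j = real (Suc j) ^ Suc j / real j ^ Suc j"
    proof -
      have "1 + 1 / real j = real (Suc j) / real j" using j by (simp add: field_simps)
      then show ?thesis by (simp only: power_divide)
    qed
    moreover have "B / (J * A) * (A / F) * (J / S) = B / (S * F)" if "A \<noteq> 0" "J \<noteq> 0" for A B F J S :: real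
      using that by simp
    ultimately show ?thesis using j by (simp only: power_Suc[of "real j"] fact_Suc power_eq_0_iff) simp
  qed
  finally show ?case .
qed

text \<open>At j = floor s, the mode of the Poisson law of mean s, the left side of
  \<open>power_div_fact_ge\<close> is exp s up to a loss of at most 2 + ln s in the exponent, and
  this is below \<theta> s for large s.\<close>

lemma poisson_mode_ge:
  fixes \<theta> :: real
  assumes "0 < \<theta>"
  shows "\<exists>s0\<ge>1. \<forall>s\<ge>s0. exp ((1 - \<theta>) * s) \<le> s ^ nat \<lfloor>s\<rfloor> / fact (nat \<lfloor>s\<rfloor>)"
proof -
  have "((\<lambda>s::real. (2 + ln s) / s) \<longlongrightarrow> 0) at_top"
  proof -
    have "((\<lambda>s::real. 2 / s + ln s / s) \<longlongrightarrow> 0 + 0) at_top"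
      by (intro tendsto_add ln_x_over_x_tendsto_0 tendsto_divide_0[OF tendsto_const])
         (auto simp: filterlim_at_top_imp_at_infinity filterlim_ident)
    then show ?thesis by (simp add: add_divide_distrib)
  qed
  then have "eventually (\<lambda>s::real. (2 + ln s) / s < \<theta>) at_top" using assms by (rule order_tendstoD(2))
  then obtain s1 where s1: "\<And>s. s \<ge> s1 \<Longrightarrow> (2 + ln s) / s < \<theta>" unfolding eventually_at_top_linorder by blast
  show ?thesis
  proof (intro exI[of _ "max 1 s1"] conjI allI impI)
    fix s assume s: "max 1 s1 \<le> s"
    define j where "j = nat \<lfloor>s\<rfloor>"
    have fl: "1 \<le> \<lfloor>s\<rfloor>" using s by (simp add: le_floor_iff)
    then have rj: "real j = of_int \<lfloor>s\<rfloor>" by (simp add: j_def)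
    have j1: "1 \<le> j" using fl by (simp add: j_def le_nat_iff)
    have js: "real j \<le> s" "s < real j + 1" unfolding rj by linarith+
    have "2 + ln s < \<theta> * s" using s1[of s] s by (simp add: field_simps)
    then have "(1 - \<theta>) * s \<le> (real j - 1) - ln (real j)"
    proof -
      have "ln (real j) \<le> ln s" using j1 js by simp
      then show ?thesis using \<open>2 + ln s < \<theta> * s\<close> js by (simp add: algebra_simps)
    qed
    then have "exp ((1 - \<theta>) * s) \<le> exp (real j - 1) / real j"
      using j1 by (metis exp_diff exp_ln exp_le_cancel_iff of_nat_0_less_iff less_le_trans zero_less_one)
    also have "\<dots> \<le> real j ^ j / fact j" using j1 by (rule power_div_fact_ge)
    also have "\<dots> \<le> s ^ j / fact j" using js by (intro divide_right_mono power_mono) auto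
    finally show "exp ((1 - \<theta>) * s) \<le> s ^ nat \<lfloor>s\<rfloor> / fact (nat \<lfloor>s\<rfloor>)" unfolding j_def .
  qed simp
qed

section \<open>Probability of a prescribed occupancy\<close>

lemma gcell_subset_square:
  assumes n: "n > 0" and q: "q > 0" and g: "g \<in> {0..<int q} \<times> {0..<int q}"
  shows "gcell (real q / real n) g \<subseteq> square n"
proof
  let ?c = "real q / real n"
  have c: "?c > 0" using n q by simp
  fix p assume p: "p \<in> gcell ?c g"
  obtain a b where ab: "g = (a, b)" by (cases g)
  have r: "0 \<le> a" "a + 1 \<le> int q" "0 \<le> b" "b + 1 \<le> int q" using g ab by auto
  have *: "0 \<le> x \<and> x \<le> real n" if "\<lfloor>?c * x\<rfloor> = a" "0 \<le> a" "a + 1 \<le> int q" for x a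
  proof
    have "of_int a \<le> ?c * x" "?c * x < of_int a + 1" using that(1) by linarith+
    moreover have "0 \<le> real_of_int a" "real_of_int a + 1 \<le> real q" using that(2,3) by linarith+
    ultimately have "0 \<le> ?c * x" "?c * x \<le> real q" by linarith+
    then show "0 \<le> x" "x \<le> real n" using c n q by (auto simp: zero_le_mult_iff field_simps)
  qed
  show "p \<in> square n"
    using p r *[of "fst p" a] *[of "snd p" b]
    by (cases p) (auto simp: square_def gcell_def ab)
qed

text \<open>With s = n^2 / q^2 the bound is the product over all q^2 blocks that independence
  predicts: exp (- s) s^j / j! for a block in \<open>G\<close> and exp (- s) for an empty one. Only
  the total number j |G| of points contributes; given it, every balanced assignment has probability
  q^(-2 j |G|), and \<open>card_balanced\<close> counts the assignments.\<close>

lemma poisson_occupancy: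
  fixes n q :: nat and G :: "(int \<times> int) set"
  assumes n: "n > 0" and q: "q > 0" and G: "G \<subseteq> {0..<int q} \<times> {0..<int q}"
    and E: "\<And>a f. (\<forall>i<j * card G. a i \<in> G \<and> f i \<in> gcell (real q / real n) (a i)) \<Longrightarrow>
       (\<forall>g\<in>G. card {i. i < j * card G \<and> a i = g} = j) \<Longrightarrow> E (f ` {..<j * card G})"
  shows "poisson_prob_ge n E (exp (- (real n ^ 2)) * ((real n ^ 2 / real q ^ 2) ^ j / fact j) ^ card G)"
proof -
  define N where "N = j * card G"
  define \<mu> where "\<mu> = uniform_measure lborel (square n)"
  have sq: "square n = {0..real n} \<times> {0..real n}" by (simp add: square_def cbox_Pair_eq)
  have sqb: "square n \<in> sets lborel" by (simp add: square_def)
  have em: "emeasure lborel (square n) = ennreal ((real n)\<^sup>2)"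
  proof -
    have "emeasure lborel (square n) = emeasure (lborel \<Otimes>\<^sub>M lborel) ({0..real n} \<times> {0..real n})"
      unfolding sq lborel_prod ..
    also have "\<dots> = ennreal (real n) * ennreal (real n)"
      by (subst lborel.emeasure_pair_measure_Times) auto
    finally show ?thesis by (simp add: ennreal_mult[symmetric] power2_eq_square)
  qed
  interpret \<mu>: prob_space \<mu>
    unfolding \<mu>_def by (rule prob_space_uniform_measure) (use n in \<open>auto simp: em\<close>)
  have finG: "finite G" by (rule finite_subset[OF G]) simp
  let ?c = "real q / real n"
  have c: "?c > 0" using n q by simp
  have sub: "gcell ?c g \<subseteq> square n" if "g \<in> G" for g
    using that G by (intro gcell_subset_square n q) auto
  have mu: "emeasure \<mu> (gcell ?c g) = ennreal (1 / (real q)\<^sup>2)" if "g \<in> G" for g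
  proof -
    have "emeasure \<mu> (gcell ?c g) = emeasure lborel (square n \<inter> gcell ?c g) / emeasure lborel (square n)"
      unfolding \<mu>_def using gcell_borel[OF c] sqb by (intro emeasure_uniform_measure) auto
    also have "square n \<inter> gcell ?c g = gcell ?c g" using sub[OF that] by blast
    also have "emeasure lborel (gcell ?c g) / emeasure lborel (square n) = ennreal (1 / (real q)\<^sup>2)"
      unfolding emeasure_gcell[OF c] em using n q
      by (simp add: divide_ennreal power_divide field_simps)
    finally show ?thesis .
  qed
  interpret P: product_prob_space "\<lambda>_. \<mu>" "{..<N}" by unfold_locales
  define F where "F = balanced j {..<N} G"
  have finF: "finite F" unfolding F_def using finG by (intro finite_balanced) auto
  define B where "B a = (\<Pi>\<^sub>E i\<in>{..<N}. gcell ?c (a i))" for a :: "nat \<Rightarrow> int \<times> int"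
  have aG: "a i \<in> G" if "a \<in> F" "i < N" for a i using that by (auto simp: F_def balanced_def)
  have setsB: "B a \<in> sets (unif_points n N)" if "a \<in> F" for a
    unfolding unif_points_def B_def \<mu>_def[symmetric]
    by (rule sets_PiM_I_finite) (auto simp: \<mu>_def gcell_borel[OF c])
  have probB: "measure (unif_points n N) (B a) = (1 / (real q)\<^sup>2) ^ N" if "a \<in> F" for a
  proof -
    have "emeasure (Pi\<^sub>M {..<N} (\<lambda>_. \<mu>)) (B a) = (\<Prod>i<N. emeasure \<mu> (gcell ?c (a i)))"
      unfolding B_def by (rule P.emeasure_PiM) (auto simp: \<mu>_def gcell_borel[OF c])
    also have "\<dots> = ennreal ((1 / (real q)\<^sup>2) ^ N)"
      using aG[OF that] by (simp add: mu ennreal_power)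
    finally show ?thesis unfolding unif_points_def \<mu>_def[symmetric] by (simp add: measure_def)
  qed
  have disj: "disjoint_family_on B F"
    unfolding disjoint_family_on_def
  proof (intro ballI impI)
    fix a b assume ab: "a \<in> F" "b \<in> F" "a \<noteq> b"
    then obtain i where i: "i < N" "a i \<noteq> b i"
      unfolding F_def balanced_def using PiE_ext[of a "{..<N}" "\<lambda>_. G" b] by auto
    show "B a \<inter> B b = {}"
    proof (rule ccontr)
      assume "B a \<inter> B b \<noteq> {}"
      then obtain f where "f i \<in> gcell ?c (a i)" "f i \<in> gcell ?c (b i)" using i(1) by (auto simp: B_def PiE_iff)
      then show False using gcell_disjoint[OF i(2), of ?c] by blast
    qed
  qed
  \<comment> \<open>Different assignments give disjoint boxes, so their probabilities add up. For
    every other number of points the event is empty, and the series over \<open>M\<close> has a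
    single term.\<close>
  define A where "A M = (if M = N then (\<Union>a\<in>F. B a) else {})" for M
  have prob: "measure (unif_points n N) (A N) = card F * (1 / (real q)\<^sup>2) ^ N"
  proof -
    have "prob_space (unif_points n N)"
      unfolding unif_points_def \<mu>_def[symmetric] by (rule P.prob_space_axioms)
    then interpret U: prob_space "unif_points n N" .
    have "measure (unif_points n N) (\<Union>a\<in>F. B a) = (\<Sum>a\<in>F. measure (unif_points n N) (B a))"
      using finF setsB disj by (intro U.finite_measure_finite_Union) auto
    then show ?thesis by (simp add: A_def probB)
  qed
  show ?thesis
    unfolding poisson_prob_ge_def
  proof (intro exI[of _ A] conjI allI ballI)
    show "A M \<in> sets (unif_points n M)" for M
      using finF setsB by (auto simp: A_def intro!: sets.finite_UN)
    show "E (f ` {..<M})" if fA: "f \<in> A M" for M f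
    proof -
      obtain a where a: "a \<in> F" "f \<in> B a" and M: "M = N" using fA by (auto simp: A_def split: if_splits)
      have "{i. i < N \<and> a i = g} = {i \<in> {..<N}. a i = g}" for g by auto
      then show ?thesis unfolding M N_def
        by (intro E[where a=a]) (use a in \<open>auto simp: F_def balanced_def B_def PiE_iff N_def[symmetric]\<close>)
    qed
    have "(\<Sum>M. poisson_weight n M * measure (unif_points n M) (A M)) =
       (\<Sum>M\<in>{N}. poisson_weight n M * measure (unif_points n M) (A M))"
      by (rule suminf_finite) (auto simp: A_def)
    also have "\<dots> = exp (- (real n ^ 2)) * (real n ^ 2) ^ N / fact N * (card F * (1 / (real q)\<^sup>2) ^ N)"
      by (simp add: prob poisson_weight_def)
    finally have s: "(\<Sum>M. poisson_weight n M * measure (unif_points n M) (A M)) =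
        exp (- (real n ^ 2)) * ((real n ^ 2 / real q ^ 2) ^ N * (card F / fact N))"
      by (simp add: power_divide field_simps)
    have "fact N \<le> card F * fact j ^ card G"
      using card_balanced[OF finG, of "{..<N}" j] by (simp add: F_def N_def)
    then have "real (fact N) \<le> real (card F * fact j ^ card G)" by (simp only: of_nat_le_iff)
    then have "1 / fact j ^ card G \<le> (card F / fact N :: real)" by (simp add: field_simps)
    then have "(real n ^ 2 / real q ^ 2) ^ N * (1 / fact j ^ card G) \<le> (real n ^ 2 / real q ^ 2) ^ N * (card F / fact N)"
      by (intro mult_left_mono) auto
    moreover have "((real n ^ 2 / real q ^ 2) ^ j / fact j) ^ card G = (real n ^ 2 / real q ^ 2) ^ N * (1 / fact j ^ card G)"
    proof -
      have "(x ^ j / fact j) ^ card G = x ^ N * (1 / fact j ^ card G)" for x :: real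
        by (simp add: power_divide N_def power_mult)
      then show ?thesis .
    qed
    ultimately show "exp (- (real n ^ 2)) * ((real n ^ 2 / real q ^ 2) ^ j / fact j) ^ card G \<le>
        (\<Sum>M. poisson_weight n M * measure (unif_points n M) (A M))"
      unfolding s by (intro mult_left_mono) auto
  qed
qed

lemma poisson_prob_ge_mono: "poisson_prob_ge n E p \<Longrightarrow> p' \<le> p \<Longrightarrow> poisson_prob_ge n E p'"
  unfolding poisson_prob_ge_def by (meson order.trans)

section \<open>The rough isometry\<close>

text \<open>A block has side at most 2 L, so moving the rescaled image of p to a point of Y in the
  same block costs at most 4 L. Two such moves give the additive error 8 L. On the boundary nothing
  is moved, since \<phi> fixes it.\<close>

lemma rough_embeds_of_occupancy:
  fixes f :: "nat \<Rightarrow> point" and a :: "nat \<Rightarrow> int \<times> int"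
  assumes n: "n > 0" and q: "q > 0" and L: "real n / real q \<le> 2 * L"
    and \<phi>: "bilip M \<phi>" and M: "M > 0"
    and Q1: "\<And>p. p \<in> X \<Longrightarrow> p \<in> square n \<Longrightarrow> (1 / real n) *\<^sub>R p \<in> Q"
    and Q2: "\<And>u. u \<in> Q \<Longrightarrow> u \<in> unit_sq \<and> (\<exists>x\<in>X \<inter> square n. dist (real n *\<^sub>R u) x \<le> 2)"
    and G: "G = {c \<in> {0..<int q} \<times> {0..<int q}. gcell (real q) c \<inter> \<phi> ` Q \<noteq> {}}"
    and a: "\<And>i. i < N \<Longrightarrow> a i \<in> G \<and> f i \<in> gcell (real q / real n) (a i)"
    and occ: "\<And>g. g \<in> G \<Longrightarrow> \<exists>i<N. a i = g"
  shows "rough_embeds M (8 * L) (8 * L + 2 * M) n X (f ` {..<N})"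
proof -
  let ?U = "unit_sq" and ?Y = "f ` {..<N}"
  define \<Phi> where "\<Phi> p = real n *\<^sub>R \<phi> ((1 / real n) *\<^sub>R p)" for p
  have n0: "real n > 0" using n by simp
  have dist_scale: "dist (c *\<^sub>R u) (c *\<^sub>R w) = c * dist u w" if "0 \<le> c" for c and u w :: point
    using that by (simp add: dist_norm flip: scaleR_diff_right)
  have inU: "(1 / real n) *\<^sub>R p \<in> ?U" if "p \<in> square n" for p
    using that n0 unfolding mem_square mem_unit by (simp add: field_simps)
  have frU: "(1 / real n) *\<^sub>R p \<in> frontier ?U" if "p \<in> frontier (square n)" for p
  proof -
    have "p \<in> square n" and c: "fst p = 0 \<or> fst p = real n \<or> snd p = 0 \<or> snd p = real n"
      using that by (auto simp: mem_frontier_square)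
    then show ?thesis unfolding frontier_unit using inU n0 by auto
  qed
  have \<phi>U: "\<phi> u \<in> ?U" if "u \<in> ?U" for u using \<phi> that unfolding bilip_def by blast
  have \<phi>fr: "\<phi> u = u" if "u \<in> frontier ?U" for u using \<phi> that unfolding bilip_def by blast
  have \<phi>d: "dist u w \<le> M * dist (\<phi> u) (\<phi> w)" "dist (\<phi> u) (\<phi> w) \<le> M * dist u w" if "u \<in> ?U" "w \<in> ?U" for u w
    using \<phi> that unfolding bilip_def by blast+
  have \<Phi>fr: "\<Phi> p = p" if "p \<in> frontier (square n)" for p
    unfolding \<Phi>_def \<phi>fr[OF frU[OF that]] using n0 by simp
  have \<Phi>d: "dist p p' / M \<le> dist (\<Phi> p) (\<Phi> p')" "dist (\<Phi> p) (\<Phi> p') \<le> M * dist p p'"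
    if p: "p \<in> square n" "p' \<in> square n" for p p'
  proof -
    let ?u = "(1 / real n) *\<^sub>R p" and ?w = "(1 / real n) *\<^sub>R p'"
    have d: "dist ?u ?w = dist p p' / real n" using dist_scale[of "1 / real n" p p'] n0 by simp
    have D: "dist (\<Phi> p) (\<Phi> p') = real n * dist (\<phi> ?u) (\<phi> ?w)" unfolding \<Phi>_def using n0 by (intro dist_scale) simp
    from \<phi>d[OF inU[OF p(1)] inU[OF p(2)]]
    show "dist p p' / M \<le> dist (\<Phi> p) (\<Phi> p')" "dist (\<Phi> p) (\<Phi> p') \<le> M * dist p p'"
      unfolding d D using n0 M by (simp_all add: field_simps)
  qed
  have near: "dist z (real n *\<^sub>R u) \<le> 4 * L" if z: "z \<in> gcell (real q / real n) c" and u: "u \<in> gcell (real q) c" for z u c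
  proof -
    have c0: "real q / real n > 0" using n q by simp
    have *: "\<bar>s - real n * t\<bar> \<le> 2 * L" if "\<lfloor>real q / real n * s\<rfloor> = \<lfloor>real q * t\<rfloor>" for s t
    proof -
      have "real q / real n * (real n * t) = real q * t" using n0 by simp
      then have "\<bar>real q / real n * s - real q / real n * (real n * t)\<bar> \<le> 1" using that by linarith
      moreover have "\<bar>\<kappa> * s - \<kappa> * w\<bar> = \<kappa> * \<bar>s - w\<bar>" if "0 < \<kappa>" for \<kappa> w :: real
        using that unfolding right_diff_distrib[symmetric] by (simp add: abs_mult)
      ultimately have "real q / real n * \<bar>s - real n * t\<bar> \<le> 1" using c0 by (simp only:)
      then have "\<bar>s - real n * t\<bar> \<le> real n / real q" using n q by (simp add: field_simps)
      then show ?thesis using L by (rule order.trans)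
    qed
    have "dist z (real n *\<^sub>R u) \<le> \<bar>fst z - real n * fst u\<bar> + \<bar>snd z - real n * snd u\<bar>"
      using dist_Pair_bounds(3)[of "fst z" "snd z" "real n * fst u" "real n * snd u"]
      by (cases z, cases u) simp
    also have "\<dots> \<le> 2 * L + 2 * L"
      using z u by (intro add_mono *) (auto simp: gcell_def)
    finally show ?thesis by simp
  qed
  have L0: "0 \<le> L" using L n q by (smt (verit) divide_nonneg_nonneg of_nat_0_le_iff)
  have Gsub: "G \<subseteq> {0..<int q} \<times> {0..<int q}" unfolding G by blast
  have Ysq: "f i \<in> square n" if "i < N" for i
    using a[OF that] gcell_subset_square[OF n q] Gsub by blast
  have ex: "\<exists>t. t \<in> Xn ?Y n \<and> dist t (\<Phi> p) \<le> 4 * L \<and> (p \<in> frontier (square n) \<longrightarrow> t = p)" if p: "p \<in> Xn X n" for p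
  proof (cases "p \<in> frontier (square n)")
    case True
    then show ?thesis using L0 \<Phi>fr[OF True] by (intro exI[of _ p]) (simp add: Xn_def)
  next
    case False
    then have pX: "p \<in> X" "p \<in> square n" using p by (auto simp: Xn_def)
    define u where "u = \<phi> ((1 / real n) *\<^sub>R p)"
    have uU: "u \<in> ?U" unfolding u_def using \<phi>U inU pX(2) by blast
    have uQ: "u \<in> \<phi> ` Q" unfolding u_def using Q1[OF pX] by blast
    \<comment> \<open>An interior point cannot be mapped to the boundary, since \<phi> is injective
      and fixes every boundary point. This is needed because the half-open blocks do not contain the
      sides where a coordinate is 1.\<close>
    have unf: "u \<notin> frontier ?U"
    proof
      assume "u \<in> frontier ?U"
      then have "\<phi> u = \<phi> ((1 / real n) *\<^sub>R p)" using \<phi>fr u_def by simp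
      then have "u = (1 / real n) *\<^sub>R p"
        using \<phi>d(1)[OF uU inU[OF pX(2)]] by simp
      then have "(1 / real n) *\<^sub>R p \<in> frontier ?U" using \<open>u \<in> frontier ?U\<close> by simp
      then have "p \<in> frontier (square n)"
        unfolding frontier_unit mem_frontier_square using n0 pX(2) by auto
      then show False using False by simp
    qed
    then have u01: "0 \<le> fst u" "fst u < 1" "0 \<le> snd u" "snd u < 1"
      using uU unfolding frontier_unit mem_unit by auto
    define c where "c = (\<lfloor>real q * fst u\<rfloor>, \<lfloor>real q * snd u\<rfloor>)"
    have uc: "u \<in> gcell (real q) c" by (simp add: gcell_def c_def)
    have "\<lfloor>real q * t\<rfloor> \<in> {0..<int q}" if "0 \<le> t" "t < 1" for t
    proof -
      have "real q * t < real q" using that q by simp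
      then show ?thesis using that by (simp add: floor_less_iff)
    qed
    then have "c \<in> G" unfolding G using u01 uc uQ by (auto simp: c_def)
    then obtain i where i: "i < N" "a i = c" using occ by blast
    have "dist (f i) (\<Phi> p) \<le> 4 * L" unfolding \<Phi>_def u_def[symmetric]
      by (rule near[OF _ uc]) (use a[OF i(1)] i(2) in simp)
    then show ?thesis using False Ysq[OF i(1)] i(1) by (intro exI[of _ "f i"]) (auto simp: Xn_def)
  qed
  then obtain T where T: "\<And>p. p \<in> Xn X n \<Longrightarrow> T p \<in> Xn ?Y n \<and> dist (T p) (\<Phi> p) \<le> 4 * L \<and>
      (p \<in> frontier (square n) \<longrightarrow> T p = p)" by metis
  have Xsq: "p \<in> square n" if "p \<in> Xn X n" for p using that by (auto simp: Xn_def mem_frontier_square)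
  have "rough_isometry M (8 * L) (8 * L + 2 * M) (Xn X n) (Xn ?Y n) T"
    unfolding rough_isometry_def
  proof (intro conjI ballI)
    show "T ` Xn X n \<subseteq> Xn ?Y n" using T by blast
  next
    fix p p' assume p: "p \<in> Xn X n" "p' \<in> Xn X n"
    have t: "dist (T p) (\<Phi> p) \<le> 4 * L" "dist (T p') (\<Phi> p') \<le> 4 * L" using T p by auto
    have 1: "dist (\<Phi> p) (\<Phi> p') \<le> dist (T p) (\<Phi> p) + dist (T p) (T p') + dist (T p') (\<Phi> p')"
      using dist_triangle[of "\<Phi> p" "\<Phi> p'" "T p"] dist_triangle[of "T p" "\<Phi> p'" "T p'"]
        dist_commute[of "\<Phi> p" "T p"] by linarith
    have 2: "dist (T p) (T p') \<le> dist (T p) (\<Phi> p) + dist (\<Phi> p) (\<Phi> p') + dist (T p') (\<Phi> p')"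
      using dist_triangle[of "T p" "T p'" "\<Phi> p"] dist_triangle[of "\<Phi> p" "T p'" "\<Phi> p'"]
        dist_commute[of "\<Phi> p'" "T p'"] by linarith
    show "dist p p' / M - 8 * L \<le> dist (T p) (T p')"
      using 1 t \<Phi>d(1)[OF Xsq[OF p(1)] Xsq[OF p(2)]] by linarith
    show "dist (T p) (T p') \<le> M * dist p p' + 8 * L"
      using 2 t \<Phi>d(2)[OF Xsq[OF p(1)] Xsq[OF p(2)]] by linarith
  next
    fix y assume y: "y \<in> Xn ?Y n"
    show "\<exists>x\<in>Xn X n. dist (T x) y \<le> 8 * L + 2 * M"
    proof (cases "y \<in> frontier (square n)")
      case True
      then have yX: "y \<in> Xn X n" by (simp add: Xn_def)
      moreover have "T y = y" using T[OF yX] True by simp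
      ultimately show ?thesis using L0 M by (intro bexI[of _ y]) auto
    next
      case False
      then obtain i where i: "i < N" "y = f i" using y by (auto simp: Xn_def)
      \<comment> \<open>The block of \<open>y\<close> contains some \<phi>(u) with \<open>u\<close>
        in \<open>Q\<close>, and the rescaled \<open>u\<close> is within 2 of a point
        \<open>x\<close> of X. The three errors are 4 L, 2 M and 4 L.\<close>
      obtain u where u: "u \<in> Q" "\<phi> u \<in> gcell (real q) (a i)" using a[OF i(1)] unfolding G by blast
      obtain x where x: "x \<in> X" "x \<in> square n" "dist (real n *\<^sub>R u) x \<le> 2" using Q2[OF u(1)] by blast
      have uU: "u \<in> ?U" using Q2[OF u(1)] by blast
      have nu: "real n *\<^sub>R u \<in> square n" using uU n0 unfolding mem_square mem_unit by simp
      have xX: "x \<in> Xn X n" using x by (simp add: Xn_def)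
      have "\<Phi> (real n *\<^sub>R u) = real n *\<^sub>R \<phi> u" unfolding \<Phi>_def using n0 by simp
      then have 1: "dist y (\<Phi> (real n *\<^sub>R u)) \<le> 4 * L" using near[OF conjunct2[OF a[OF i(1)]] u(2)] i(2) by simp
      have "dist (\<Phi> (real n *\<^sub>R u)) (\<Phi> x) \<le> M * dist (real n *\<^sub>R u) x" using \<Phi>d(2)[OF nu x(2)] .
      also have "\<dots> \<le> M * 2" using x(3) M by (intro mult_left_mono) auto
      finally have 2: "dist (\<Phi> (real n *\<^sub>R u)) (\<Phi> x) \<le> 2 * M" by simp
      have 3: "dist (T x) (\<Phi> x) \<le> 4 * L" using T[OF xX] by simp
      have "dist (T x) y \<le> dist (T x) (\<Phi> x) + dist (\<Phi> (real n *\<^sub>R u)) (\<Phi> x) + dist y (\<Phi> (real n *\<^sub>R u))"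
        using dist_triangle[of "T x" y "\<Phi> x"] dist_triangle[of "\<Phi> x" y "\<Phi> (real n *\<^sub>R u)"]
          dist_commute[of "\<Phi> (real n *\<^sub>R u)" y] dist_commute[of "\<Phi> (real n *\<^sub>R u)" "\<Phi> x"] by linarith
      then show ?thesis using 1 2 3 xX by (intro bexI[of _ x]) linarith+
    qed
  qed
  then show ?thesis unfolding rough_embeds_def using T by (intro exI[of _ T]) (auto simp: Xn_def)
qed

text \<open>\<open>Q\<close> is the rescaled union of the closed unit squares counted by
  \<open>kX\<close>. Closed squares make \<open>Q\<close> compact; they overlap in their edges, so
  the area is bounded below through the disjoint half-open cells inside them. The distance 2 bounds
  the diameter of a unit square.\<close>

lemma occupied_region:
  assumes n: "n > 0"
  obtains Q where "compact Q" "Q \<subseteq> unit_sq" "real (kX X n) / (real n)\<^sup>2 \<le> measure lborel Q"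
    "\<And>p. p \<in> X \<Longrightarrow> p \<in> square n \<Longrightarrow> (1 / real n) *\<^sub>R p \<in> Q"
    "\<And>u. u \<in> Q \<Longrightarrow> u \<in> unit_sq \<and> (\<exists>x\<in>X \<inter> square n. dist (real n *\<^sub>R u) x \<le> 2)"
proof -
  have n0: "real n > 0" using n by simp
  define K where "K = {(j :: int, l :: int). 0 \<le> j \<and> j + 1 \<le> int n \<and> 0 \<le> l \<and> l + 1 \<le> int n \<and>
      (\<exists>p\<in>X. p \<in> cbox (real_of_int j, real_of_int l) (real_of_int j + 1, real_of_int l + 1))}"
  define R :: "int \<times> int \<Rightarrow> point set" where
    "R c = cbox (real_of_int (fst c) / real n, real_of_int (snd c) / real n)
       ((real_of_int (fst c) + 1) / real n, (real_of_int (snd c) + 1) / real n)" for c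
  define Q where "Q = (\<Union>c\<in>K. R c)"
  have Ksub: "K \<subseteq> {0..<int n} \<times> {0..<int n}" by (auto simp: K_def)
  have finK: "finite K" by (rule finite_subset[OF Ksub]) simp
  have cQ: "compact Q" unfolding Q_def R_def using finK by (intro compact_UN) auto
  have memR: "u \<in> R c \<longleftrightarrow> real_of_int (fst c) \<le> real n * fst u \<and> real n * fst u \<le> real_of_int (fst c) + 1 \<and>
      real_of_int (snd c) \<le> real n * snd u \<and> real n * snd u \<le> real_of_int (snd c) + 1" for u c
    using n0 by (cases u) (simp add: R_def field_simps)
  have Kb: "0 \<le> real_of_int (fst c)" "real_of_int (fst c) + 1 \<le> real n"
      "0 \<le> real_of_int (snd c)" "real_of_int (snd c) + 1 \<le> real n" if "c \<in> K" for c
  proof -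
    have "0 \<le> fst c \<and> fst c + 1 \<le> int n \<and> 0 \<le> snd c \<and> snd c + 1 \<le> int n" using that by (auto simp: K_def)
    then show "0 \<le> real_of_int (fst c)" "real_of_int (fst c) + 1 \<le> real n"
      "0 \<le> real_of_int (snd c)" "real_of_int (snd c) + 1 \<le> real n" by linarith+
  qed
  have RU: "u \<in> unit_sq" if "c \<in> K" "u \<in> R c" for u c
  proof -
    have "0 \<le> real n * fst u" "real n * fst u \<le> real n * 1" "0 \<le> real n * snd u" "real n * snd u \<le> real n * 1"
      using that(2) Kb[OF that(1)] unfolding memR by linarith+
    then show ?thesis unfolding mem_unit using n0 by (simp_all add: zero_le_mult_iff)
  qed
  show thesis
  proof (rule that[of Q])
    show "compact Q" by (rule cQ)
    show QU: "Q \<subseteq> unit_sq" using RU by (auto simp: Q_def)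
    have "gcell (real n) c \<subseteq> R c" for c
      unfolding gcell_def by (auto simp: memR) linarith+
    then have sub: "(\<Union>c\<in>K. gcell (real n) c) \<subseteq> Q" unfolding Q_def by blast
    have "real (kX X n) / (real n)\<^sup>2 = measure lborel (\<Union>c\<in>K. gcell (real n) c)"
      using measure_gcells[OF n0 finK] by (simp add: kX_def K_def)
    also have "\<dots> \<le> measure lborel Q"
      using sub cQ finK gcell_borel[OF n0] emeasure_compact_finite[OF cQ]
      by (intro measure_mono_fmeasurable) (auto simp: fmeasurable_def borel_compact intro!: sets.finite_UN)
    finally show "real (kX X n) / (real n)\<^sup>2 \<le> measure lborel Q" .
    show "(1 / real n) *\<^sub>R p \<in> Q" if p: "p \<in> X" "p \<in> square n" for p
    proof -
      \<comment> \<open>On the far side t = n the floor would name a square outside; the last closed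
        square, with index n - 1, takes this point.\<close>
      have "\<exists>j::int. 0 \<le> j \<and> j + 1 \<le> int n \<and> of_int j \<le> t \<and> t \<le> of_int j + 1" if "0 \<le> t" "t \<le> real n" for t
      proof (cases "t = real n")
        case True
        then show ?thesis using n by (intro exI[of _ "int n - 1"]) auto
      next
        case False
        then have "\<lfloor>t\<rfloor> < int n" using that by (simp add: floor_less_iff)
        then have "\<lfloor>t\<rfloor> + 1 \<le> int n" by simp
        moreover have "0 \<le> \<lfloor>t\<rfloor>" using that by simp
        moreover have "of_int \<lfloor>t\<rfloor> \<le> t" "t \<le> of_int \<lfloor>t\<rfloor> + 1" by linarith+
        ultimately show ?thesis by blast
      qed
      note ex = this
      obtain j where j: "0 \<le> j" "j + 1 \<le> int n" "of_int j \<le> fst p" "fst p \<le> of_int j + 1"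
        using ex[of "fst p"] p(2) unfolding mem_square by blast
      obtain l where l: "0 \<le> l" "l + 1 \<le> int n" "of_int l \<le> snd p" "snd p \<le> of_int l + 1"
        using ex[of "snd p"] p(2) unfolding mem_square by blast
      have "(j, l) \<in> K" unfolding K_def using j l p(1) by (auto intro!: bexI[of _ p] simp: cbox_prod mem_Times_iff)
      moreover have "(1 / real n) *\<^sub>R p \<in> R (j, l)" unfolding memR using j l n0 by simp
      ultimately show ?thesis unfolding Q_def by blast
    qed
    fix u assume "u \<in> Q"
    then obtain c where c: "c \<in> K" "u \<in> R c" unfolding Q_def by blast
    then obtain x where x: "x \<in> X" "x \<in> cbox (real_of_int (fst c), real_of_int (snd c)) (real_of_int (fst c) + 1, real_of_int (snd c) + 1)"
      unfolding K_def by auto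
    have xb: "real_of_int (fst c) \<le> fst x" "fst x \<le> real_of_int (fst c) + 1"
      "real_of_int (snd c) \<le> snd x" "snd x \<le> real_of_int (snd c) + 1"
      using x(2) by (auto simp: cbox_prod mem_Times_iff)
    have "x \<in> square n" unfolding mem_square using xb Kb[OF c(1)] by linarith
    moreover have "dist (real n *\<^sub>R u) x \<le> 2"
    proof -
      have "dist (real n *\<^sub>R u) x \<le> \<bar>real n * fst u - fst x\<bar> + \<bar>real n * snd u - snd x\<bar>"
        using dist_Pair_bounds(3)[of "real n * fst u" "real n * snd u" "fst x" "snd x"]
        by (cases x, cases u) simp
      also have "\<dots> \<le> 1 + 1" using c(2) xb unfolding memR by (intro add_mono) (simp_all add: abs_le_iff)
      finally show ?thesis by simp
    qed
    ultimately show "u \<in> unit_sq \<and> (\<exists>x\<in>X \<inter> square n. dist (real n *\<^sub>R u) x \<le> 2)"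
      using RU[OF c] x(1) by blast
  qed
qed

theorem theorem2:
  fixes \<epsilon> \<delta> :: real
  assumes "\<epsilon> > 0" and "\<delta> > 0"
  shows "\<exists>M D C :: real. M > 0 \<and> D > 0 \<and> C > 0 \<and>
    (\<forall>\<^sub>F n in sequentially. \<forall>X :: point set.
       locally_finite_set X \<and> real (kX X n) \<ge> \<delta> * (real n ^ 2) \<longrightarrow>
       poisson_prob_ge n (\<lambda>Y. rough_embeds M D C n X Y) (exp (- \<epsilon> * (real n ^ 2))))"
proof -
  \<comment> \<open>\<theta> is used twice, once for the share of empty blocks and once for the cost
    of the exact counts, and each use spends \<theta> n^2 of the exponent.\<close>
  define \<theta> where "\<theta> = \<epsilon> / 2"
  have \<theta>: "0 < \<theta>" using assms(1) by (simp add: \<theta>_def)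
  obtain M where M: "M > 0" and fill: "\<And>Q. compact Q \<Longrightarrow> Q \<subseteq> unit_sq \<Longrightarrow> \<delta> \<le> measure lborel Q \<Longrightarrow>
      \<exists>\<phi>. bilip M \<phi> \<and> 1 - \<theta> \<le> measure lborel (\<phi> ` Q)"
    using bilip_fill[OF assms(2) \<theta>] by blast
  obtain s0 where s0: "s0 \<ge> 1" "\<And>s. s \<ge> s0 \<Longrightarrow> exp ((1 - \<theta>) * s) \<le> s ^ nat \<lfloor>s\<rfloor> / fact (nat \<lfloor>s\<rfloor>)"
    using poisson_mode_ge[OF \<theta>] by blast
  define L where "L = nat \<lceil>s0\<rceil>"
  have L: "1 \<le> real L" "s0 \<le> real L" using s0(1) unfolding L_def by linarith+
  have "poisson_prob_ge n (\<lambda>Y. rough_embeds M (8 * real L) (8 * real L + 2 * M) n X Y) (exp (- \<epsilon> * (real n ^ 2)))"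
    if nL: "L \<le> n" and X: "\<delta> * (real n ^ 2) \<le> real (kX X n)" for n X
  proof -
    have L1: "1 \<le> L" using L(1) by simp
    have n: "n > 0" using nL L1 by simp
    \<comment> \<open>For every n \<ge> L the blocks then have a side between L and 2 L, so the
      geometry is uniform in n, and their area is at least L^2 \<ge> s0.\<close>
    define q where "q = n div L"
    have q: "q > 0" using nL L1 by (simp add: q_def div_greater_zero_iff)
    have "q * L \<le> n" by (simp add: q_def)
    moreover have "n \<le> 2 * (q * L)"
    proof -
      have "n = q * L + n mod L" by (simp add: q_def)
      moreover have "n mod L < L" using L1 by simp
      moreover have "L \<le> q * L" using q by simp
      ultimately show ?thesis by linarith
    qed
    ultimately have "real (q * L) \<le> real n" "real n \<le> real (2 * (q * L))" by (simp_all only: of_nat_le_iff)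
    then have nq: "real L \<le> real n / real q" "real n / real q \<le> 2 * real L"
      using q by (simp_all add: field_simps)
    define s where "s = real n ^ 2 / real q ^ 2"
    have "s0 \<le> s"
    proof -
      have "s0 \<le> real L * 1" using L by simp
      also have "\<dots> \<le> real L * real L" using L by (intro mult_left_mono) auto
      also have "\<dots> \<le> (real n / real q) * (real n / real q)" using nq L by (intro mult_mono) auto
      finally show ?thesis by (simp add: s_def power2_eq_square)
    qed
    \<comment> \<open>The most likely number of points in a block of area s.\<close>
    define j where "j = nat \<lfloor>s\<rfloor>"
    have "1 \<le> s" using \<open>s0 \<le> s\<close> s0(1) by linarith
    then have j: "j > 0" unfolding j_def by simp
    obtain Q where Q: "compact Q" "Q \<subseteq> unit_sq" "real (kX X n) / (real n)\<^sup>2 \<le> measure lborel Q"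
      and Q1: "\<And>p. p \<in> X \<Longrightarrow> p \<in> square n \<Longrightarrow> (1 / real n) *\<^sub>R p \<in> Q"
      and Q2: "\<And>u. u \<in> Q \<Longrightarrow> u \<in> unit_sq \<and> (\<exists>x\<in>X \<inter> square n. dist (real n *\<^sub>R u) x \<le> 2)"
      using occupied_region[OF n, of X] by blast
    have "\<delta> \<le> real (kX X n) / (real n)\<^sup>2" using X n by (simp add: field_simps)
    then have "\<delta> \<le> measure lborel Q" using Q(3) by (rule order.trans)
    then obtain \<phi> where \<phi>: "bilip M \<phi>" and big: "1 - \<theta> \<le> measure lborel (\<phi> ` Q)" using fill[OF Q(1,2)] by blast
    define A where "A = {0..<int q} \<times> {0..<int q}"
    define G where "G = {c \<in> A. gcell (real q) c \<inter> \<phi> ` Q \<noteq> {}}"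
    define H where "H = A - G"
    have finA: "finite A" and cardA: "card A = q * q" by (simp_all add: A_def card_cartesian_product)
    have GA: "G \<subseteq> A" by (auto simp: G_def)
    have q0: "real q > 0" using q by simp
    \<comment> \<open>The blocks in \<open>H\<close> miss \<phi>(Q), so together they fit into its
      complement, of area at most \<theta>.\<close>
    have cH: "real (card H) / (real q)\<^sup>2 \<le> \<theta>"
    proof -
      have cQ: "compact (\<phi> ` Q)"
        by (rule compact_continuous_image[OF continuous_on_subset[OF bilip_continuous[OF \<phi>] Q(2)] Q(1)])
      have QU: "\<phi> ` Q \<subseteq> unit_sq" using \<phi> Q(2) unfolding bilip_def by blast
      have gU: "gcell (real q) c \<subseteq> unit_sq" if "c \<in> A" for c
        using gcell_subset_square[of 1 q c] q that by (simp add: A_def square_def)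
      have sub: "(\<Union>c\<in>H. gcell (real q) c) \<subseteq> unit_sq - \<phi> ` Q"
        using gU by (auto simp: H_def G_def)
      have finH: "finite H" using finA by (simp add: H_def)
      have one: "measure lborel (unit_sq) = 1"
        by (subst content_cbox_if) (simp add: Basis_prod_def cbox_Pair_eq_0)
      have "real (card H) / (real q)\<^sup>2 = measure lborel (\<Union>c\<in>H. gcell (real q) c)"
        using measure_gcells[OF q0 finH] by simp
      also have "\<dots> \<le> measure lborel (unit_sq - \<phi> ` Q)"
      proof (rule measure_mono_fmeasurable[OF sub])
        show "(\<Union>c\<in>H. gcell (real q) c) \<in> sets lborel"
          using finH gcell_borel[OF q0] by (intro sets.finite_UN) auto
        show "unit_sq - \<phi> ` Q \<in> fmeasurable lborel"
          using borel_compact[OF cQ] by (intro fmeasurable_Diff) auto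
      qed
      also have "\<dots> = measure lborel (unit_sq) - measure lborel (\<phi> ` Q)"
        using QU borel_compact[OF cQ] emeasure_compact_finite[OF cQ]
        by (intro measure_Diff) (auto simp: emeasure_lborel_cbox_eq)
      also have "\<dots> \<le> \<theta>" using big one by simp
      finally show ?thesis .
    qed
    have cardG: "real (card G) = real q ^ 2 - real (card H)"
    proof -
      have "card A = card G + card H"
        using card_Un_disjoint[of G H] finA GA finite_subset[OF GA finA] by (simp add: H_def Un_absorb1)
      then have "real (card A) = real (card G) + real (card H)" by simp
      then show ?thesis by (simp add: cardA power2_eq_square)
    qed
    have "poisson_prob_ge n (\<lambda>Y. rough_embeds M (8 * real L) (8 * real L + 2 * M) n X Y)
      (exp (- (real n ^ 2)) * (s ^ j / fact j) ^ card G)"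
      unfolding s_def
    proof (rule poisson_occupancy[OF n q])
      show "G \<subseteq> {0..<int q} \<times> {0..<int q}" using GA by (simp add: A_def)
      fix a f
      assume a1: "\<forall>i<j * card G. a i \<in> G \<and> f i \<in> gcell (real q / real n) (a i)"
        and a2: "\<forall>g\<in>G. card {i. i < j * card G \<and> a i = g} = j"
      show "rough_embeds M (8 * real L) (8 * real L + 2 * M) n X (f ` {..<j * card G})"
      proof (rule rough_embeds_of_occupancy[OF n q nq(2) \<phi> M Q1 Q2])
        show "G = {c \<in> {0..<int q} \<times> {0..<int q}. gcell (real q) c \<inter> \<phi> ` Q \<noteq> {}}" by (simp add: G_def A_def)
        show "a i \<in> G \<and> f i \<in> gcell (real q / real n) (a i)" if "i < j * card G" for i using a1 that by blast
        show "\<exists>i<j * card G. a i = g" if "g \<in> G" for g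
        proof (rule ccontr)
          assume "\<not> ?thesis"
          then have "{i. i < j * card G \<and> a i = g} = {}" by blast
          then have "card {i. i < j * card G \<and> a i = g} = 0" by simp
          then show False using a2 that j by simp
        qed
      qed
    qed
    moreover have "exp (- \<epsilon> * (real n ^ 2)) \<le> exp (- (real n ^ 2)) * (s ^ j / fact j) ^ card G"
    \<comment> \<open>The identity s q^2 = n^2 gives s |G| = n^2 - s |H|, and s |H| \<le> \<theta>
      n^2. Hence the exponent - n^2 + (1 - \<theta>) s |G| is at least - 2 \<theta> n^2 = -
      \<epsilon> n^2.\<close>
    proof -
      have sq: "s * real q ^ 2 = real n ^ 2" using q0 by (simp add: s_def)
      have sH: "s * real (card H) \<le> \<theta> * real n ^ 2"
      proof -
        have "s * real (card H) = real n ^ 2 * (real (card H) / (real q)\<^sup>2)" by (simp add: s_def)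
        also have "\<dots> \<le> real n ^ 2 * \<theta>" using cH by (intro mult_left_mono) auto
        finally show ?thesis by (simp add: mult.commute)
      qed
      have "0 \<le> \<theta> * (s * real (card H))" using \<theta> \<open>1 \<le> s\<close> by simp
      moreover have "(1 - \<theta>) * s * real (card G) =
          real n ^ 2 - \<theta> * real n ^ 2 - s * real (card H) + \<theta> * (s * real (card H))"
      proof -
        have "(1 - \<theta>) * s * real (card G) = (1 - \<theta>) * (s * real q ^ 2 - s * real (card H))"
          unfolding cardG by (simp add: algebra_simps)
        then show ?thesis unfolding sq by (simp add: algebra_simps)
      qed
      moreover have "- \<epsilon> * (real n ^ 2) = - (\<theta> * real n ^ 2) - \<theta> * real n ^ 2" by (simp add: \<theta>_def)
      ultimately have "- \<epsilon> * (real n ^ 2) \<le> - (real n ^ 2) + (1 - \<theta>) * s * real (card G)"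
        using sH by linarith
      then have "exp (- \<epsilon> * (real n ^ 2)) \<le> exp (- (real n ^ 2) + (1 - \<theta>) * s * real (card G))" by simp
      also have "\<dots> = exp (- (real n ^ 2)) * exp ((1 - \<theta>) * s) ^ card G"
        unfolding exp_add exp_of_nat_mult[symmetric] by (simp only: mult.commute)
      also have "\<dots> \<le> exp (- (real n ^ 2)) * (s ^ j / fact j) ^ card G"
        using s0(2)[OF \<open>s0 \<le> s\<close>] by (intro mult_left_mono power_mono) (simp_all add: j_def)
      finally show ?thesis .
    qed
    ultimately show ?thesis by (rule poisson_prob_ge_mono)
  qed
  then have "\<forall>\<^sub>F n in sequentially. \<forall>X :: point set.
       locally_finite_set X \<and> real (kX X n) \<ge> \<delta> * (real n ^ 2) \<longrightarrow>
       poisson_prob_ge n (\<lambda>Y. rough_embeds M (8 * real L) (8 * real L + 2 * M) n X Y) (exp (- \<epsilon> * (real n ^ 2)))"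
    by (intro eventually_sequentiallyI[of L]) blast
  moreover have "0 < 8 * real L" "0 < 8 * real L + 2 * M" using L M by simp_all
  ultimately show ?thesis using M by blast
qed

end
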